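(* Let $\varphi\colon A\to B$ be a minimal isogeny between abelian varieties in $\mathcal{I}_h$, let $I=\mathcal{F}(A)$, $J=\mathcal{F}(B)$, $a=\mathcal{F}(\varphi)\in K^\times$, and let $\mathfrak m$ be the unique maximal ideal of $R$ such that $J/aI\simeq R/\mathfrak m$. Then: (i) $\varphi$ is horizontal or vertical, i.e. $\operatorname{End}(A)\subseteq\operatorname{End}(B)$ or $\operatorname{End}(B)\subseteq\operatorname{End}(A)$; (ii) if $\mathfrak m$ is regular then $I$ and $J$ are weakly equivalent; in particular $\varphi$ is horizontal; (iii) if $\varphi$ is vertical then $\mathfrak m$ is singular; (iv) letting $T$ be the larger and $S$ the smaller of the two orders $\operatorname{End}(A),\operatorname{End}(B)$, we have $|T/S|=|R/\mathfrak m|^{\operatorname{len}_R(T/S)}$; in particular $\varphi$ is vertical if and only if $[R:\mathfrak m]$ divides $[T:S]$.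
   Context: Let $q$ be a prime power and $h(x)$ a $q$-Weil polynomial with no repeated complex roots determining an $\mathbb{F}_q$-isogeny class $\mathcal{I}_h$ of ordinary abelian varieties over $\mathbb{F}_q$; all morphisms are over $\mathbb{F}_q$. Let $K=\mathbb{Q}[x]/(h(x))$, $\pi$ the class of $x$, $\overline\pi=q/\pi$, $R=\mathbb{Z}[\pi,\overline\pi]$, $\mathcal{O}_K$ the maximal order. Fractional $R$-ideals are finitely generated $R$-submodules of $K$ containing a unit of $K$; $(J:I)=\{a\in K:aI\subseteq J\}$. $\mathcal{F}$ is Deligne's functor, an equivalence between abelian varieties in $\mathcal{I}_h$ (with $\mathbb{F}_q$-homomorphisms) and fractional $R$-ideals (with $R$-linear maps, which are multiplications by elements of $(J:I)$); in particular $\operatorname{End}(A)=(I:I)$ for $I=\mathcal{F}(A)$, and an isogeny corresponds to some $a\in(J:I)\cap K^\times$. An isogeny of degree $>1$ is minimal if in every factorization $\varphi=\psi_1\circ\psi_2$ one factor is an isomorphism (for a minimal isogeny $J/aI$ is a simple $R$-module). An isogeny $\varphi\colon A\to B$ is horizontal if $\operatorname{End}(A)=\operatorname{End}(B)$, ascending if $\operatorname{End}(A)\subsetneq\operatorname{End}(B)$, descending if $\operatorname{End}(B)\subsetneq\operatorname{End}(A)$, vertical if ascending or descending. A maximal ideal $\mathfrak m$ of $R$ is regular if $R_{\mathfrak m}=\mathcal{O}_{K,\mathfrak m}$ (i.e. the localization is integrally closed), and singular otherwise. Fractional ideals $I,J$ are weakly equivalent if $I\otimes R_{\mathfrak n}\simeq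 J\otimes R_{\mathfrak n}$ for every maximal ideal $\mathfrak n$ of $R$ ($R_{\mathfrak n}$ the completion). *)

theory Defs
  imports
    "HOL-Algebra.Algebra"
    "HOL-Algebra.Algebraic_Closure_Type"
    "HOL-Computational_Algebra.Computational_Algebra"
    "HOL-Number_Theory.Prime_Powers"
    "HOL-Library.Extended_Nat"
    Complex_Main
begin

section \<open>The polynomial and the rings\<close>

definition weil_poly :: "nat \<Rightarrow> int poly \<Rightarrow> bool" where
  "weil_poly q h \<longleftrightarrow>
     Polynomial.lead_coeff h = 1 \<and> even (Polynomial.degree h) \<and>
     (\<forall>z::complex. poly (map_poly of_int h) z = 0 \<longrightarrow> cmod z = sqrt (real q))"

text \<open>
  For a \<open>q\<close>-Weil polynomial of degree \<open>2g\<close>, being ordinary means that the coefficient of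
  \<open>x\<^sup>g\<close> is prime to the characteristic, equivalently to \<open>q\<close>.
\<close>
definition ordinary_poly :: "nat \<Rightarrow> int poly \<Rightarrow> bool" where
  "ordinary_poly q h \<longleftrightarrow>
     coprime (Polynomial.coeff h (Polynomial.degree h div 2)) (int q)"

definition no_repeated_complex_roots :: "int poly \<Rightarrow> bool" where
  "no_repeated_complex_roots h \<longleftrightarrow> rsquarefree (map_poly of_int h :: complex poly)"

definition rat_poly_ring :: "rat poly ring" where
  "rat_poly_ring = ring_of_type_algebra"

definition weil_ideal :: "int poly \<Rightarrow> rat poly set" where
  "weil_ideal h = PIdl\<^bsub>rat_poly_ring\<^esub> (map_poly of_int h)"

definition weil_algebra :: "int poly \<Rightarrow> rat poly set ring" where
  "weil_algebra h = rat_poly_ring Quot weil_ideal h"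

definition weil_class :: "int poly \<Rightarrow> rat poly \<Rightarrow> rat poly set" where
  "weil_class h f = weil_ideal h +>\<^bsub>rat_poly_ring\<^esub> f"

definition frob :: "int poly \<Rightarrow> rat poly set" where
  "frob h = weil_class h [:0, 1:]"

definition verschiebung :: "nat \<Rightarrow> int poly \<Rightarrow> rat poly set" where
  "verschiebung q h =
     weil_class h [:of_nat q:] \<otimes>\<^bsub>weil_algebra h\<^esub> inv\<^bsub>weil_algebra h\<^esub> (frob h)"

definition frob_order :: "nat \<Rightarrow> int poly \<Rightarrow> rat poly set ring" where
  "frob_order q h =
     (weil_algebra h) \<lparr>carrier := generate_ring (weil_algebra h) {frob h, verschiebung q h}\<rparr>"

text \<open>
  The set \<open>generate_ring K {}\<close> is the image of the integers in \<open>K\<close>, so the following is the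
  integral closure of the integers in \<open>K\<close>, that is, the maximal order of an etale algebra.
\<close>
definition maximal_order :: "('a, 'b) ring_scheme \<Rightarrow> 'a set" where
  "maximal_order K =
     {x \<in> carrier K. \<exists>p. set p \<subseteq> generate_ring K {} \<and> p \<noteq> [] \<and> hd p = \<one>\<^bsub>K\<^esub> \<and>
        ring.eval K p x = \<zero>\<^bsub>K\<^esub>}"

section \<open>Modules\<close>

definition submod :: "('a, 'b) ring_scheme \<Rightarrow> 'a set \<Rightarrow> ('a, 'a) module" where
  "submod K I = \<lparr>carrier = I, monoid.mult = monoid.mult K, monoid.one = monoid.one K,
     ring.zero = ring.zero K, ring.add = ring.add K, module.smult = monoid.mult K\<rparr>"

text \<open>
  The record type of modules extends that of rings; the unused multiplicative fields are left
  unspecified.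
\<close>
definition quot_module :: "('r, 'a) module \<Rightarrow> 'a set \<Rightarrow> ('r, 'a set) module" where
  "quot_module M N =
     \<lparr>carrier = a_rcosets\<^bsub>M\<^esub> N, monoid.mult = undefined, monoid.one = undefined, ring.zero = N,
      ring.add = set_add M, module.smult = (\<lambda>r C. \<Union>x\<in>C. N +>\<^bsub>M\<^esub> (r \<odot>\<^bsub>M\<^esub> x))\<rparr>"

definition module_isomorphic ::
    "('r, 'c) ring_scheme \<Rightarrow> ('r, 'a) module \<Rightarrow> ('r, 'b) module \<Rightarrow> bool" where
  "module_isomorphic R M N \<longleftrightarrow>
     (\<exists>f. bij_betw f (carrier M) (carrier N) \<and>
        (\<forall>x\<in>carrier M. \<forall>y\<in>carrier M. f (x \<oplus>\<^bsub>M\<^esub> y) = f x \<oplus>\<^bsub>N\<^esub> f y) \<and>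
        (\<forall>r\<in>carrier R. \<forall>x\<in>carrier M. f (r \<odot>\<^bsub>M\<^esub> x) = r \<odot>\<^bsub>N\<^esub> f x))"

definition module_length :: "('r, 'c) ring_scheme \<Rightarrow> ('r, 'a) module \<Rightarrow> enat" where
  "module_length R M =
     Sup {enat n | n. \<exists>c. (\<forall>i\<le>n. submodule (c i) R M) \<and> (\<forall>i<n. c i \<subset> c (Suc i))}"

section \<open>Fractional ideals\<close>

definition fractional_ideal :: "nat \<Rightarrow> int poly \<Rightarrow> rat poly set set \<Rightarrow> bool" where
  "fractional_ideal q h I \<longleftrightarrow>
     (\<exists>us. set us \<subseteq> carrier (weil_algebra h) \<and>
        I = ring.Span (weil_algebra h) (carrier (frob_order q h)) us) \<and>
     I \<inter> Units (weil_algebra h) \<noteq> {}"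

definition colon :: "('a, 'b) ring_scheme \<Rightarrow> 'a set \<Rightarrow> 'a set \<Rightarrow> 'a set" where
  "colon K J I = {a \<in> carrier K. a <#\<^bsub>K\<^esub> I \<subseteq> J}"

text \<open>
  The order may contain zero divisors outside a maximal ideal, so its localization need not embed
  into \<open>K\<close>.  Fractions are therefore equivalence classes of pairs, and for an \<open>R\<close>-submodule \<open>M\<close>
  of \<open>K\<close> the localization of \<open>M\<close> is regarded as a subset of the localization of \<open>K\<close>.
\<close>
definition loc_fraction ::
    "('a, 'b) ring_scheme \<Rightarrow> 'a set \<Rightarrow> 'a set \<Rightarrow> 'a \<Rightarrow> 'a \<Rightarrow> ('a \<times> 'a) set" where
  "loc_fraction K R m x s =
     {(y, t). y \<in> carrier K \<and> t \<in> R - m \<and>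
        (\<exists>u\<in>R - m. u \<otimes>\<^bsub>K\<^esub> (t \<otimes>\<^bsub>K\<^esub> x) = u \<otimes>\<^bsub>K\<^esub> (s \<otimes>\<^bsub>K\<^esub> y))}"

definition localization ::
    "('a, 'b) ring_scheme \<Rightarrow> 'a set \<Rightarrow> 'a set \<Rightarrow> 'a set \<Rightarrow> ('a \<times> 'a) set set" where
  "localization K R m M = {loc_fraction K R m x s | x s. x \<in> M \<and> s \<in> R - m}"

definition regular_ideal :: "nat \<Rightarrow> int poly \<Rightarrow> rat poly set set \<Rightarrow> bool" where
  "regular_ideal q h m \<longleftrightarrow>
     (let K = weil_algebra h; R = carrier (frob_order q h)
      in localization K R m R = localization K R m (maximal_order K))"

abbreviation singular_ideal :: "nat \<Rightarrow> int poly \<Rightarrow> rat poly set set \<Rightarrow> bool" where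
  "singular_ideal q h m \<equiv> \<not> regular_ideal q h m"

section \<open>Completion, base change and weak equivalence\<close>

abbreviation ideal_power :: "('a, 'b) ring_scheme \<Rightarrow> 'a set \<Rightarrow> nat \<Rightarrow> 'a set" where
  "ideal_power R n k \<equiv> n [^]\<^bsub>ideals_set R\<^esub> k"

text \<open>
  The inverse limit of the rings \<open>R/n\<^sup>k\<close>; a coset modulo \<open>n\<^bsup>k+1\<^esup>\<close> maps to a coset
  modulo \<open>n\<^sup>k\<close> exactly if it is contained in it.
\<close>
definition completion :: "('a, 'b) ring_scheme \<Rightarrow> 'a set \<Rightarrow> (nat \<Rightarrow> 'a set) ring" where
  "completion R n =
     \<lparr>carrier = {f. (\<forall>k. f k \<in> carrier (R Quot ideal_power R n k)) \<and> (\<forall>k. f (Suc k) \<subseteq> f k)},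
      monoid.mult = (\<lambda>f g k. f k \<otimes>\<^bsub>R Quot ideal_power R n k\<^esub> g k),
      monoid.one = (\<lambda>k. \<one>\<^bsub>R Quot ideal_power R n k\<^esub>),
      ring.zero = (\<lambda>k. \<zero>\<^bsub>R Quot ideal_power R n k\<^esub>),
      ring.add = (\<lambda>f g k. f k \<oplus>\<^bsub>R Quot ideal_power R n k\<^esub> g k)\<rparr>"

definition to_completion :: "('a, 'b) ring_scheme \<Rightarrow> 'a set \<Rightarrow> 'a \<Rightarrow> nat \<Rightarrow> 'a set" where
  "to_completion R n r = (\<lambda>k. ideal_power R n k +>\<^bsub>R\<^esub> r)"

definition tensor_relations ::
    "('r, 'c) ring_scheme \<Rightarrow> ('s, 'd) ring_scheme \<Rightarrow> ('r \<Rightarrow> 's) \<Rightarrow> ('r, 'a) module \<Rightarrow>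
     ('a \<times> 's \<Rightarrow>\<^sub>0 int) set" where
  "tensor_relations R S \<iota> M =
     {frag_of (x \<oplus>\<^bsub>M\<^esub> y, t) - frag_of (x, t) - frag_of (y, t) | x y t.
        x \<in> carrier M \<and> y \<in> carrier M \<and> t \<in> carrier S} \<union>
     {frag_of (x, t \<oplus>\<^bsub>S\<^esub> u) - frag_of (x, t) - frag_of (x, u) | x t u.
        x \<in> carrier M \<and> t \<in> carrier S \<and> u \<in> carrier S} \<union>
     {frag_of (r \<odot>\<^bsub>M\<^esub> x, t) - frag_of (x, \<iota> r \<otimes>\<^bsub>S\<^esub> t) | r x t.
        r \<in> carrier R \<and> x \<in> carrier M \<and> t \<in> carrier S}"

text \<open>
  The \<open>S\<close>-module obtained by tensoring \<open>M\<close> over \<open>R\<close> with \<open>S\<close> along \<open>\<iota>\<close>: the free abelian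
  group on pairs modulo the tensor relations, with \<open>S\<close> acting on the second factor.
\<close>
definition base_change ::
    "('r, 'c) ring_scheme \<Rightarrow> ('s, 'd) ring_scheme \<Rightarrow> ('r \<Rightarrow> 's) \<Rightarrow> ('r, 'a) module \<Rightarrow>
     ('s, ('a \<times> 's \<Rightarrow>\<^sub>0 int) set) module" where
  "base_change R S \<iota> M =
     (let G = free_Abelian_group (carrier M \<times> carrier S);
          N = generate G (tensor_relations R S \<iota> M)
      in \<lparr>carrier = rcosets\<^bsub>G\<^esub> N, monoid.mult = undefined, monoid.one = undefined, ring.zero = N,
          ring.add = set_mult G,
          module.smult = (\<lambda>s C. \<Union>c\<in>C. N #>\<^bsub>G\<^esub> frag_extend (\<lambda>(x, t). frag_of (x, s \<otimes>\<^bsub>S\<^esub> t)) c)\<rparr>)"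

definition weakly_equivalent ::
    "nat \<Rightarrow> int poly \<Rightarrow> rat poly set set \<Rightarrow> rat poly set set \<Rightarrow> bool" where
  "weakly_equivalent q h I J \<longleftrightarrow>
     (let K = weil_algebra h; R = frob_order q h
      in \<forall>n. maximalideal n R \<longrightarrow>
           module_isomorphic (completion R n)
             (base_change R (completion R n) (to_completion R n) (submod K I))
             (base_change R (completion R n) (to_completion R n) (submod K J)))"

section \<open>Categories and Deligne's functor\<close>

record ('o, 'm) cat =
  Obj :: "'o set"
  Hom :: "'o \<Rightarrow> 'o \<Rightarrow> 'm set"
  Comp :: "'m \<Rightarrow> 'm \<Rightarrow> 'm"
  Id :: "'o \<Rightarrow> 'm"

text \<open>
  \<open>Comp C g f\<close> is the composite of \<open>g\<close> after \<open>f\<close>.  Morphism sets need not be disjoint, so morphisms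
  are always considered together with a source and a target.
\<close>
definition category :: "('o, 'm, 'x) cat_scheme \<Rightarrow> bool" where
  "category C \<longleftrightarrow>
     (\<forall>A\<in>Obj C. Id C A \<in> Hom C A A) \<and>
     (\<forall>A\<in>Obj C. \<forall>B\<in>Obj C. \<forall>D\<in>Obj C. \<forall>f\<in>Hom C A B. \<forall>g\<in>Hom C B D.
        Comp C g f \<in> Hom C A D) \<and>
     (\<forall>A\<in>Obj C. \<forall>B\<in>Obj C. \<forall>f\<in>Hom C A B. Comp C f (Id C A) = f \<and> Comp C (Id C B) f = f) \<and>
     (\<forall>A\<in>Obj C. \<forall>B\<in>Obj C. \<forall>D\<in>Obj C. \<forall>E\<in>Obj C.
        \<forall>f\<in>Hom C A B. \<forall>g\<in>Hom C B D. \<forall>k\<in>Hom C D E.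
          Comp C k (Comp C g f) = Comp C (Comp C k g) f)"

definition isomorphism :: "('o, 'm, 'x) cat_scheme \<Rightarrow> 'o \<Rightarrow> 'o \<Rightarrow> 'm \<Rightarrow> bool" where
  "isomorphism C A B f \<longleftrightarrow> f \<in> Hom C A B \<and>
     (\<exists>g\<in>Hom C B A. Comp C g f = Id C A \<and> Comp C f g = Id C B)"

definition equivalence_functor ::
    "('o, 'm, 'x) cat_scheme \<Rightarrow> ('p, 'n, 'y) cat_scheme \<Rightarrow> ('o \<Rightarrow> 'p) \<Rightarrow> ('o \<Rightarrow> 'o \<Rightarrow> 'm \<Rightarrow> 'n) \<Rightarrow>
     bool" where
  "equivalence_functor C D F\<^sub>O F\<^sub>M \<longleftrightarrow>
     (\<forall>A\<in>Obj C. F\<^sub>O A \<in> Obj D) \<and>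
     (\<forall>A\<in>Obj C. F\<^sub>M A A (Id C A) = Id D (F\<^sub>O A)) \<and>
     (\<forall>A\<in>Obj C. \<forall>B\<in>Obj C. \<forall>E\<in>Obj C. \<forall>f\<in>Hom C A B. \<forall>g\<in>Hom C B E.
        F\<^sub>M A E (Comp C g f) = Comp D (F\<^sub>M B E g) (F\<^sub>M A B f)) \<and>
     (\<forall>A\<in>Obj C. \<forall>B\<in>Obj C. bij_betw (F\<^sub>M A B) (Hom C A B) (Hom D (F\<^sub>O A) (F\<^sub>O B))) \<and>
     (\<forall>Y\<in>Obj D. \<exists>A\<in>Obj C. \<exists>f. isomorphism D (F\<^sub>O A) Y f)"

text \<open>An \<open>R\<close>-linear map \<open>I \<rightarrow> J\<close> is represented by the element of \<open>(J : I)\<close> it multiplies by.\<close>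
definition fractional_ideal_cat :: "nat \<Rightarrow> int poly \<Rightarrow> (rat poly set set, rat poly set) cat" where
  "fractional_ideal_cat q h =
     \<lparr>Obj = {I. fractional_ideal q h I},
      Hom = (\<lambda>I J. colon (weil_algebra h) J I),
      Comp = monoid.mult (weil_algebra h),
      Id = (\<lambda>_. \<one>\<^bsub>weil_algebra h\<^esub>)\<rparr>"

record ('o, 'm) isog_cat = "('o, 'm) cat" +
  Isog :: "'o \<Rightarrow> 'o \<Rightarrow> 'm set"
  isog_deg :: "'o \<Rightarrow> 'o \<Rightarrow> 'm \<Rightarrow> nat"

text \<open>
  Abelian varieties over finite fields and the construction of Deligne's functor are not available.
  An isogeny class is represented by a category with distinguished isogenies and their degrees, and
  Deligne's functor by a functor with the properties listed here: it is an equivalence onto the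
  category of fractional ideals under which isogenies are the morphisms sent to units of \<open>K\<close>; and,
  as for abelian varieties, the isogenies of degree one are the isomorphisms.
\<close>
definition deligne_functor ::
    "nat \<Rightarrow> int poly \<Rightarrow> ('o, 'm, 'x) isog_cat_scheme \<Rightarrow> ('o \<Rightarrow> rat poly set set) \<Rightarrow>
     ('o \<Rightarrow> 'o \<Rightarrow> 'm \<Rightarrow> rat poly set) \<Rightarrow> bool" where
  "deligne_functor q h V F\<^sub>O F\<^sub>M \<longleftrightarrow>
     category V \<and>
     equivalence_functor V (fractional_ideal_cat q h) F\<^sub>O F\<^sub>M \<and>
     (\<forall>A\<in>Obj V. \<forall>B\<in>Obj V.
        Isog V A B = {\<phi> \<in> Hom V A B. F\<^sub>M A B \<phi> \<in> Units (weil_algebra h)}) \<and>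
     (\<forall>A\<in>Obj V. \<forall>B\<in>Obj V. \<forall>\<phi>\<in>Isog V A B.
        isog_deg V A B \<phi> > 0 \<and> (isog_deg V A B \<phi> = 1 \<longleftrightarrow> isomorphism V A B \<phi>))"

definition minimal_isogeny :: "('o, 'm, 'x) isog_cat_scheme \<Rightarrow> 'o \<Rightarrow> 'o \<Rightarrow> 'm \<Rightarrow> bool" where
  "minimal_isogeny V A B \<phi> \<longleftrightarrow>
     \<phi> \<in> Isog V A B \<and> isog_deg V A B \<phi> > 1 \<and>
     (\<forall>C\<in>Obj V. \<forall>\<psi>\<^sub>2\<in>Hom V A C. \<forall>\<psi>\<^sub>1\<in>Hom V C B. \<phi> = Comp V \<psi>\<^sub>1 \<psi>\<^sub>2 \<longrightarrow>
        isomorphism V C B \<psi>\<^sub>1 \<or> isomorphism V A C \<psi>\<^sub>2)"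

text \<open>
  Endomorphism rings are compared as subsets of \<open>K\<close>, through the functor.
\<close>
definition End_in :: "('o, 'm, 'x) cat_scheme \<Rightarrow> ('o \<Rightarrow> 'o \<Rightarrow> 'm \<Rightarrow> 'k) \<Rightarrow> 'o \<Rightarrow> 'k set" where
  "End_in V F\<^sub>M A = F\<^sub>M A A ` Hom V A A"

definition horizontal ::
    "('o, 'm, 'x) cat_scheme \<Rightarrow> ('o \<Rightarrow> 'o \<Rightarrow> 'm \<Rightarrow> 'k) \<Rightarrow> 'o \<Rightarrow> 'o \<Rightarrow> bool" where
  "horizontal V F\<^sub>M A B \<longleftrightarrow> End_in V F\<^sub>M A = End_in V F\<^sub>M B"

definition ascending ::
    "('o, 'm, 'x) cat_scheme \<Rightarrow> ('o \<Rightarrow> 'o \<Rightarrow> 'm \<Rightarrow> 'k) \<Rightarrow> 'o \<Rightarrow> 'o \<Rightarrow> bool" where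
  "ascending V F\<^sub>M A B \<longleftrightarrow> End_in V F\<^sub>M A \<subset> End_in V F\<^sub>M B"

definition descending ::
    "('o, 'm, 'x) cat_scheme \<Rightarrow> ('o \<Rightarrow> 'o \<Rightarrow> 'm \<Rightarrow> 'k) \<Rightarrow> 'o \<Rightarrow> 'o \<Rightarrow> bool" where
  "descending V F\<^sub>M A B \<longleftrightarrow> End_in V F\<^sub>M B \<subset> End_in V F\<^sub>M A"

definition vertical ::
    "('o, 'm, 'x) cat_scheme \<Rightarrow> ('o \<Rightarrow> 'o \<Rightarrow> 'm \<Rightarrow> 'k) \<Rightarrow> 'o \<Rightarrow> 'o \<Rightarrow> bool" where
  "vertical V F\<^sub>M A B \<longleftrightarrow> ascending V F\<^sub>M A B \<or> descending V F\<^sub>M A B"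

definition cokernel_maximal_ideal ::
    "nat \<Rightarrow> int poly \<Rightarrow> rat poly set set \<Rightarrow> rat poly set set \<Rightarrow> rat poly set \<Rightarrow>
     rat poly set set \<Rightarrow> bool" where
  "cokernel_maximal_ideal q h I J a m \<longleftrightarrow>
     (let K = weil_algebra h; R = frob_order q h
      in maximalideal m R \<and>
         module_isomorphic R (quot_module (submod K J) (a <#\<^bsub>K\<^esub> I))
           (quot_module (submod K (carrier R)) m))"

end

theory Submission
  imports Defs
begin

text \<open>
  Replace \<open>I\<close> by \<open>aI\<close>, which does not change its endomorphism ring.  Minimality of the isogeny means
  that \<open>J/I\<close> is a simple \<open>R\<close>-module; let \<open>m\<close> be its annihilator.

  If some \<open>t \<in> (J:J)\<close> does not map \<open>I\<close> into itself, then \<open>J = I + tI\<close> by simplicity, and every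
  \<open>s \<in> (I:I)\<close> satisfies \<open>sJ = sI + t(sI) \<subseteq> J\<close>; hence the two endomorphism rings are comparable.  From
  \<open>mJ \<subseteq> I\<close> one gets \<open>mT \<subseteq> S\<close> for the larger ring \<open>T\<close> and the smaller ring \<open>S\<close>, so \<open>T/S\<close> is a finite
  vector space over \<open>R/m\<close>.

  Let \<open>m\<close> be regular.  There is \<open>y \<in> K\<close> whose annihilator in \<open>K/R\<close> is exactly \<open>m\<close>.  If
  \<open>L \<cdot> (R:L) \<subseteq> m\<close> for a fractional ideal \<open>L\<close>, then \<open>y\<close> stabilizes \<open>(R:L)\<close>, so \<open>y\<close> is integral and
  \<open>sy \<in> R\<close> for some \<open>s \<notin> m\<close>, a contradiction.  So every \<open>L\<close> is locally principal at \<open>m\<close>, which yields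
  \<open>\<alpha> \<in> (J:I)\<close> and \<open>\<beta> \<in> (I:J)\<close> with \<open>\<alpha>\<beta> \<notin> m\<close>; for a maximal ideal \<open>n \<noteq> m\<close>, the inclusion and an
  element of \<open>m\<close> outside \<open>n\<close> do the same.  An element outside \<open>n\<close> is a unit of the completion at \<open>n\<close>, so
  multiplication by \<open>\<alpha>\<close> becomes an isomorphism after base change.
\<close>

section \<open>Finitely generated abelian groups\<close>

text \<open>\<open>K\<close> is a product of fields, so multiplying by an element outside m may have
  a kernel. Local statements are therefore kept in the form "s x \<in> R for some s \<notin> m", and
  regularity enters only as the existence of such an s for each integral x. Finiteness is taken from
  the additive group: R and all lattices are finitely generated over the integers, and integers
  serve as common denominators. That R is finitely generated is where the Weil condition acts. At a
  root z of h the element q/x takes the value q/z, the complex conjugate of z, which is again a root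
  of h; so q/x satisfies the same monic equation as x. For regular m, equality of the endomorphism
  rings is obtained directly. An element t of the larger ring T is integral, so s t \<in> R with s
  \<notin> m; also m t \<subseteq> S, and 1 is a combination of s and an element of m, whence t
  \<in> S. After base change, multiplication by \<alpha> is inverted by \<beta> \<otimes> s^(-1),
  where s = \<alpha>\<beta> is a unit of the completion.\<close>

lemma (in comm_group) generate_insert_eq:
  assumes "x \<in> carrier G" "U \<subseteq> carrier G"
  shows "generate G (insert x U) = {x [^] (k::int) \<otimes> y | k y. y \<in> generate G U}"
proof
  have gc: "generate G U \<subseteq> carrier G" using generate_incl assms by blast
  let ?L = "{x [^] (k::int) \<otimes> y | k y. y \<in> generate G U}"
  have "subgroup ?L G"
  proof (rule subgroupI)
    show "?L \<subseteq> carrier G" using assms gc by auto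
    show "?L \<noteq> {}" using generate.one by blast
    fix u assume "u \<in> ?L"
    then obtain k y where u: "u = x [^] (k::int) \<otimes> y" "y \<in> generate G U" by blast
    have "inv u = x [^] (-k) \<otimes> inv y" using u assms gc by (auto simp: inv_mult int_pow_neg)
    then show "inv u \<in> ?L" using generate_m_inv_closed[OF assms(2)] u by blast
    fix v assume "v \<in> ?L"
    then obtain l z where v: "v = x [^] (l::int) \<otimes> z" "z \<in> generate G U" by blast
    have "u \<otimes> v = x [^] (k + l) \<otimes> (y \<otimes> z)"
      using u v assms gc by (auto simp: int_pow_mult m_ac subset_iff)
    then show "u \<otimes> v \<in> ?L" using generate.eng[OF u(2) v(2)] by blast
  qed
  moreover have "insert x U \<subseteq> ?L"
  proof -
    have "x = x [^] (1::int) \<otimes> \<one>" using assms by simp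
    moreover have "z = x [^] (0::int) \<otimes> z" if "z \<in> U" for z using assms that by auto
    ultimately show ?thesis using generate.one generate.incl by (fastforce simp del: int_pow_1 int_pow_0)
  qed
  ultimately show "generate G (insert x U) \<subseteq> ?L" by (rule generate_subgroup_incl[rotated])
  have sg: "subgroup (generate G (insert x U)) G" using generate_is_subgroup assms by blast
  show "?L \<subseteq> generate G (insert x U)"
  proof clarify
    fix k :: int and y assume "y \<in> generate G U"
    then have "y \<in> generate G (insert x U)" using mono_generate[of U "insert x U"] by blast
    moreover have "x [^] k \<in> generate G (insert x U)"
      by (rule subgroup_int_pow_closed[OF sg]) (simp add: generate.incl)
    ultimately show "x [^] k \<otimes> y \<in> generate G (insert x U)" by (rule generate.eng[rotated])
  qed
qed

text \<open>Induction on the generators, as for subgroups of a free abelian group: the exponents of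
  \<open>x\<close> that occur in \<open>H\<close> are the multiples of the least positive one,
  \<open>d\<close>. One element \<open>h0\<close> with exponent \<open>d\<close>, together with
  generators of the part of \<open>H\<close> inside \<open>generate G U\<close>, generates
  \<open>H\<close>; if no nonzero exponent occurs, that part is all of \<open>H\<close>.\<close>

lemma (in comm_group) subgroup_finitely_generated:
  assumes "finite U" "U \<subseteq> carrier G" "subgroup H G" "H \<subseteq> generate G U"
  shows "\<exists>Y. finite Y \<and> Y \<subseteq> H \<and> H = generate G Y"
  using assms
proof (induction U arbitrary: H rule: finite_induct)
  case empty
  then have "H = {\<one>}" using generate_empty subgroup.one_closed by blast
  then show ?case using generate_empty by (intro exI[of _ "{}"]) auto
next
  case (insert x U)
  let ?A = "generate G U"
  have x: "x \<in> carrier G" and U: "U \<subseteq> carrier G" using insert by auto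
  have A: "subgroup ?A G" using generate_is_subgroup[OF U] .
  have gc: "?A \<subseteq> carrier G" using generate_incl U by blast
  have hc: "H \<subseteq> carrier G" using insert.prems subgroup.subset by blast
  have "subgroup (H \<inter> ?A) G" using A insert.prems subgroups_Inter_pair by blast
  then obtain Y where Y: "finite Y" "Y \<subseteq> H \<inter> ?A" "H \<inter> ?A = generate G Y"
    using insert.IH[OF U, of "H \<inter> ?A"] by (metis Int_lower2)
  \<comment> \<open>Relations between \<open>x\<close> and \<open>U\<close> are allowed, so the
    exponent of an element is not unique; \<open>D\<close> collects every positive exponent that
    some expression of an element of \<open>H\<close> has. Inverses bring negative exponents into
    \<open>D\<close>.\<close>
  define D where "D = {k::nat. k > 0 \<and> (\<exists>y\<in>?A. x [^] int k \<otimes> y \<in> H)}"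
  have dec: "\<exists>k y. h = x [^] (k::int) \<otimes> y \<and> y \<in> ?A" if "h \<in> H" for h
    using insert.prems that generate_insert_eq[OF x U] by blast
  have Dabs: "nat \<bar>k\<bar> \<in> D" if k: "x [^] (k::int) \<otimes> y \<in> H" "y \<in> ?A" "k \<noteq> 0" for k y
  proof (cases "k > 0")
    case True then show ?thesis using k by (auto simp: D_def)
  next
    case False
    have "inv (x [^] k \<otimes> y) \<in> H" using k insert.prems by (simp add: subgroup.m_inv_closed)
    moreover have "inv (x [^] k \<otimes> y) = x [^] (-k) \<otimes> inv y"
      using k x gc by (auto simp: inv_mult int_pow_neg)
    moreover have "inv y \<in> ?A" using k generate_m_inv_closed[OF U] by blast
    ultimately show ?thesis using k False by (auto simp: D_def)
  qed
  show ?case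
  proof (cases "D = {}")
    case True
    have "H \<subseteq> ?A"
    proof
      fix h assume h: "h \<in> H"
      then obtain k y where k: "h = x [^] (k::int) \<otimes> y" "y \<in> ?A" using dec by blast
      then have "k = 0" using Dabs True h by blast
      then show "h \<in> ?A" using k gc by auto
    qed
    then show ?thesis using Y by (intro exI[of _ Y]) (auto simp: Int_absorb2)
  next
    case False
    define d where "d = (LEAST k. k \<in> D)"
    have dD: "d \<in> D" using False by (metis d_def LeastI ex_in_conv)
    have least: "k \<notin> D" if "k < d" for k using that not_less_Least d_def by metis
    obtain y0 where y0: "y0 \<in> ?A" "x [^] int d \<otimes> y0 \<in> H" "d > 0" using dD by (auto simp: D_def)
    define h0 where "h0 = x [^] int d \<otimes> y0"
    have h0: "h0 \<in> H" "h0 \<in> carrier G" using y0 hc h0_def by auto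
    let ?Y = "insert h0 Y"
    have YH: "?Y \<subseteq> H" using h0 Y by auto
    have "H \<subseteq> generate G ?Y"
    proof
      fix h assume h: "h \<in> H"
      then obtain k y where k: "h = x [^] (k::int) \<otimes> y" "y \<in> ?A" using dec by blast
      define l where "l = k div int d"
      have hl: "h0 [^] l \<in> H" using subgroup_int_pow_closed insert.prems h0 by blast
      have y0l: "y0 [^] l \<in> ?A" using subgroup_int_pow_closed A y0 by blast
      have m: "k - int d * l = k mod int d" by (simp add: l_def minus_mult_div_eq_mod)
      have c: "y \<in> carrier G" "y0 \<in> carrier G" "h \<in> carrier G" using k y0 gc h hc by auto
      have e: "h \<otimes> inv (h0 [^] l) = x [^] (k mod int d) \<otimes> (y \<otimes> inv (y0 [^] l))"
      proof -
        have "h0 [^] l = x [^] (int d * l) \<otimes> y0 [^] l"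
          using c x by (simp add: h0_def int_pow_mult_distrib m_comm int_pow_pow)
        moreover have "x [^] (k mod int d) = x [^] k \<otimes> inv (x [^] (int d * l))"
          using x by (simp add: m[symmetric] int_pow_diff)
        ultimately show ?thesis using k(1) c x by (simp add: inv_mult m_ac)
      qed
      have in_H: "h \<otimes> inv (h0 [^] l) \<in> H"
        using h hl insert.prems by (simp add: subgroup.m_inv_closed subgroup.m_closed)
      have in_A: "y \<otimes> inv (y0 [^] l) \<in> ?A"
        using k y0l A by (simp add: subgroup.m_inv_closed subgroup.m_closed)
      have "k mod int d = 0"
      proof (rule ccontr)
        assume "k mod int d \<noteq> 0"
        then have "nat \<bar>k mod int d\<bar> \<in> D" using Dabs in_H in_A e by metis
        moreover have "nat \<bar>k mod int d\<bar> < d" using y0(3)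
          by (simp add: nat_less_iff)
        ultimately show False using least by blast
      qed
      then have "h \<otimes> inv (h0 [^] l) \<in> H \<inter> ?A" using e in_H in_A c by (simp)
      then have "h \<otimes> inv (h0 [^] l) \<in> generate G ?Y" using Y mono_generate[of Y ?Y] by auto
      moreover have "h0 [^] l \<in> generate G ?Y"
        using subgroup_int_pow_closed generate_is_subgroup YH hc generate.incl
        by (metis insertI1 subset_trans)
      ultimately have "(h \<otimes> inv (h0 [^] l)) \<otimes> h0 [^] l \<in> generate G ?Y" by (rule generate.eng)
      then show "h \<in> generate G ?Y" using c h0 by (simp add: m_assoc)
    qed
    moreover have "generate G ?Y \<subseteq> H" using generate_subgroup_incl YH insert.prems by blast
    ultimately show ?thesis using Y YH by (intro exI[of _ ?Y]) auto
  qed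
qed

text \<open>Division of the exponent of a generator x by n leaves x^i with i < n, as the powers of
  x^n fall into \<open>B\<close>. Each generator thus multiplies the number of cosets by at most
  n.\<close>

lemma (in comm_group) finite_cosets_of_torsion_quotient:
  assumes "finite U" "U \<subseteq> carrier G" "subgroup B G" "n > 0" "\<And>x. x \<in> U \<Longrightarrow> x [^] (n::nat) \<in> B"
  shows "finite ((\<lambda>x. B #> x) ` generate G U)"
  using assms
proof (induction U rule: finite_induct)
  case empty
  then show ?case by (simp add: generate_empty)
next
  case (insert x U)
  let ?A = "generate G U"
  have x: "x \<in> carrier G" and U: "U \<subseteq> carrier G" using insert by auto
  have gc: "?A \<subseteq> carrier G" using generate_incl U by blast
  have Bc: "B \<subseteq> carrier G" using insert.prems subgroup.subset by blast
  have "(\<lambda>x. B #> x) ` generate G (insert x U)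
      \<subseteq> (\<lambda>(i, C). C #> x [^] i) ` ({..<n} \<times> (\<lambda>x. B #> x) ` ?A)"
  proof
    fix C assume "C \<in> (\<lambda>x. B #> x) ` generate G (insert x U)"
    then obtain k y where k: "C = B #> (x [^] (k::int) \<otimes> y)" "y \<in> ?A"
      using generate_insert_eq[OF x U] by auto
    have yc: "y \<in> carrier G" using k gc by blast
    define i where "i = nat (k mod int n)"
    define l where "l = k div int n"
    have i: "i < n" "k = int n * l + int i" using insert.prems(3) by (auto simp: i_def l_def nat_less_iff)
    have "x [^] k = (x [^] n) [^] l \<otimes> x [^] i"
      using x by (simp add: i int_pow_mult int_pow_pow int_pow_int[symmetric])
    moreover have b: "(x [^] n) [^] l \<in> B"
      using subgroup_int_pow_closed insert.prems by blast
    ultimately have "C = B #> ((x [^] n) [^] l \<otimes> (y \<otimes> x [^] i))"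
      using k yc x Bc by (simp add: m_ac)
    also have "\<dots> = (B #> (x [^] n) [^] l) #> (y \<otimes> x [^] i)"
      using Bc b x yc by (subst coset_mult_assoc) auto
    also have "B #> (x [^] n) [^] l = B" using b insert.prems(2)
      by (meson coset_join2 subgroup.mem_carrier)
    also have "B #> (y \<otimes> x [^] i) = (B #> y) #> x [^] i"
      using Bc x yc by (subst coset_mult_assoc) auto
    finally show "C \<in> (\<lambda>(i, C). C #> x [^] i) ` ({..<n} \<times> (\<lambda>x. B #> x) ` ?A)"
      using i k by auto
  qed
  moreover have "finite ((\<lambda>x. B #> x) ` ?A)" using insert by auto
  ultimately show ?case by (meson finite_SigmaI finite_imageI finite_lessThan finite_subset)
qed

section \<open>Length of finite modules over a residue field\<close>

text \<open>The ideal generated by \<open>x\<close> and \<open>I\<close> is larger than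
  \<open>I\<close>, hence the whole ring. The inverse modulo \<open>I\<close> is given as an
  equation inside \<open>R\<close>, ready to be multiplied by elements of a module.\<close>

lemma (in maximalideal) exists_inverse_mod:
  assumes "cring R" "x \<in> carrier R" "x \<notin> I"
  shows "\<exists>y\<in>carrier R. \<exists>z\<in>I. y \<otimes> x \<oplus> z = \<one>"
proof -
  interpret cring R by fact
  let ?P = "PIdl x"
  have P: "ideal ?P R" using assms by (simp add: cgenideal_ideal)
  have "ideal (?P <+> I) R" using add_ideals[OF P is_ideal] .
  moreover have "I \<subseteq> ?P <+> I"
  proof
    fix z assume "z \<in> I"
    moreover have "\<zero> \<in> ?P" using P by (simp add: additive_subgroup.zero_closed ideal.axioms(1))
    ultimately have "\<zero> \<oplus> z \<in> ?P <+> I" unfolding set_add_def' by blast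
    then show "z \<in> ?P <+> I" using Icarr[OF \<open>z \<in> I\<close>] by simp
  qed
  moreover have "x \<in> ?P <+> I"
  proof -
    have "x \<in> ?P" using assms by (simp add: cgenideal_self)
    then have "x \<oplus> \<zero> \<in> ?P <+> I"
      using additive_subgroup.zero_closed[OF is_additive_subgroup] unfolding set_add_def' by blast
    then show ?thesis using assms by simp
  qed
  moreover have "?P <+> I \<subseteq> carrier R" using P
    by (simp add: ideal.Icarr a_subset set_add_closed subsetI)
  ultimately have "?P <+> I = carrier R" using I_maximal assms(3) by blast
  then have "\<one> \<in> ?P <+> I" by simp
  then obtain p z where "p \<in> ?P" "z \<in> I" "\<one> = p \<oplus> z" unfolding set_add_def' by blast
  then show ?thesis unfolding cgenideal_def by auto
qed

text \<open>As \<open>m\<close> kills \<open>M\<close>, the multiple r x depends only on the residue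
  of r. As nonzero residues are invertible and x \<notin> H, different residues give different
  cosets of \<open>H\<close>. So H + R x is the disjoint union of |R/m| cosets of \<open>H\<close>,
  and it is the least submodule that contains \<open>H\<close> and x.\<close>

lemma (in module) exists_submodule_adjoining:
  assumes m: "maximalideal m R"
    and ann: "\<And>r x. r \<in> m \<Longrightarrow> x \<in> carrier M \<Longrightarrow> r \<odot>\<^bsub>M\<^esub> x = \<zero>\<^bsub>M\<^esub>"
    and H: "submodule H R M" and x: "x \<in> carrier M" "x \<notin> H"
  shows "\<exists>H'. submodule H' R M \<and> H \<subset> H' \<and> card H' = card H * card (carrier (R Quot m)) \<and>
    (\<forall>L. submodule L R M \<and> H \<subseteq> L \<and> x \<in> L \<longrightarrow> H' \<subseteq> L)"
proof -
  interpret m: maximalideal m R by fact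
  interpret H: submodule H R M by fact
  \<comment> \<open>A chosen representative of a residue class: scalars can then be counted by
    \<open>R Quot m\<close> while the module stays over \<open>R\<close>.\<close>
  define \<rho> where "\<rho> C = (SOME r. r \<in> C)" for C :: "'a set"
  let ?Q = "carrier (R Quot m)"
  let ?f = "\<lambda>(h, C). h \<oplus>\<^bsub>M\<^esub> \<rho> C \<odot>\<^bsub>M\<^esub> x"
  define H' where "H' = {h \<oplus>\<^bsub>M\<^esub> r \<odot>\<^bsub>M\<^esub> x | h r. h \<in> H \<and> r \<in> carrier R}"
  have Hc: "h \<in> carrier M" if "h \<in> H" for h using that H.subset by auto
  have Hm: "h \<oplus>\<^bsub>M\<^esub> h' \<in> H" if "h \<in> H" "h' \<in> H" for h h' using that H.m_closed by simp
  have Hi: "\<ominus>\<^bsub>M\<^esub> h \<in> H" if "h \<in> H" for h using that H.m_inv_closed by (simp add: a_inv_def)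
  have H0: "\<zero>\<^bsub>M\<^esub> \<in> H" using H.one_closed by simp
  have rho: "\<rho> C \<in> carrier R \<and> C = m +> \<rho> C" if CQ: "C \<in> ?Q" for C
  proof -
    obtain r where r: "r \<in> carrier R" "C = m +> r" using CQ by (auto simp: FactRing_def A_RCOSETS_def')
    have "r \<in> C" using r m.a_rcos_self by blast
    then have rC: "\<rho> C \<in> C" unfolding \<rho>_def by (rule someI)
    then have "\<rho> C \<in> carrier R" using r R.a_r_coset_subset_G[OF m.a_subset r(1)] by blast
    moreover have "C = m +> \<rho> C" using r rC m.a_repr_independence' by blast
    ultimately show ?thesis by blast
  qed
  have diff: "r \<odot>\<^bsub>M\<^esub> x = r' \<odot>\<^bsub>M\<^esub> x" if "r \<in> carrier R" "r' \<in> carrier R" "r \<ominus> r' \<in> m" for r r'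
  proof -
    have "(r \<ominus> r') \<odot>\<^bsub>M\<^esub> x = \<zero>\<^bsub>M\<^esub>" using ann that x by blast
    moreover have "r \<odot>\<^bsub>M\<^esub> x = (r \<ominus> r') \<odot>\<^bsub>M\<^esub> x \<oplus>\<^bsub>M\<^esub> r' \<odot>\<^bsub>M\<^esub> x"
    proof -
      have "r = (r \<ominus> r') \<oplus> r'" using that by algebra
      then have "r \<odot>\<^bsub>M\<^esub> x = ((r \<ominus> r') \<oplus> r') \<odot>\<^bsub>M\<^esub> x" by (rule arg_cong)
      then show ?thesis using that x smult_l_distr[of "r \<ominus> r'" r' x] by simp
    qed
    ultimately show ?thesis using that x by simp
  qed
  have cos: "m +> r = m +> r' \<longleftrightarrow> r \<ominus> r' \<in> m" if "r \<in> carrier R" "r' \<in> carrier R" for r r'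
    using R.quotient_eq_iff_same_a_r_cos[OF m.is_ideal] that by blast
  have inj: "inj_on ?f (H \<times> ?Q)"
  proof (rule inj_onI, clarify)
    fix h C h' C' assume a: "h \<in> H" "C \<in> ?Q" "h' \<in> H" "C' \<in> ?Q"
      and e: "h \<oplus>\<^bsub>M\<^esub> \<rho> C \<odot>\<^bsub>M\<^esub> x = h' \<oplus>\<^bsub>M\<^esub> \<rho> C' \<odot>\<^bsub>M\<^esub> x"
    let ?r = "\<rho> C" and ?r' = "\<rho> C'"
    have r: "?r \<in> carrier R" "?r' \<in> carrier R" using rho a by auto
    have "(?r \<ominus> ?r') \<odot>\<^bsub>M\<^esub> x = h' \<oplus>\<^bsub>M\<^esub> \<ominus>\<^bsub>M\<^esub> h"
    proof -
      have c: "?r \<odot>\<^bsub>M\<^esub> x \<in> carrier M" "?r' \<odot>\<^bsub>M\<^esub> x \<in> carrier M" "h \<in> carrier M" "h' \<in> carrier M"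
        using r x a Hc by auto
      have "(?r \<ominus> ?r') \<odot>\<^bsub>M\<^esub> x = ?r \<odot>\<^bsub>M\<^esub> x \<oplus>\<^bsub>M\<^esub> \<ominus>\<^bsub>M\<^esub> (?r' \<odot>\<^bsub>M\<^esub> x)"
        using r x by (simp add: a_minus_def smult_l_distr smult_l_minus)
      also have "\<dots> = \<ominus>\<^bsub>M\<^esub> h \<oplus>\<^bsub>M\<^esub> (h \<oplus>\<^bsub>M\<^esub> ?r \<odot>\<^bsub>M\<^esub> x) \<oplus>\<^bsub>M\<^esub> \<ominus>\<^bsub>M\<^esub> (?r' \<odot>\<^bsub>M\<^esub> x)"
        using c by (simp add: M.r_neg1)
      also have "\<dots> = h' \<oplus>\<^bsub>M\<^esub> \<ominus>\<^bsub>M\<^esub> h" unfolding e using c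
        by (simp add: M.a_ac M.r_neg1 M.r_neg2 M.r_neg)
      finally show ?thesis .
    qed
    then have dH: "(?r \<ominus> ?r') \<odot>\<^bsub>M\<^esub> x \<in> H" using a Hm Hi by auto
    have "?r \<ominus> ?r' \<in> m"
    proof (rule ccontr)
      assume "?r \<ominus> ?r' \<notin> m"
      then obtain y z where yz: "y \<in> carrier R" "z \<in> m" "y \<otimes> (?r \<ominus> ?r') \<oplus> z = \<one>"
        using m.exists_inverse_mod[OF R.is_cring] r by blast
      have "x = (y \<otimes> (?r \<ominus> ?r') \<oplus> z) \<odot>\<^bsub>M\<^esub> x" using yz x by simp
      also have "\<dots> = y \<odot>\<^bsub>M\<^esub> ((?r \<ominus> ?r') \<odot>\<^bsub>M\<^esub> x)"
        using yz(1,2) x r ann m.Icarr by (simp add: smult_l_distr smult_assoc1)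
      also have "\<dots> \<in> H" using yz dH by blast
      finally show False using x by blast
    qed
    then have C: "C = C'" using cos r rho a by metis
    then have "h = h'" using e a Hc r x by simp
    with C show "h = h' \<and> C = C'" by blast
  qed
  have img: "?f ` (H \<times> ?Q) = H'"
  proof
    show "?f ` (H \<times> ?Q) \<subseteq> H'" using rho unfolding H'_def by auto
    show "H' \<subseteq> ?f ` (H \<times> ?Q)"
    proof
      fix u assume "u \<in> H'"
      then obtain h r where u: "u = h \<oplus>\<^bsub>M\<^esub> r \<odot>\<^bsub>M\<^esub> x" "h \<in> H" "r \<in> carrier R" unfolding H'_def by blast
      have C: "m +> r \<in> ?Q" using u by (auto simp: FactRing_def A_RCOSETS_def')
      then have "r \<ominus> \<rho> (m +> r) \<in> m" using cos rho u by metis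
      then have "u = ?f (h, m +> r)" using u diff[of r "\<rho> (m +> r)"] rho[OF C] by simp
      then show "u \<in> ?f ` (H \<times> ?Q)" using u C by blast
    qed
  qed
  have card: "card H' = card H * card ?Q"
    using card_image[OF inj] unfolding img by (simp add: card_cartesian_product)
  have mem: "h \<oplus>\<^bsub>M\<^esub> r \<odot>\<^bsub>M\<^esub> x \<in> H'" if "h \<in> H" "r \<in> carrier R" for h r
    unfolding H'_def using that by blast
  have sub: "submodule H' R M"
  proof (rule submoduleI)
    show "H' \<subseteq> carrier M" unfolding H'_def using Hc x by auto
    show "\<zero>\<^bsub>M\<^esub> \<in> H'" using mem[OF H0 R.zero_closed] x by simp
    fix a assume "a \<in> H'"
    then obtain h r where a: "a = h \<oplus>\<^bsub>M\<^esub> r \<odot>\<^bsub>M\<^esub> x" "h \<in> H" "r \<in> carrier R" unfolding H'_def by blast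
    have "\<ominus>\<^bsub>M\<^esub> a = \<ominus>\<^bsub>M\<^esub> h \<oplus>\<^bsub>M\<^esub> (\<ominus> r) \<odot>\<^bsub>M\<^esub> x" using a x Hc by (simp add: M.minus_add smult_l_minus)
    then show "\<ominus>\<^bsub>M\<^esub> a \<in> H'" using a Hi mem by simp
    {
      fix b assume "b \<in> H'"
      then obtain h' r' where b: "b = h' \<oplus>\<^bsub>M\<^esub> r' \<odot>\<^bsub>M\<^esub> x" "h' \<in> H" "r' \<in> carrier R" unfolding H'_def by blast
      have "a \<oplus>\<^bsub>M\<^esub> b = (h \<oplus>\<^bsub>M\<^esub> h') \<oplus>\<^bsub>M\<^esub> (r \<oplus> r') \<odot>\<^bsub>M\<^esub> x"
        using a b x Hc by (simp add: smult_l_distr M.a_ac)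
      then show "a \<oplus>\<^bsub>M\<^esub> b \<in> H'" using a b Hm mem by simp
    }
    fix s assume s: "s \<in> carrier R"
    have "s \<odot>\<^bsub>M\<^esub> a = s \<odot>\<^bsub>M\<^esub> h \<oplus>\<^bsub>M\<^esub> (s \<otimes> r) \<odot>\<^bsub>M\<^esub> x"
      using a x s Hc by (simp add: smult_r_distr smult_assoc1)
    then show "s \<odot>\<^bsub>M\<^esub> a \<in> H'" using a s mem by simp
  qed
  have HH': "H \<subseteq> H'"
  proof
    fix h assume h: "h \<in> H"
    then have "h = h \<oplus>\<^bsub>M\<^esub> \<zero> \<odot>\<^bsub>M\<^esub> x" using x Hc by simp
    then show "h \<in> H'" using mem[OF h R.zero_closed] by simp
  qed
  have xH': "x \<in> H'"
  proof -
    have "x = \<zero>\<^bsub>M\<^esub> \<oplus>\<^bsub>M\<^esub> \<one> \<odot>\<^bsub>M\<^esub> x" using x by simp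
    then show ?thesis using mem[OF H0 R.one_closed] by simp
  qed
  have "H' \<subseteq> L" if L: "submodule L R M" "H \<subseteq> L" "x \<in> L" for L
  proof -
    interpret L: submodule L R M by fact
    show ?thesis unfolding H'_def using L L.m_closed L.smult_closed by auto
  qed
  then show ?thesis using sub HH' xH' x card by (intro exI[of _ H']) blast
qed

text \<open>Counting replaces bases. With F = |R/m|, each strict step of a chain multiplies the size
  by at least F, whereas a chain from 0 whose steps adjoin a single element has exactly F^n elements
  after n steps. As F \<ge> 2, the comparison shows that no chain is longer than one of the second
  kind that reaches \<open>M\<close>.\<close>

lemma length_of_finite_vector_space:
  fixes R :: "('r, 'x) ring_scheme" (structure) and M :: "('r, 'a) module"
  assumes mod: "module R M" and fin: "finite (carrier M)" and m: "maximalideal m R"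
    and finm: "finite (carrier (R Quot m))"
    and ann: "\<And>r x. r \<in> m \<Longrightarrow> x \<in> carrier M \<Longrightarrow> r \<odot>\<^bsub>M\<^esub> x = \<zero>\<^bsub>M\<^esub>"
  shows "2 \<le> card (carrier (R Quot m))"
    and "\<exists>n. module_length R M = enat n \<and> card (carrier M) = card (carrier (R Quot m)) ^ n"
proof -
  let ?F = "card (carrier (R Quot m))"
  interpret module R M by (rule mod)
  interpret m: maximalideal m R by fact
  show F2: "2 \<le> ?F"
  proof -
    have Q: "m +> r \<in> carrier (R Quot m)" if "r \<in> carrier R" for r
      using that unfolding FactRing_def A_RCOSETS_def' by auto
    have mQ: "m \<in> carrier (R Quot m)" and oQ: "m +> \<one> \<in> carrier (R Quot m)"
      using Q[OF R.zero_closed] Q[OF R.one_closed] m.a_rcos_const[OF m.zero_closed] by simp_all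
    have "\<one> \<notin> m" using m.I_notcarr m.one_imp_carrier by blast
    then have "m \<noteq> m +> \<one>" using m.a_rcos_self[OF R.one_closed] by blast
    then have "card {m, m +> \<one>} = 2" by simp
    then show ?thesis using mQ oQ finm card_mono[of "carrier (R Quot m)" "{m, m +> \<one>}"] by simp
  qed
  define chain where "chain n c \<longleftrightarrow> (\<forall>i\<le>n. submodule (c i) R M) \<and> (\<forall>i<n. c i \<subset> c (Suc i))" for n and c :: "nat \<Rightarrow> 'a set"
  have bound: "?F ^ n \<le> card (c n)" if "chain n c" for n c
    using that
  proof (induction n)
    case 0
    then interpret c0: submodule "c 0" R M by (simp add: chain_def)
    have "finite (c 0)" "c 0 \<noteq> {}" using fin c0.subset finite_subset c0.one_closed by fastforce+
    then show ?case by (simp add: Suc_leI card_gt_0_iff)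
  next
    case (Suc n)
    then have "chain n c" by (simp add: chain_def)
    then have IH: "?F ^ n \<le> card (c n)" using Suc by blast
    have c: "submodule (c n) R M" "submodule (c (Suc n)) R M" "c n \<subset> c (Suc n)" using Suc by (auto simp: chain_def)
    interpret c': submodule "c (Suc n)" R M by fact
    obtain x where x: "x \<in> c (Suc n)" "x \<notin> c n" using c by blast
    have sub: "c (Suc n) \<subseteq> carrier M" using c'.subset by simp
    then have xM: "x \<in> carrier M" using x by blast
    obtain H' where H': "card H' = card (c n) * ?F" "H' \<subseteq> c (Suc n)"
      using exists_submodule_adjoining[OF m ann c(1) xM x(2)] c x by blast
    have "?F ^ Suc n \<le> card H'" using H' IH by (simp add: mult.commute)
    also have "\<dots> \<le> card (c (Suc n))" using card_mono[OF finite_subset[OF sub fin] H'(2)] .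
    finally show ?case .
  qed
  \<comment> \<open>A chain whose last term has exactly F^n elements is extended by one adjoined
    element at a time until it reaches \<open>M\<close>; the induction runs on the number of
    elements still missing.\<close>
  have ex: "\<exists>n c. chain n c \<and> c n = carrier M \<and> card (carrier M) = ?F ^ n"
    if "chain n c" "card (c n) = ?F ^ n" for n c
    using that
  proof (induction "card (carrier M) - card (c n)" arbitrary: n c rule: less_induct)
    case less
    have cn: "submodule (c n) R M" using less by (simp add: chain_def)
    interpret cn: submodule "c n" R M by fact
    have sub: "c n \<subseteq> carrier M" using cn.subset by simp
    show ?case
    proof (cases "c n = carrier M")
      case True then show ?thesis using less by metis
    next
      case False
      then obtain x where x: "x \<in> carrier M" "x \<notin> c n" using sub by blast
      obtain H' where H': "submodule H' R M" "c n \<subset> H'" "card H' = card (c n) * ?F"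
        using exists_submodule_adjoining[OF m ann cn x] by blast
      define d where "d = c(Suc n := H')"
      have "chain (Suc n) d" using less(2) H' unfolding chain_def d_def
        by (auto simp: le_Suc_eq less_Suc_eq)
      moreover have "card (d (Suc n)) = ?F ^ Suc n" using H' less by (simp add: d_def)
      moreover have "card (carrier M) - card (d (Suc n)) < card (carrier M) - card (c n)"
      proof -
        interpret H': submodule H' R M by fact
        have "card H' \<le> card (carrier M)" using H'.subset fin by (simp add: card_mono)
        moreover have "card (c n) < card H'"
          using psubset_card_mono[OF finite_subset[OF _ fin] H'(2)] H'.subset by simp
        ultimately show ?thesis by (simp add: d_def)
      qed
      ultimately show ?thesis using less.hyps by blast
    qed
  qed
  have "submodule {\<zero>\<^bsub>M\<^esub>} R M" by (rule submoduleI) auto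
  then obtain n c where c: "chain n c" "c n = carrier M" "card (carrier M) = ?F ^ n"
    using ex[of 0 "\<lambda>_. {\<zero>\<^bsub>M\<^esub>}"] by (auto simp: chain_def)
  have "module_length R M = enat n"
  proof -
    have le: "k \<le> n" if "chain k d" for k d
    proof -
      interpret dk: submodule "d k" R M using that by (simp add: chain_def)
      have "card (d k) \<le> card (carrier M)" using dk.subset fin by (simp add: card_mono)
      then have "?F ^ k \<le> ?F ^ n" using bound[OF that] c by linarith
      then show ?thesis using F2 by (simp)
    qed
    show ?thesis unfolding module_length_def chain_def[symmetric]
      by (rule Sup_eqI) (use c le in auto)
  qed
  then show "\<exists>n. module_length R M = enat n \<and> card (carrier M) = ?F ^ n" using c by blast
qed

section \<open>Base change\<close>

lemma coset_eq_iff: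
  fixes N :: "'a::ab_group_add set"
  assumes "0 \<in> N" "\<And>a b. a \<in> N \<Longrightarrow> b \<in> N \<Longrightarrow> a - b \<in> N"
  shows "(\<lambda>n. n + a) ` N = (\<lambda>n. n + b) ` N \<longleftrightarrow> a - b \<in> N"
proof
  assume "(\<lambda>n. n + a) ` N = (\<lambda>n. n + b) ` N"
  moreover have "0 + a \<in> (\<lambda>n. n + a) ` N" using assms by blast
  ultimately have "a \<in> (\<lambda>n. n + b) ` N" by simp
  then show "a - b \<in> N" by auto
next
  have add: "x + y \<in> N" if "x \<in> N" "y \<in> N" for x y
    using assms(2)[OF that(1) assms(2)[OF assms(1) that(2)]] by simp
  assume ab: "a - b \<in> N"
  have "x + a \<in> (\<lambda>n. n + b) ` N" if "x \<in> N" for x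
    using add[OF that ab] by (intro image_eqI[of _ _ "x + (a - b)"]) auto
  moreover have "x + b \<in> (\<lambda>n. n + a) ` N" if "x \<in> N" for x
    using assms(2)[OF that ab] by (intro image_eqI[of _ _ "x - (a - b)"]) auto
  ultimately show "(\<lambda>n. n + a) ` N = (\<lambda>n. n + b) ` N" by auto
qed

text \<open>The map p \<otimes> w before passing to classes. It serves in three roles: as f
  \<otimes> 1, as its inverse g \<otimes> v, and, for p = id, as the scalar action in
  \<open>base_change\<close>.\<close>

definition tensor_map ::
    "('s, 'd) ring_scheme \<Rightarrow> ('a \<Rightarrow> 'b) \<Rightarrow> 's \<Rightarrow> ('a \<times> 's \<Rightarrow>\<^sub>0 int) \<Rightarrow> ('b \<times> 's \<Rightarrow>\<^sub>0 int)" where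
  "tensor_map S p w = frag_extend (\<lambda>(x, t). frag_of (p x, w \<otimes>\<^bsub>S\<^esub> t))"

lemma tensor_map_diff: "tensor_map S p w (c - d) = tensor_map S p w c - tensor_map S p w d"
  by (simp add: tensor_map_def frag_extend_diff)

lemma tensor_map_add: "tensor_map S p w (c + d) = tensor_map S p w c + tensor_map S p w d"
  by (simp add: tensor_map_def frag_extend_add)

lemma tensor_map_zero [simp]: "tensor_map S p w 0 = 0"
  by (simp add: tensor_map_def)

lemma tensor_map_of [simp]: "tensor_map S p w (frag_of (x, t)) = frag_of (p x, w \<otimes>\<^bsub>S\<^esub> t)"
  by (simp add: tensor_map_def)

locale base_changeable = S: cring S for R :: "('r, 'c) ring_scheme" and S :: "('s, 'd) ring_scheme"
    and \<iota> :: "'r \<Rightarrow> 's" +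
  assumes \<iota>_closed: "r \<in> carrier R \<Longrightarrow> \<iota> r \<in> carrier S"
begin

text \<open>Closure is what keeps the tensor relations inside the free group on
  \<open>carrier M \<times> carrier S\<close>.\<close>

definition closed_module :: "('r, 'a) module \<Rightarrow> bool" where
  "closed_module M \<longleftrightarrow> (\<forall>x\<in>carrier M. \<forall>y\<in>carrier M. x \<oplus>\<^bsub>M\<^esub> y \<in> carrier M) \<and>
     (\<forall>r\<in>carrier R. \<forall>x\<in>carrier M. r \<odot>\<^bsub>M\<^esub> x \<in> carrier M)"

definition linear_map :: "('r, 'a) module \<Rightarrow> ('r, 'b) module \<Rightarrow> ('a \<Rightarrow> 'b) \<Rightarrow> bool" where
  "linear_map M N p \<longleftrightarrow> p \<in> carrier M \<rightarrow> carrier N \<and>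
     (\<forall>x\<in>carrier M. \<forall>y\<in>carrier M. p (x \<oplus>\<^bsub>M\<^esub> y) = p x \<oplus>\<^bsub>N\<^esub> p y) \<and>
     (\<forall>r\<in>carrier R. \<forall>x\<in>carrier M. p (r \<odot>\<^bsub>M\<^esub> x) = r \<odot>\<^bsub>N\<^esub> p x)"

abbreviation relators :: "('r, 'a) module \<Rightarrow> ('a \<times> 's \<Rightarrow>\<^sub>0 int) set" where
  "relators M \<equiv> generate (free_Abelian_group (carrier M \<times> carrier S)) (tensor_relations R S \<iota> M)"

lemma tensor_relations_keys:
  assumes "closed_module M" "c \<in> tensor_relations R S \<iota> M"
  shows "Poly_Mapping.keys c \<subseteq> carrier M \<times> carrier S"
proof -
  have add: "x \<oplus>\<^bsub>M\<^esub> y \<in> carrier M" if "x \<in> carrier M" "y \<in> carrier M" for x y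
    using that assms(1) unfolding closed_module_def by blast
  have smult: "r \<odot>\<^bsub>M\<^esub> x \<in> carrier M" if "r \<in> carrier R" "x \<in> carrier M" for r x
    using that assms(1) unfolding closed_module_def by blast
  show ?thesis
    using assms(2) unfolding tensor_relations_def
    by (auto dest!: subsetD[OF keys_diff] simp: keys_frag_of add smult \<iota>_closed split: if_splits)
qed

lemma relators_keys:
  assumes "closed_module M" "c \<in> relators M"
  shows "Poly_Mapping.keys c \<subseteq> carrier M \<times> carrier S"
proof -
  let ?G = "free_Abelian_group (carrier M \<times> carrier S)"
  interpret G: group ?G by simp
  have "tensor_relations R S \<iota> M \<subseteq> carrier ?G" using tensor_relations_keys[OF assms(1)] by auto
  then have "c \<in> carrier ?G" using G.generate_in_carrier assms(2) by blast
  then show ?thesis by simp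
qed

lemma relators_subgroup:
  assumes "closed_module M"
  shows "0 \<in> relators M" and "\<And>c d. c \<in> relators M \<Longrightarrow> d \<in> relators M \<Longrightarrow> c - d \<in> relators M"
proof -
  let ?G = "free_Abelian_group (carrier M \<times> carrier S)"
  interpret G: group ?G by simp
  have "tensor_relations R S \<iota> M \<subseteq> carrier ?G" using tensor_relations_keys[OF assms(1)] by auto
  then have sg: "subgroup (relators M) ?G" by (rule G.generate_is_subgroup)
  show "0 \<in> relators M" using subgroup.one_closed[OF sg] by simp
  fix c d assume cd: "c \<in> relators M" "d \<in> relators M"
  have "inv\<^bsub>?G\<^esub> d \<in> relators M" using subgroup.m_inv_closed[OF sg cd(2)] .
  then have "- d \<in> relators M" using relators_keys[OF assms cd(2)] by simp
  then show "c - d \<in> relators M" using subgroup.m_closed[OF sg cd(1), of "- d"] by simp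
qed

lemma tensor_map_keys:
  assumes "p \<in> carrier M \<rightarrow> carrier N" "w \<in> carrier S" "Poly_Mapping.keys c \<subseteq> carrier M \<times> carrier S"
  shows "Poly_Mapping.keys (tensor_map S p w c) \<subseteq> carrier N \<times> carrier S"
  using assms(3)
proof (induction c rule: frag_induction)
  case zero show ?case by simp
next
  case (one x)
  obtain y t where "x = (y, t)" by fastforce
  then show ?case using one assms by (auto simp: keys_frag_of)
next
  case (diff a b)
  then show ?case using keys_diff[of "tensor_map S p w a" "tensor_map S p w b"] unfolding tensor_map_diff by blast
qed

text \<open>Each of the three kinds of relation is sent to one of the same kind. For the third,
  \<open>w\<close> has to be moved past \<iota> r, which is possible because \<open>S\<close> is
  commutative.\<close>

lemma tensor_map_relators:
  assumes M: "closed_module M" and N: "closed_module N" and p: "linear_map M N p" and w: "w \<in> carrier S"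
    and c: "c \<in> relators M"
  shows "tensor_map S p w c \<in> relators N"
proof -
  have pc: "p x \<in> carrier N" if "x \<in> carrier M" for x using p that by (auto simp: linear_map_def)
  have rel: "tensor_map S p w d \<in> tensor_relations R S \<iota> N" if d: "d \<in> tensor_relations R S \<iota> M" for d
  proof -
    consider (a) x y t where "d = frag_of (x \<oplus>\<^bsub>M\<^esub> y, t) - frag_of (x, t) - frag_of (y, t)"
        "x \<in> carrier M" "y \<in> carrier M" "t \<in> carrier S"
      | (b) x t u where "d = frag_of (x, t \<oplus>\<^bsub>S\<^esub> u) - frag_of (x, t) - frag_of (x, u)"
        "x \<in> carrier M" "t \<in> carrier S" "u \<in> carrier S"
      | (c) r x t where "d = frag_of (r \<odot>\<^bsub>M\<^esub> x, t) - frag_of (x, \<iota> r \<otimes>\<^bsub>S\<^esub> t)"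
        "r \<in> carrier R" "x \<in> carrier M" "t \<in> carrier S"
      using d unfolding tensor_relations_def by blast
    then show ?thesis
    proof cases
      case a
      have "tensor_map S p w d = frag_of (p x \<oplus>\<^bsub>N\<^esub> p y, w \<otimes>\<^bsub>S\<^esub> t) - frag_of (p x, w \<otimes>\<^bsub>S\<^esub> t) - frag_of (p y, w \<otimes>\<^bsub>S\<^esub> t)"
        using a p by (simp add: tensor_map_diff linear_map_def)
      then show ?thesis using pc[OF a(2)] pc[OF a(3)] w a(4) S.m_closed unfolding tensor_relations_def by blast
    next
      case b
      have "tensor_map S p w d = frag_of (p x, w \<otimes>\<^bsub>S\<^esub> t \<oplus>\<^bsub>S\<^esub> w \<otimes>\<^bsub>S\<^esub> u) - frag_of (p x, w \<otimes>\<^bsub>S\<^esub> t) - frag_of (p x, w \<otimes>\<^bsub>S\<^esub> u)"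
        using b w by (simp add: tensor_map_diff S.r_distr)
      then show ?thesis using pc[OF b(2)] w b(3,4) S.m_closed unfolding tensor_relations_def by blast
    next
      case c
      have "tensor_map S p w d = frag_of (r \<odot>\<^bsub>N\<^esub> p x, w \<otimes>\<^bsub>S\<^esub> t) - frag_of (p x, \<iota> r \<otimes>\<^bsub>S\<^esub> (w \<otimes>\<^bsub>S\<^esub> t))"
        using c w p \<iota>_closed by (simp add: tensor_map_diff linear_map_def S.m_lcomm)
      then show ?thesis using pc[OF c(3)] c(2,4) w S.m_closed unfolding tensor_relations_def by blast
    qed
  qed
  show ?thesis using c
  proof (induction c rule: generate.induct)
    case one show ?case using relators_subgroup(1)[OF N] by simp
  next
    case (incl c) then show ?case using rel by (simp add: generate.incl)
  next
    case (inv c)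
    have "tensor_map S p w c \<in> relators N" using inv rel by (simp add: generate.incl)
    then have "0 - tensor_map S p w c \<in> relators N" using relators_subgroup[OF N] by blast
    then show ?case using tensor_relations_keys[OF M inv] tensor_map_diff[of S p w 0 c] by simp
  next
    case (eng c d)
    then have "tensor_map S p w c - (0 - tensor_map S p w d) \<in> relators N"
      using relators_subgroup[OF N] by blast
    then show ?case by (simp add: tensor_map_add)
  qed
qed

abbreviation tensor_class :: "('r, 'a) module \<Rightarrow> ('a \<times> 's \<Rightarrow>\<^sub>0 int) \<Rightarrow> ('a \<times> 's \<Rightarrow>\<^sub>0 int) set" where
  "tensor_class M c \<equiv> (\<lambda>n. n + c) ` relators M"

lemma tensor_class_eq_iff:
  "closed_module M \<Longrightarrow> tensor_class M c = tensor_class M d \<longleftrightarrow> c - d \<in> relators M"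
  by (rule coset_eq_iff) (rule relators_subgroup; assumption)+

lemma r_coset_relators:
  "relators M #>\<^bsub>free_Abelian_group (carrier M \<times> carrier S)\<^esub> c = tensor_class M c"
  by (auto simp: r_coset_def)

lemma carrier_base_change:
  "carrier (base_change R S \<iota> M) = tensor_class M ` {c. Poly_Mapping.keys c \<subseteq> carrier M \<times> carrier S}"
  by (auto simp: base_change_def Let_def RCOSETS_def r_coset_relators)

lemma add_base_change:
  assumes "closed_module M"
  shows "tensor_class M c \<oplus>\<^bsub>base_change R S \<iota> M\<^esub> tensor_class M d = tensor_class M (c + d)"
proof -
  have add: "x + y \<in> relators M" if "x \<in> relators M" "y \<in> relators M" for x y
    using relators_subgroup(2)[OF assms that(1) relators_subgroup(2)[OF assms relators_subgroup(1)[OF assms] that(2)]]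
    by simp
  have "tensor_class M c \<oplus>\<^bsub>base_change R S \<iota> M\<^esub> tensor_class M d = {x + y | x y. x \<in> tensor_class M c \<and> y \<in> tensor_class M d}"
    by (auto simp: base_change_def Let_def set_mult_def)
  also have "\<dots> = tensor_class M (c + d)"
  proof safe
    fix x y assume "x \<in> relators M" "y \<in> relators M"
    then show "x + c + (y + d) \<in> tensor_class M (c + d)"
      using add by (intro image_eqI[of _ _ "x + y"]) (auto simp: algebra_simps)
  next
    fix x assume x: "x \<in> relators M"
    then have "x + (c + d) = (x + c) + (0 + d)" by (simp add: algebra_simps)
    then show "\<exists>y z. x + (c + d) = y + z \<and> y \<in> tensor_class M c \<and> z \<in> tensor_class M d"
      using x relators_subgroup(1)[OF assms] by blast
  qed
  finally show ?thesis .
qed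

text \<open>Maps on classes are written as unions over representatives, as in
  \<open>base_change\<close>. All members of such a union are the same class, because relators are
  sent to relators.\<close>

lemma image_tensor_class:
  assumes "closed_module M" "closed_module N" "linear_map M N p" "w \<in> carrier S"
  shows "(\<Union>c\<in>tensor_class M d. tensor_class N (tensor_map S p w c)) = tensor_class N (tensor_map S p w d)"
proof -
  have "tensor_class N (tensor_map S p w c) = tensor_class N (tensor_map S p w d)" if cd: "c \<in> tensor_class M d" for c
  proof -
    obtain n where n: "n \<in> relators M" "c = n + d" using cd by blast
    then have "tensor_map S p w c - tensor_map S p w d \<in> relators N"
      using tensor_map_relators[OF assms n(1)] by (simp add: tensor_map_add)
    then show ?thesis using tensor_class_eq_iff[OF assms(2)] by blast
  qed
  moreover have "tensor_class M d \<noteq> {}" using relators_subgroup(1)[OF assms(1)] by blast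
  ultimately show ?thesis by auto
qed

lemma smult_base_change:
  assumes "closed_module M" "s \<in> carrier S"
  shows "s \<odot>\<^bsub>base_change R S \<iota> M\<^esub> tensor_class M c = tensor_class M (tensor_map S id s c)"
proof -
  have "linear_map M M id" by (auto simp: linear_map_def)
  then show ?thesis
    using image_tensor_class[OF assms(1,1) _ assms(2), of id c]
    by (simp add: base_change_def Let_def r_coset_relators tensor_map_def)
qed

text \<open>The tensor x \<otimes> t goes to s x \<otimes> v t, and moving s across turns this into
  x \<otimes> \<iota>(s) v t = x \<otimes> t; the difference is itself a relation of the third kind.
  Two scalars with w u = v are kept apart so that both orders of composition of f \<otimes> 1 and g
  \<otimes> v are instances.\<close>

lemma tensor_map_inverse:
  assumes M: "closed_module M" and s: "s \<in> carrier R" and v: "v \<in> carrier S" "v \<otimes>\<^bsub>S\<^esub> \<iota> s = \<one>\<^bsub>S\<^esub>"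
    and gf: "\<And>x. x \<in> carrier M \<Longrightarrow> g (f x) = s \<odot>\<^bsub>M\<^esub> x"
    and wu: "\<And>t. t \<in> carrier S \<Longrightarrow> w \<otimes>\<^bsub>S\<^esub> (u \<otimes>\<^bsub>S\<^esub> t) = v \<otimes>\<^bsub>S\<^esub> t"
    and c: "Poly_Mapping.keys c \<subseteq> carrier M \<times> carrier S"
  shows "tensor_map S g w (tensor_map S f u c) - c \<in> relators M"
  using c
proof (induction c rule: frag_induction)
  case zero show ?case using relators_subgroup[OF M] by simp
next
  case (one z)
  then obtain x t where z: "z = (x, t)" "x \<in> carrier M" "t \<in> carrier S" by blast
  have "\<iota> s \<otimes>\<^bsub>S\<^esub> (v \<otimes>\<^bsub>S\<^esub> t) = t"
    using z(3) v \<iota>_closed[OF s] S.m_assoc[of "\<iota> s" v t] S.m_comm[of "\<iota> s" v] by simp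
  then have "tensor_map S g w (tensor_map S f u (frag_of z)) - frag_of z
      = frag_of (s \<odot>\<^bsub>M\<^esub> x, v \<otimes>\<^bsub>S\<^esub> t) - frag_of (x, \<iota> s \<otimes>\<^bsub>S\<^esub> (v \<otimes>\<^bsub>S\<^esub> t))"
    using z gf wu by simp
  also have "\<dots> \<in> tensor_relations R S \<iota> M"
    unfolding tensor_relations_def using z s v S.m_closed by blast
  finally show ?case by (rule generate.incl)
next
  case (diff a b)
  then have "(tensor_map S g w (tensor_map S f u a) - a) - (tensor_map S g w (tensor_map S f u b) - b) \<in> relators M"
    using relators_subgroup[OF M] by blast
  then show ?case by (simp add: tensor_map_diff algebra_simps)
qed

text \<open>The inverse of f \<otimes> 1 is g \<otimes> v, where v cancels the factor s that both
  composites of f and g produce.\<close>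

theorem base_change_isomorphic:
  assumes M: "closed_module M" and N: "closed_module N" and f: "linear_map M N f" and g: "linear_map N M g"
    and s: "s \<in> carrier R" and v: "v \<in> carrier S" "v \<otimes>\<^bsub>S\<^esub> \<iota> s = \<one>\<^bsub>S\<^esub>"
    and gf: "\<And>x. x \<in> carrier M \<Longrightarrow> g (f x) = s \<odot>\<^bsub>M\<^esub> x"
    and fg: "\<And>y. y \<in> carrier N \<Longrightarrow> f (g y) = s \<odot>\<^bsub>N\<^esub> y"
  shows "module_isomorphic S (base_change R S \<iota> M) (base_change R S \<iota> N)"
proof -
  let ?BM = "base_change R S \<iota> M" and ?BN = "base_change R S \<iota> N"
  let ?F = "tensor_map S f \<one>\<^bsub>S\<^esub>" and ?G = "tensor_map S g v"
  let ?\<Phi> = "\<lambda>C. \<Union>c\<in>C. tensor_class N (?F c)"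
  let ?\<Psi> = "\<lambda>C. \<Union>c\<in>C. tensor_class M (?G c)"
  have \<Phi>: "?\<Phi> (tensor_class M c) = tensor_class N (?F c)" for c
    using image_tensor_class[OF M N f S.one_closed] .
  have \<Psi>: "?\<Psi> (tensor_class N c) = tensor_class M (?G c)" for c
    using image_tensor_class[OF N M g v(1)] .
  have fc: "f \<in> carrier M \<rightarrow> carrier N" and gc: "g \<in> carrier N \<rightarrow> carrier M"
    using f g by (auto simp: linear_map_def)
  have GF: "?G (?F c) - c \<in> relators M" if "Poly_Mapping.keys c \<subseteq> carrier M \<times> carrier S" for c
    by (rule tensor_map_inverse[where f = f and g = g, OF M s v gf _ that]) simp_all
  have FG: "?F (?G c) - c \<in> relators N" if "Poly_Mapping.keys c \<subseteq> carrier N \<times> carrier S" for c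
    by (rule tensor_map_inverse[where f = g and g = f, OF N s v fg _ that]) (simp_all add: v(1))
  have comm: "?F (tensor_map S id w c) = tensor_map S id w (?F c)"
    if "w \<in> carrier S" "Poly_Mapping.keys c \<subseteq> carrier M \<times> carrier S" for w c
    using that(2)
  proof (induction c rule: frag_induction)
    case (one z)
    then show ?case using that(1) by (cases z) (auto)
  qed (auto simp: tensor_map_diff)
  have inv1: "?\<Psi> (?\<Phi> C) = C" if "C \<in> carrier ?BM" for C
  proof -
    obtain c where c: "C = tensor_class M c" "Poly_Mapping.keys c \<subseteq> carrier M \<times> carrier S"
      using \<open>C \<in> carrier ?BM\<close> unfolding carrier_base_change by blast
    show ?thesis unfolding c(1) \<Phi> \<Psi> using GF[OF c(2)] tensor_class_eq_iff[OF M] by blast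
  qed
  have inv2: "?\<Phi> (?\<Psi> C) = C" if "C \<in> carrier ?BN" for C
  proof -
    obtain c where c: "C = tensor_class N c" "Poly_Mapping.keys c \<subseteq> carrier N \<times> carrier S"
      using \<open>C \<in> carrier ?BN\<close> unfolding carrier_base_change by blast
    show ?thesis unfolding c(1) \<Phi> \<Psi> using FG[OF c(2)] tensor_class_eq_iff[OF N] by blast
  qed
  have m1: "?\<Phi> C \<in> carrier ?BN" if "C \<in> carrier ?BM" for C
    using that tensor_map_keys[OF fc S.one_closed] \<Phi> unfolding carrier_base_change by auto
  have m2: "?\<Psi> C \<in> carrier ?BM" if "C \<in> carrier ?BN" for C
    using that tensor_map_keys[OF gc v(1)] \<Psi> unfolding carrier_base_change by auto
  have bij: "bij_betw ?\<Phi> (carrier ?BM) (carrier ?BN)"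
  proof (rule bij_betw_byWitness[where f' = ?\<Psi>])
    show "\<forall>C\<in>carrier ?BM. ?\<Psi> (?\<Phi> C) = C" by (rule ballI, rule inv1)
    show "\<forall>C\<in>carrier ?BN. ?\<Phi> (?\<Psi> C) = C" by (rule ballI, rule inv2)
    show "?\<Phi> ` carrier ?BM \<subseteq> carrier ?BN"
      by (rule image_subsetI, rule m1)
    show "?\<Psi> ` carrier ?BN \<subseteq> carrier ?BM"
      by (rule image_subsetI, rule m2)
  qed
  have add: "?\<Phi> (C \<oplus>\<^bsub>?BM\<^esub> D) = ?\<Phi> C \<oplus>\<^bsub>?BN\<^esub> ?\<Phi> D"
    if "C \<in> carrier ?BM" "D \<in> carrier ?BM" for C D
  proof -
    obtain c d where "C = tensor_class M c" "D = tensor_class M d"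
      using \<open>C \<in> _\<close> \<open>D \<in> _\<close> unfolding carrier_base_change by blast
    then show ?thesis by (simp only: \<Phi> add_base_change[OF M] add_base_change[OF N] tensor_map_add)
  qed
  have smult: "?\<Phi> (w \<odot>\<^bsub>?BM\<^esub> C) = w \<odot>\<^bsub>?BN\<^esub> ?\<Phi> C"
    if "w \<in> carrier S" "C \<in> carrier ?BM" for w C
  proof -
    obtain c where c: "C = tensor_class M c" "Poly_Mapping.keys c \<subseteq> carrier M \<times> carrier S"
      using \<open>C \<in> _\<close> unfolding carrier_base_change by blast
    show ?thesis
      unfolding c(1) \<Phi> smult_base_change[OF M \<open>w \<in> _\<close>] smult_base_change[OF N \<open>w \<in> _\<close>] comm[OF \<open>w \<in> _\<close> c(2)] ..
  qed
  show ?thesis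
    unfolding module_isomorphic_def
  proof (rule exI[of _ ?\<Phi>], intro conjI ballI)
    show "bij_betw ?\<Phi> (carrier ?BM) (carrier ?BN)" by (rule bij)
  next
    fix C D assume "C \<in> carrier ?BM" "D \<in> carrier ?BM"
    then show "?\<Phi> (C \<oplus>\<^bsub>?BM\<^esub> D) = ?\<Phi> C \<oplus>\<^bsub>?BN\<^esub> ?\<Phi> D" by (rule add)
  next
    fix w C assume "w \<in> carrier S" "C \<in> carrier ?BM"
    then show "?\<Phi> (w \<odot>\<^bsub>?BM\<^esub> C) = w \<odot>\<^bsub>?BN\<^esub> ?\<Phi> C" by (rule smult)
  qed
qed

end

section \<open>Completions\<close>

lemma (in ring) ideal_ideal_power:
  assumes "ideal I R"
  shows "ideal (ideal_power R I k) R"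
proof (induction k)
  case 0
  then show ?case by (simp add: nat_pow_def ideals_set_def oneideal)
next
  case (Suc k)
  then show ?case using ideal_prod_is_ideal[OF _ assms] by (simp add: nat_pow_def ideals_set_def)
qed

lemma ideal_power_Suc: "ideal_power R I (Suc k) = ideal_power R I k \<cdot>\<^bsub>R\<^esub> I"
  by (simp add: nat_pow_def ideals_set_def)

lemma (in ring) ideal_power_decreasing:
  assumes "ideal I R"
  shows "ideal_power R I (Suc k) \<subseteq> ideal_power R I k"
  using ideal_prod_inter[OF ideal_ideal_power[OF assms] assms] unfolding ideal_power_Suc by blast

locale completing = cring + n: ideal n R for n
begin

text \<open>An element of the inverse limit is handled through a coherent sequence of
  representatives, so that identities in the completion become identities in \<open>R\<close> at
  each level.\<close>

definition represents :: "(nat \<Rightarrow> 'a) \<Rightarrow> (nat \<Rightarrow> 'a set) \<Rightarrow> bool" where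
  "represents r f \<longleftrightarrow> (\<forall>k. r k \<in> carrier R \<and> f k = ideal_power R n k +> r k) \<and>
     (\<forall>k. r (Suc k) \<ominus> r k \<in> ideal_power R n k)"

lemma power_ideal: "ideal (ideal_power R n k) R"
  using ideal_ideal_power n.is_ideal by blast

lemma coset_in_quot: "r \<in> carrier R \<Longrightarrow> ideal_power R n k +> r \<in> carrier (R Quot ideal_power R n k)"
  unfolding FactRing_def A_RCOSETS_def' by auto

lemma coset_eq: "a \<in> carrier R \<Longrightarrow> b \<in> carrier R \<Longrightarrow>
    ideal_power R n k +> a = ideal_power R n k +> b \<longleftrightarrow> a \<ominus> b \<in> ideal_power R n k"
  using quotient_eq_iff_same_a_r_cos[OF power_ideal] by blast

lemma coset_mono:
  "ideal_power R n (Suc k) +> r \<subseteq> ideal_power R n k +> r"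
  using ideal_power_decreasing[OF n.is_ideal, of k] unfolding a_r_coset_def' by blast

lemma coset_self: "r \<in> carrier R \<Longrightarrow> r \<in> ideal_power R n k +> r"
proof -
  assume "r \<in> carrier R"
  interpret p: ideal "ideal_power R n k" R by (rule power_ideal)
  show ?thesis by (rule p.a_rcos_self) fact
qed

lemma represents_imp_mem: "represents r f \<Longrightarrow> f \<in> carrier (completion R n)"
proof -
  assume r: "represents r f"
  have "f (Suc k) \<subseteq> f k" for k
  proof -
    have "f k = ideal_power R n k +> r (Suc k)" using r coset_eq[of "r (Suc k)" "r k" k] by (simp add: represents_def)
    then show ?thesis using r coset_mono by (simp add: represents_def)
  qed
  then show ?thesis using r coset_in_quot by (simp add: represents_def completion_def)
qed

lemma mem_imp_represents:
  assumes "f \<in> carrier (completion R n)"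
  obtains r where "represents r f"
proof -
  have f: "f k \<in> carrier (R Quot ideal_power R n k)" "f (Suc k) \<subseteq> f k" for k
    using assms by (auto simp: completion_def)
  have "\<exists>r. r \<in> carrier R \<and> f k = ideal_power R n k +> r" for k
    using f(1)[of k] unfolding FactRing_def A_RCOSETS_def' by auto
  then obtain r where r: "r k \<in> carrier R" "f k = ideal_power R n k +> r k" for k by metis
  have "r (Suc k) \<ominus> r k \<in> ideal_power R n k" for k
  proof -
    interpret p: ideal "ideal_power R n k" R by (rule power_ideal)
    \<comment> \<open>Compatibility is given as an inclusion of cosets, so a representative at level
      k+1 also represents the coset at level k.\<close>
    have "r (Suc k) \<in> f (Suc k)" using coset_self[OF r(1)] unfolding r(2)[of "Suc k"] .
    then have "r (Suc k) \<in> ideal_power R n k +> r k" using f(2)[of k] unfolding r(2)[of k] by (rule subsetD[rotated])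
    then have "ideal_power R n k +> r k = ideal_power R n k +> r (Suc k)"
      using p.a_repr_independence' r(1) by simp
    then show ?thesis using coset_eq[of "r (Suc k)" "r k" k] r by simp
  qed
  then have "represents r f" using r by (simp add: represents_def)
  then show thesis by (rule that)
qed

lemma quot_hom: "(+>) (ideal_power R n k) \<in> ring_hom R (R Quot ideal_power R n k)"
  using ideal.rcos_ring_hom[OF power_ideal] .

lemma represents_add:
  assumes "represents r f" "represents s g"
  shows "represents (\<lambda>k. r k \<oplus> s k) (f \<oplus>\<^bsub>completion R n\<^esub> g)"
proof -
  have c: "r k \<in> carrier R" "s k \<in> carrier R" for k using assms by (auto simp: represents_def)
  have "r (Suc k) \<oplus> s (Suc k) \<ominus> (r k \<oplus> s k) \<in> ideal_power R n k" for k
  proof -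
    interpret p: ideal "ideal_power R n k" R by (rule power_ideal)
    have "r (Suc k) \<oplus> s (Suc k) \<ominus> (r k \<oplus> s k) = (r (Suc k) \<ominus> r k) \<oplus> (s (Suc k) \<ominus> s k)"
      using c[of k] c[of "Suc k"] by algebra
    then show ?thesis using assms p.a_closed by (simp add: represents_def)
  qed
  then show ?thesis using assms c ring_hom_add[OF quot_hom] by (simp add: represents_def completion_def)
qed

lemma represents_mult:
  assumes "represents r f" "represents s g"
  shows "represents (\<lambda>k. r k \<otimes> s k) (f \<otimes>\<^bsub>completion R n\<^esub> g)"
proof -
  have c: "r k \<in> carrier R" "s k \<in> carrier R" for k using assms by (auto simp: represents_def)
  have "r (Suc k) \<otimes> s (Suc k) \<ominus> (r k \<otimes> s k) \<in> ideal_power R n k" for k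
  proof -
    interpret p: ideal "ideal_power R n k" R by (rule power_ideal)
    have "r (Suc k) \<otimes> s (Suc k) \<ominus> (r k \<otimes> s k) = r (Suc k) \<otimes> (s (Suc k) \<ominus> s k) \<oplus> s k \<otimes> (r (Suc k) \<ominus> r k)"
      using c[of k] c[of "Suc k"] by algebra
    then show ?thesis using assms c p.a_closed p.I_l_closed by (simp add: represents_def)
  qed
  then show ?thesis using assms c ring_hom_mult[OF quot_hom] by (simp add: represents_def completion_def)
qed

lemma represents_const:
  assumes "r \<in> carrier R"
  shows "represents (\<lambda>_. r) (to_completion R n r)"
proof -
  have e: "r \<ominus> r = \<zero>" using assms r_right_minus_eq by simp
  have "r \<ominus> r \<in> ideal_power R n k" for k
    unfolding e by (rule additive_subgroup.zero_closed[OF ideal.axioms(1)[OF power_ideal]])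
  then show ?thesis using assms by (simp add: represents_def to_completion_def)
qed

lemma one_completion: "\<one>\<^bsub>completion R n\<^esub> = to_completion R n \<one>"
  using ring_hom_one[OF quot_hom] by (simp add: completion_def to_completion_def)

lemma zero_completion: "\<zero>\<^bsub>completion R n\<^esub> = to_completion R n \<zero>"
proof -
  have "\<zero>\<^bsub>R Quot ideal_power R n k\<^esub> = ideal_power R n k +> \<zero>" for k
    using ideal.Icarr[OF power_ideal] by (simp add: FactRing_def subsetI)
  then show ?thesis by (simp add: completion_def to_completion_def)
qed

lemma represents_unique:
  assumes "represents r f" "represents r g"
  shows "f = g"
  using assms by (auto simp: represents_def)

text \<open>A sequence represents at most one element, so a law holds as soon as both sides are
  represented by sequences that agree termwise in \<open>R\<close>.\<close>

lemma cring_completion: "cring (completion R n)"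
proof -
  let ?S = "completion R n"
  have Rc: "\<exists>r. represents r f" if "f \<in> carrier ?S" for f using that mem_imp_represents by blast
  have rc: "r k \<in> carrier R" if "represents r f" for r f k using that by (simp add: represents_def)
  note [simp] = one_completion zero_completion
  show ?thesis
  proof (rule cringI)
    show "abelian_group ?S"
    proof (rule abelian_groupI)
      show "\<zero>\<^bsub>?S\<^esub> \<in> carrier ?S" using represents_const[OF zero_closed] represents_imp_mem by simp
    next
      fix f g assume "f \<in> carrier ?S" "g \<in> carrier ?S"
      then obtain r s where rs: "represents r f" "represents s g" using Rc by blast
      show "f \<oplus>\<^bsub>?S\<^esub> g \<in> carrier ?S" using represents_add[OF rs] represents_imp_mem by blast
      have "(\<lambda>k. r k \<oplus> s k) = (\<lambda>k. s k \<oplus> r k)" using rc[OF rs(1)] rc[OF rs(2)] by (simp add: a_comm)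
      then show "f \<oplus>\<^bsub>?S\<^esub> g = g \<oplus>\<^bsub>?S\<^esub> f"
        using represents_unique represents_add[OF rs] represents_add[OF rs(2,1)] by simp
      fix h assume "h \<in> carrier ?S"
      then obtain t where t: "represents t h" using Rc by blast
      have "(\<lambda>k. (r k \<oplus> s k) \<oplus> t k) = (\<lambda>k. r k \<oplus> (s k \<oplus> t k))" using rc[OF rs(1)] rc[OF rs(2)] rc[OF t] by (simp add: a_assoc)
      then show "(f \<oplus>\<^bsub>?S\<^esub> g) \<oplus>\<^bsub>?S\<^esub> h = f \<oplus>\<^bsub>?S\<^esub> (g \<oplus>\<^bsub>?S\<^esub> h)"
        using represents_unique represents_add[OF represents_add[OF rs] t]
          represents_add[OF rs(1) represents_add[OF rs(2) t]] by simp
    next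
      fix f assume "f \<in> carrier ?S"
      then obtain r where r: "represents r f" using Rc by blast
      have "(\<lambda>k. \<zero> \<oplus> r k) = r" using rc[OF r] by simp
      then show "\<zero>\<^bsub>?S\<^esub> \<oplus>\<^bsub>?S\<^esub> f = f"
        using represents_unique r represents_add[OF represents_const[OF zero_closed] r] by simp
      define g where "g = (\<lambda>k. ideal_power R n k +> (\<ominus> r k))"
      have "\<ominus> r (Suc k) \<ominus> (\<ominus> r k) \<in> ideal_power R n k" for k
      proof -
        interpret p: ideal "ideal_power R n k" R by (rule power_ideal)
        have "\<ominus> r (Suc k) \<ominus> (\<ominus> r k) = \<ominus> (r (Suc k) \<ominus> r k)"
          using rc[OF r, of k] rc[OF r, of "Suc k"] by algebra
        then show ?thesis using r p.a_inv_closed by (simp add: represents_def)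
      qed
      then have g: "represents (\<lambda>k. \<ominus> r k) g" using rc[OF r] by (simp add: represents_def g_def)
      have "(\<lambda>k. (\<ominus> r k) \<oplus> r k) = (\<lambda>k. \<zero>)" using rc[OF r] by (simp add: l_neg)
      then have "g \<oplus>\<^bsub>?S\<^esub> f = \<zero>\<^bsub>?S\<^esub>"
        using represents_unique represents_const[OF zero_closed] represents_add[OF g r] by simp
      then show "\<exists>g\<in>carrier ?S. g \<oplus>\<^bsub>?S\<^esub> f = \<zero>\<^bsub>?S\<^esub>" using g represents_imp_mem by blast
    qed
    show "Group.comm_monoid ?S"
    proof (rule comm_monoidI)
      show "\<one>\<^bsub>?S\<^esub> \<in> carrier ?S" using represents_const[OF one_closed] represents_imp_mem by simp
    next
      fix f g assume "f \<in> carrier ?S" "g \<in> carrier ?S"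
      then obtain r s where rs: "represents r f" "represents s g" using Rc by blast
      show "f \<otimes>\<^bsub>?S\<^esub> g \<in> carrier ?S" using represents_mult[OF rs] represents_imp_mem by blast
      have "(\<lambda>k. r k \<otimes> s k) = (\<lambda>k. s k \<otimes> r k)" using rc[OF rs(1)] rc[OF rs(2)] by (simp add: m_comm)
      then show "f \<otimes>\<^bsub>?S\<^esub> g = g \<otimes>\<^bsub>?S\<^esub> f"
        using represents_unique represents_mult[OF rs] represents_mult[OF rs(2,1)] by simp
      fix h assume "h \<in> carrier ?S"
      then obtain t where t: "represents t h" using Rc by blast
      have "(\<lambda>k. (r k \<otimes> s k) \<otimes> t k) = (\<lambda>k. r k \<otimes> (s k \<otimes> t k))" using rc[OF rs(1)] rc[OF rs(2)] rc[OF t] by (simp add: m_assoc)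
      then show "(f \<otimes>\<^bsub>?S\<^esub> g) \<otimes>\<^bsub>?S\<^esub> h = f \<otimes>\<^bsub>?S\<^esub> (g \<otimes>\<^bsub>?S\<^esub> h)"
        using represents_unique represents_mult[OF represents_mult[OF rs] t]
          represents_mult[OF rs(1) represents_mult[OF rs(2) t]] by simp
    next
      fix f assume "f \<in> carrier ?S"
      then obtain r where r: "represents r f" using Rc by blast
      have "(\<lambda>k. \<one> \<otimes> r k) = r" using rc[OF r] by simp
      then show "\<one>\<^bsub>?S\<^esub> \<otimes>\<^bsub>?S\<^esub> f = f"
        using represents_unique r represents_mult[OF represents_const[OF one_closed] r] by simp
    qed
    fix f g h assume fgh: "f \<in> carrier ?S" "g \<in> carrier ?S" "h \<in> carrier ?S"
    obtain r s t where rst: "represents r f" "represents s g" "represents t h"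
      using Rc[OF fgh(1)] Rc[OF fgh(2)] Rc[OF fgh(3)] by blast
    have "(\<lambda>k. (r k \<oplus> s k) \<otimes> t k) = (\<lambda>k. r k \<otimes> t k \<oplus> s k \<otimes> t k)" using rc[OF rst(1)] rc[OF rst(2)] rc[OF rst(3)] by (simp add: l_distr)
    then show "(f \<oplus>\<^bsub>?S\<^esub> g) \<otimes>\<^bsub>?S\<^esub> h = f \<otimes>\<^bsub>?S\<^esub> h \<oplus>\<^bsub>?S\<^esub> g \<otimes>\<^bsub>?S\<^esub> h"
      using represents_unique represents_mult[OF represents_add[OF rst(1,2)] rst(3)]
        represents_add[OF represents_mult[OF rst(1,3)] represents_mult[OF rst(2,3)]] by simp
  qed
qed

sublocale base_changeable R "completion R n" "to_completion R n"
  by (intro base_changeable.intro cring_completion base_changeable_axioms.intro)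
    (rule represents_imp_mem[OF represents_const])

text \<open>From y s + w = 1 with w \<in> n, an approximate inverse is improved step by step: if z =
  r s - 1 lies in n^k, then (r - y z) s - 1 = z w lies in n^(k+1).\<close>

lemma to_completion_unit:
  assumes "maximalideal n R" "s \<in> carrier R" "s \<notin> n"
  shows "\<exists>v\<in>carrier (completion R n). v \<otimes>\<^bsub>completion R n\<^esub> to_completion R n s = \<one>\<^bsub>completion R n\<^esub>"
proof -
  interpret m: maximalideal n R by fact
  obtain y w where yw: "y \<in> carrier R" "w \<in> n" "y \<otimes> s \<oplus> w = \<one>"
    using m.exists_inverse_mod[OF is_cring assms(2,3)] by blast
  have wc: "w \<in> carrier R" using yw n.Icarr by blast
  have "\<exists>r. r \<in> carrier R \<and> r \<otimes> s \<ominus> \<one> \<in> ideal_power R n k" for k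
  proof (induction k)
    case 0
    \<comment> \<open>The power with exponent 0 is the whole ring, so 0 is a valid start.\<close>
    show ?case using assms(2) by (auto simp: ideals_set_def intro!: exI[of _ \<zero>])
  next
    case (Suc k)
    then obtain r where r: "r \<in> carrier R" "r \<otimes> s \<ominus> \<one> \<in> ideal_power R n k" by blast
    define z where "z = r \<otimes> s \<ominus> \<one>"
    have zc: "z \<in> carrier R" using r assms by (simp add: z_def)
    have "(r \<ominus> y \<otimes> z) \<otimes> s \<ominus> \<one> = z \<ominus> y \<otimes> s \<otimes> z"
      using r zc yw(1) assms(2) unfolding z_def by algebra
    also have "\<dots> = z \<ominus> (y \<otimes> s \<oplus> w \<ominus> w) \<otimes> z"
      using zc yw(1) assms(2) wc by algebra
    also have "\<dots> = z \<otimes> w" unfolding yw(3) using zc wc by algebra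
    also have "\<dots> \<in> ideal_power R n (Suc k)"
      unfolding ideal_power_Suc using r(2) yw(2) z_def by (auto intro: ideal_prod.prod)
    finally show ?case using r zc yw(1) by (intro exI[of _ "r \<ominus> y \<otimes> z"]) simp
  qed
  then obtain r where r: "r k \<in> carrier R" "r k \<otimes> s \<ominus> \<one> \<in> ideal_power R n k" for k by metis
  define v where "v = (\<lambda>k. ideal_power R n k +> r k)"
  have v: "represents r v"
  proof -
    have "r (Suc k) \<ominus> r k \<in> ideal_power R n k" for k
    proof -
      interpret p: ideal "ideal_power R n k" R by (rule power_ideal)
      let ?a = "r k \<otimes> s \<ominus> \<one>" and ?b = "r (Suc k) \<otimes> s \<ominus> \<one>"
      have b: "?b \<in> ideal_power R n k" using r ideal_power_decreasing[OF n.is_ideal] by blast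
      \<comment> \<open>Two inverses of s modulo n^k agree modulo n^k. Hence the r k, although
        chosen independently of each other, form a coherent sequence.\<close>
      have "r (Suc k) \<ominus> r k = r k \<otimes> ?b \<ominus> r (Suc k) \<otimes> ?a"
        using r(1)[of k] r(1)[of "Suc k"] assms(2) by algebra
      moreover have "\<dots> \<in> ideal_power R n k"
        using b r p.I_l_closed p.a_closed p.a_inv_closed unfolding a_minus_def by blast
      ultimately show ?thesis by simp
    qed
    then show ?thesis using r by (simp add: represents_def v_def)
  qed
  have "v \<otimes>\<^bsub>completion R n\<^esub> to_completion R n s = to_completion R n \<one>"
  proof
    fix k
    have "(v \<otimes>\<^bsub>completion R n\<^esub> to_completion R n s) k = ideal_power R n k +> (r k \<otimes> s)"
      using represents_mult[OF v represents_const[OF assms(2)]] by (simp add: represents_def)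
    also have "\<dots> = ideal_power R n k +> \<one>" using coset_eq r assms by simp
    finally show "(v \<otimes>\<^bsub>completion R n\<^esub> to_completion R n s) k = to_completion R n \<one> k"
      by (simp add: to_completion_def)
  qed
  then show ?thesis using v represents_imp_mem one_completion by auto
qed

end

section \<open>Orders and lattices\<close>

lemma (in cring) generate_add_mult_closed:
  assumes U: "U \<subseteq> carrier R" and c: "c \<in> carrier R" and V: "subgroup V (add_monoid R)"
    and g: "\<And>x. x \<in> U \<Longrightarrow> c \<otimes> x \<in> V" and x: "x \<in> generate (add_monoid R) U"
  shows "c \<otimes> x \<in> V"
  using x
proof (induction x rule: generate.induct)
  case one
  then show ?case using subgroup.one_closed[OF V] c by simp
next
  case (incl h) then show ?case by (rule g)
next
  case (inv h)
  have "c \<otimes> inv\<^bsub>add_monoid R\<^esub> h = inv\<^bsub>add_monoid R\<^esub> (c \<otimes> h)"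
    using inv U c by (simp add: a_inv_def[symmetric] r_minus subset_iff)
  then show ?case using subgroup.m_inv_closed[OF V g[OF inv]] by simp
next
  case (eng h1 h2)
  then have "h1 \<in> carrier R" "h2 \<in> carrier R" using add.generate_in_carrier[OF U] by auto
  then have "c \<otimes> (h1 \<oplus> h2) = c \<otimes> h1 \<oplus> c \<otimes> h2" using c r_distr by blast
  then show ?case using subgroup.m_closed[OF V eng.IH] by simp
qed

text \<open>An order over the integers in an algebra over the rationals, in axiomatic form. Positive
  integers are units of \<open>K\<close> and every element of \<open>K\<close> has an integer
  denominator, so elements of \<open>K\<close> can be moved into \<open>R\<close> by integers even
  when \<open>K\<close> has zero divisors.\<close>

locale order_in_algebra = cring K for K (structure) +
  fixes R :: "'a set"
  assumes subring: "subring R K"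
    and order_fg: "\<exists>U. finite U \<and> U \<subseteq> carrier K \<and> R \<subseteq> generate (add_monoid K) U"
    and int_unit: "n > 0 \<Longrightarrow> add_pow K (n::nat) \<one> \<in> Units K"
    and denominator: "x \<in> carrier K \<Longrightarrow> \<exists>n>0. add_pow K (n::nat) x \<in> R"
begin

abbreviation order_ring ("\<R>") where "order_ring \<equiv> K\<lparr>carrier := R\<rparr>"

lemma order_carrier: "r \<in> R \<Longrightarrow> r \<in> carrier K"
  and order_zero: "\<zero> \<in> R" and order_one: "\<one> \<in> R"
  and order_minus: "r \<in> R \<Longrightarrow> \<ominus> r \<in> R"
  and order_add: "r \<in> R \<Longrightarrow> s \<in> R \<Longrightarrow> r \<oplus> s \<in> R"
  and order_mult: "r \<in> R \<Longrightarrow> s \<in> R \<Longrightarrow> r \<otimes> s \<in> R"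
  using subringE[OF subring] by auto

lemma order_diff: "r \<in> R \<Longrightarrow> s \<in> R \<Longrightarrow> r \<ominus> s \<in> R"
  unfolding a_minus_def using order_add order_minus by blast

lemma order_cring: "cring \<R>"
  using subring order_carrier m_comm by (intro subcring_iff[THEN iffD1] subcringI') auto

definition submodule_of :: "'a set \<Rightarrow> bool" where
  "submodule_of L \<longleftrightarrow> subgroup L (add_monoid K) \<and> (\<forall>r\<in>R. \<forall>x\<in>L. r \<otimes> x \<in> L)"

text \<open>Containment in a finitely generated group, rather than equality with one, passes to
  every subset at once; \<open>generate_finitely_generated\<close> recovers generators inside a
  subgroup.\<close>

definition fg :: "'a set \<Rightarrow> bool" where
  "fg L \<longleftrightarrow> (\<exists>U. finite U \<and> U \<subseteq> carrier K \<and> L \<subseteq> generate (add_monoid K) U)"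

definition lattice_in :: "'a set \<Rightarrow> bool" where
  "lattice_in L \<longleftrightarrow> submodule_of L \<and> fg L \<and> L \<inter> Units K \<noteq> {}"

lemma submodule_ofI:
  assumes "L \<subseteq> carrier K" "\<zero> \<in> L" "\<And>x y. x \<in> L \<Longrightarrow> y \<in> L \<Longrightarrow> x \<oplus> y \<in> L"
    "\<And>r x. r \<in> R \<Longrightarrow> x \<in> L \<Longrightarrow> r \<otimes> x \<in> L"
  shows "submodule_of L"
proof -
  have "\<ominus> x \<in> L" if "x \<in> L" for x
  proof -
    have "(\<ominus> \<one>) \<otimes> x \<in> L" using assms(4) order_minus order_one that by blast
    then show ?thesis using that assms(1) by (simp add: l_minus subset_iff)
  qed
  then have "subgroup L (add_monoid K)"
    using assms by (intro add.subgroupI) (auto simp: a_inv_def)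
  then show ?thesis using assms(4) unfolding submodule_of_def by blast
qed

lemma submodule_ofD:
  assumes "submodule_of L"
  shows "subgroup L (add_monoid K)" "L \<subseteq> carrier K" "\<zero> \<in> L" "\<And>x y. x \<in> L \<Longrightarrow> y \<in> L \<Longrightarrow> x \<oplus> y \<in> L"
    "\<And>x. x \<in> L \<Longrightarrow> \<ominus> x \<in> L" "\<And>x y. x \<in> L \<Longrightarrow> y \<in> L \<Longrightarrow> x \<ominus> y \<in> L"
    "\<And>r x. r \<in> R \<Longrightarrow> x \<in> L \<Longrightarrow> r \<otimes> x \<in> L" "\<And>x. x \<in> L \<Longrightarrow> x \<in> carrier K"
proof -
  show sg: "subgroup L (add_monoid K)" using assms by (simp add: submodule_of_def)
  show "L \<subseteq> carrier K" "\<And>x. x \<in> L \<Longrightarrow> x \<in> carrier K" using subgroup.subset[OF sg] by auto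
  show "\<zero> \<in> L" using subgroup.one_closed[OF sg] by simp
  show ad: "\<And>x y. x \<in> L \<Longrightarrow> y \<in> L \<Longrightarrow> x \<oplus> y \<in> L" using subgroup.m_closed[OF sg] by simp
  show mi: "\<And>x. x \<in> L \<Longrightarrow> \<ominus> x \<in> L" using subgroup.m_inv_closed[OF sg] by (simp add: a_inv_def)
  show "\<And>x y. x \<in> L \<Longrightarrow> y \<in> L \<Longrightarrow> x \<ominus> y \<in> L" using ad mi by (simp add: a_minus_def)
  show "\<And>r x. r \<in> R \<Longrightarrow> x \<in> L \<Longrightarrow> r \<otimes> x \<in> L" using assms by (simp add: submodule_of_def)
qed

lemma submodule_of_scale:
  assumes "submodule_of L" "c \<in> carrier K"
  shows "submodule_of ((\<otimes>) c ` L)"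
proof -
  note D = submodule_ofD[OF assms(1)]
  show ?thesis
  proof (rule submodule_ofI)
    show "(\<otimes>) c ` L \<subseteq> carrier K" using D(8) assms(2) by auto
    show "\<zero> \<in> (\<otimes>) c ` L" using imageI[OF D(3), of "(\<otimes>) c"] assms(2) by simp
    fix x y assume "x \<in> (\<otimes>) c ` L" "y \<in> (\<otimes>) c ` L"
    then obtain u v where uv: "u \<in> L" "v \<in> L" "x = c \<otimes> u" "y = c \<otimes> v" by blast
    then have "x \<oplus> y = c \<otimes> (u \<oplus> v)" using D(8) assms(2) by (simp add: r_distr)
    then show "x \<oplus> y \<in> (\<otimes>) c ` L" using D(4)[OF uv(1,2)] by blast
  next
    fix r x assume r: "r \<in> R" and "x \<in> (\<otimes>) c ` L"
    then obtain u where u: "u \<in> L" "x = c \<otimes> u" by blast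
    have "r \<otimes> x = c \<otimes> (r \<otimes> u)"
      unfolding u(2) by (rule m_lcomm[OF order_carrier[OF r] assms(2) D(8)[OF u(1)]])
    then show "r \<otimes> x \<in> (\<otimes>) c ` L" using D(7)[OF r u(1)] by blast
  qed
qed

lemma submodule_of_sum:
  assumes "submodule_of L" "submodule_of M"
  shows "submodule_of {x \<oplus> y | x y. x \<in> L \<and> y \<in> M}" (is "submodule_of ?S")
proof -
  note L = submodule_ofD[OF assms(1)] and M = submodule_ofD[OF assms(2)]
  have mem: "x \<oplus> y \<in> ?S" if "x \<in> L" "y \<in> M" for x y using that by blast
  show ?thesis
  proof (rule submodule_ofI)
    show "?S \<subseteq> carrier K" using L(8) M(8) by auto
    show "\<zero> \<in> ?S" using mem[OF L(3) M(3)] by simp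
    fix u v assume "u \<in> ?S" "v \<in> ?S"
    then obtain x y x' y' where xy: "x \<in> L" "y \<in> M" "u = x \<oplus> y" "x' \<in> L" "y' \<in> M" "v = x' \<oplus> y'" by blast
    then have "u \<oplus> v = (x \<oplus> x') \<oplus> (y \<oplus> y')" using L(8) M(8) by (simp add: a_ac)
    then show "u \<oplus> v \<in> ?S" using mem[OF L(4)[OF xy(1,4)] M(4)[OF xy(2,5)]] by simp
  next
    fix r u assume r: "r \<in> R" and "u \<in> ?S"
    then obtain x y where xy: "x \<in> L" "y \<in> M" "u = x \<oplus> y" by blast
    then have "r \<otimes> u = r \<otimes> x \<oplus> r \<otimes> y" using r order_carrier L(8) M(8) by (simp add: r_distr)
    then show "r \<otimes> u \<in> ?S" using mem[OF L(7)[OF r xy(1)] M(7)[OF r xy(2)]] by simp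
  qed
qed

lemma submodule_of_order: "submodule_of R"
  by (rule submodule_ofI) (auto simp: order_carrier order_zero order_add order_mult)

lemma fg_mono: "fg L \<Longrightarrow> L' \<subseteq> L \<Longrightarrow> fg L'"
  unfolding fg_def by blast

lemma fg_order: "fg R" using order_fg by (simp add: fg_def)

lemma generate_finitely_generated:
  assumes "fg L" "subgroup L (add_monoid K)"
  obtains Y where "finite Y" "Y \<subseteq> L" "L = generate (add_monoid K) Y"
proof -
  obtain U where "finite U" "U \<subseteq> carrier K" "L \<subseteq> generate (add_monoid K) U" using assms(1) fg_def by blast
  then obtain Y where "finite Y \<and> Y \<subseteq> L \<and> L = generate (add_monoid K) Y"
    using add.subgroup_finitely_generated[of U L] assms(2) by auto
  then show thesis using that by blast
qed

lemma generate_scale: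
  assumes "c \<in> carrier K" "U \<subseteq> carrier K" "x \<in> generate (add_monoid K) U"
  shows "c \<otimes> x \<in> generate (add_monoid K) ((\<otimes>) c ` U)"
proof (rule generate_add_mult_closed[OF assms(2,1) _ _ assms(3)])
  show "subgroup (generate (add_monoid K) ((\<otimes>) c ` U)) (add_monoid K)"
    by (rule add.generate_is_subgroup) (use assms(1,2) in auto)
qed (simp add: generate.incl)

lemma fg_scale:
  assumes "c \<in> carrier K" "fg L"
  shows "fg ((\<otimes>) c ` L)"
proof -
  obtain U where U: "finite U" "U \<subseteq> carrier K" "L \<subseteq> generate (add_monoid K) U" using assms(2) fg_def by blast
  then have "(\<otimes>) c ` L \<subseteq> generate (add_monoid K) ((\<otimes>) c ` U)" using generate_scale[OF assms(1) U(2)] by blast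
  moreover have "(\<otimes>) c ` U \<subseteq> carrier K" using U assms by auto
  ultimately show ?thesis unfolding fg_def using U(1) by blast
qed

lemma fg_sum:
  assumes "fg L" "fg L'"
  shows "fg {x \<oplus> y | x y. x \<in> L \<and> y \<in> L'}"
proof -
  obtain U where U: "finite U" "U \<subseteq> carrier K" "L \<subseteq> generate (add_monoid K) U" using assms fg_def by blast
  obtain U' where U': "finite U'" "U' \<subseteq> carrier K" "L' \<subseteq> generate (add_monoid K) U'" using assms fg_def by blast
  let ?V = "generate (add_monoid K) (U \<union> U')"
  have "L \<subseteq> ?V" "L' \<subseteq> ?V"
    using U U' add.mono_generate[of U "U \<union> U'"] add.mono_generate[of U' "U \<union> U'"] by auto
  moreover have "x \<oplus> y \<in> ?V" if "x \<in> ?V" "y \<in> ?V" for x y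
    using generate.eng[OF that] by simp
  ultimately have "{x \<oplus> y | x y. x \<in> L \<and> y \<in> L'} \<subseteq> ?V" by auto
  then show ?thesis unfolding fg_def using U U' by (intro exI[of _ "U \<union> U'"]) auto
qed

lemma add_pow_eq_mult: "x \<in> carrier K \<Longrightarrow> add_pow K (n::nat) x = add_pow K n \<one> \<otimes> x"
  using add_pow_ldistr[of \<one> x n] by simp

lemma int_in_order: "add_pow K (n::nat) \<one> \<in> R"
proof (induction n)
  case 0 then show ?case using order_zero by simp
next
  case (Suc n) then show ?case using order_add order_one by simp
qed

text \<open>For a single x, an integer denominator of x/b moves x into R b, which lies in
  \<open>L\<close>. The product of the denominators of finitely many generators then serves for all
  of \<open>J\<close>.\<close>

lemma fg_denominator:
  assumes L: "submodule_of L" and b: "b \<in> L" "b \<in> Units K" and J: "fg J"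
  obtains n :: nat where "n > 0" "\<And>x. x \<in> J \<Longrightarrow> add_pow K n \<one> \<otimes> x \<in> L"
proof -
  note LD = submodule_ofD[OF L]
  have single: "\<exists>n>0. add_pow K (n::nat) \<one> \<otimes> x \<in> L" if x: "x \<in> carrier K" for x
  proof -
    have bc: "b \<in> carrier K" "inv b \<in> carrier K" using b by auto
    obtain n where n: "n > 0" "add_pow K (n::nat) (x \<otimes> inv b) \<in> R" using denominator x bc by blast
    have "add_pow K n (x \<otimes> inv b) \<otimes> b = add_pow K n \<one> \<otimes> (x \<otimes> (inv b \<otimes> b))"
      using x bc by (simp add: add_pow_eq_mult[of "x \<otimes> inv b"] m_assoc)
    then have "add_pow K n (x \<otimes> inv b) \<otimes> b = add_pow K n \<one> \<otimes> x" using b x by simp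
    then show ?thesis using n LD(7)[OF n(2) b(1)] by auto
  qed
  obtain U where U: "finite U" "U \<subseteq> carrier K" "J \<subseteq> generate (add_monoid K) U" using J fg_def by blast
  have "\<exists>n>0. \<forall>x\<in>U. add_pow K (n::nat) \<one> \<otimes> x \<in> L" using U(1,2)
  proof (induction U rule: finite_induct)
    case empty then show ?case by auto
  next
    case (insert u U)
    then obtain n where n: "n > 0" "\<forall>x\<in>U. add_pow K (n::nat) \<one> \<otimes> x \<in> L" by auto
    obtain k where k: "k > 0" "add_pow K (k::nat) \<one> \<otimes> u \<in> L"
      using single[of u] insert.prems by blast
    let ?n = "add_pow K n \<one>" and ?k = "add_pow K k \<one>"
    have nk: "add_pow K (n * k) \<one> = ?n \<otimes> ?k" using add_pow_eq_mult[of ?k n] by (simp add: add.nat_pow_pow mult.commute)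
    have c: "?n \<in> carrier K" "?k \<in> carrier K" by auto
    have "?n \<otimes> ?k \<otimes> x \<in> L" if "x \<in> insert u U" for x
    proof (cases "x = u")
      case True
      then show ?thesis using LD(7)[OF int_in_order k(2)] insert.prems c by (simp add: m_assoc)
    next
      case False
      then have "?k \<otimes> (?n \<otimes> x) \<in> L" using that n(2) LD(7)[OF int_in_order] by blast
      moreover have "x \<in> carrier K" using that insert.prems by auto
      ultimately show ?thesis using c by (metis m_assoc m_comm)
    qed
    then show ?case using n(1) k(1) nk by (intro exI[of _ "n * k"]) simp
  qed
  then obtain n where n: "n > 0" "\<forall>x\<in>U. add_pow K (n::nat) \<one> \<otimes> x \<in> L" by blast
  let ?n = "add_pow K n \<one>"
  have "?n \<otimes> x \<in> L" if "x \<in> generate (add_monoid K) U" for x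
  proof -
    have "?n \<otimes> x \<in> generate (add_monoid K) ((\<otimes>) ?n ` U)" by (rule generate_scale) (use that U in auto)
    moreover have "generate (add_monoid K) ((\<otimes>) ?n ` U) \<subseteq> L"
      by (rule add.generate_subgroup_incl) (use n LD(1) in auto)
    ultimately show ?thesis by blast
  qed
  then show thesis using that[OF n(1)] U(3) by blast
qed

section \<open>Spans over the order\<close>

lemma Span_Cons_eq: "Span R (u # us) = {k \<otimes> u \<oplus> v | k v. k \<in> R \<and> v \<in> Span R us}"
proof -
  have e: "Span R (u # us) = line_extension R u (Span R us)" by simp
  show ?thesis unfolding e set_eq_iff mem_Collect_eq line_extension_mem_iff by blast
qed

lemma Span_lattice:
  assumes "set us \<subseteq> carrier K"
  shows "submodule_of (Span R us) \<and> fg (Span R us) \<and> set us \<subseteq> Span R us"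
  using assms
proof (induction us)
  case Nil
  have "fg {\<zero>}" using fg_mono[OF fg_order] order_zero by blast
  moreover have "submodule_of {\<zero>}" by (rule submodule_ofI) (auto simp: order_carrier)
  ultimately show ?case by simp
next
  case (Cons u us)
  have u: "u \<in> carrier K" using Cons by simp
  define E where "E = Span R us"
  have E: "submodule_of E" "fg E" "set us \<subseteq> E" using Cons unfolding E_def by auto
  note D = submodule_ofD[OF E(1)]
  define F where "F = {x \<oplus> y | x y. x \<in> (\<otimes>) u ` R \<and> y \<in> E}"
  have comm: "k \<otimes> u = u \<otimes> k" if "k \<in> R" for k using m_comm[OF order_carrier[OF that] u] .
  have F: "Span R (u # us) = F" unfolding Span_Cons_eq F_def E_def[symmetric] using comm by force
  have memF: "k \<otimes> u \<oplus> v \<in> F" if "k \<in> R" "v \<in> E" for k v unfolding F_def comm[OF that(1)] using that by blast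
  have "submodule_of F"
    unfolding F_def by (rule submodule_of_sum[OF submodule_of_scale[OF submodule_of_order u] E(1)])
  moreover have "fg F" unfolding F_def by (rule fg_sum[OF fg_scale[OF u fg_order] E(2)])
  moreover have "u \<in> F" using memF[OF order_one D(3)] u by simp
  moreover have "w \<in> F" if "w \<in> E" for w
    using memF[OF order_zero that] u D(8)[OF that] by simp
  ultimately show ?case unfolding F using E(3) by auto
qed

text \<open>Translation between \<open>fractional_ideal\<close>, which speaks of spans over
  \<open>R\<close>, and lattices, which have generators over the integers. One direction holds
  because \<open>R\<close>, and with it each u R, is finitely generated as a group; the other
  because generators over the integers also span over \<open>R\<close>.\<close>

lemma Span_iff:
  "(\<exists>us. set us \<subseteq> carrier K \<and> L = Span R us) \<longleftrightarrow> submodule_of L \<and> fg L"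
proof
  assume "\<exists>us. set us \<subseteq> carrier K \<and> L = Span R us"
  then show "submodule_of L \<and> fg L" using Span_lattice by blast
next
  assume L: "submodule_of L \<and> fg L"
  note D = submodule_ofD[OF conjunct1[OF L]]
  obtain Y where Y: "finite Y" "Y \<subseteq> L" "L = generate (add_monoid K) Y"
    using generate_finitely_generated L D(1) by blast
  obtain us where us: "set us = Y" using finite_list Y(1) by blast
  have usK: "set us \<subseteq> carrier K" using us Y(2) D(2) by blast
  have "set vs \<subseteq> L \<Longrightarrow> Span R vs \<subseteq> L" for vs
  proof (induction vs)
    case Nil then show ?case using D(3) by simp
  next
    case (Cons v vs)
    then show ?case unfolding Span_Cons_eq using D(4,7) by (auto simp del: Span.simps)
  qed
  moreover have "L \<subseteq> Span R us"
    unfolding Y(3)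
    by (rule add.generate_subgroup_incl)
      (use Span_lattice[OF usK] submodule_ofD(1) us in blast)+
  ultimately show "\<exists>us. set us \<subseteq> carrier K \<and> L = Span R us" using usK us Y(2) by blast
qed

text \<open>A finiteness argument in place of a determinant. Every t^k lies in u^(-1) T, which is
  finitely generated, so the group \<open>H\<close> generated by all powers of t is finitely
  generated. The groups \<open>E k\<close> increase and exhaust \<open>H\<close>, hence one of them
  contains its generators, and t^k becomes an integer combination of lower powers.\<close>

lemma integral_of_stable:
  assumes t: "t \<in> carrier K" and T: "fg T" "\<And>x. x \<in> T \<Longrightarrow> t \<otimes> x \<in> T"
    and u: "u \<in> T" "u \<in> Units K"
  shows "t \<in> maximal_order K"
proof -
  let ?Z = "generate_ring K {}"
  \<comment> \<open>The integer combinations of the powers of t below t^k. In \<open>eval\<close>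
    the head of the list is the leading coefficient, so prepending c to a list of length k adds c
    t^k.\<close>
  define E where "E k = {eval p t | p. length p = k \<and> set p \<subseteq> ?Z}" for k
  have Zc: "?Z \<subseteq> carrier K" using generate_ring_incl by blast
  have Z0: "\<zero> \<in> ?Z" by (rule zero_in_generate)
  have ESuc: "E (Suc k) = {c \<otimes> t [^] k \<oplus> e | c e. c \<in> ?Z \<and> e \<in> E k}" for k
  proof
    show "E (Suc k) \<subseteq> {c \<otimes> t [^] k \<oplus> e | c e. c \<in> ?Z \<and> e \<in> E k}"
    proof
      fix x assume "x \<in> E (Suc k)"
      then obtain p where p: "x = eval p t" "length p = Suc k" "set p \<subseteq> ?Z" unfolding E_def by blast
      then obtain c p' where p': "p = c # p'" by (metis length_Suc_conv)
      then have "eval p' t \<in> E k" "c \<in> ?Z" "x = c \<otimes> t [^] k \<oplus> eval p' t" using p unfolding E_def by auto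
      then show "x \<in> {c \<otimes> t [^] k \<oplus> e | c e. c \<in> ?Z \<and> e \<in> E k}" by blast
    qed
    show "{c \<otimes> t [^] k \<oplus> e | c e. c \<in> ?Z \<and> e \<in> E k} \<subseteq> E (Suc k)"
    proof clarify
      fix c e assume c: "c \<in> ?Z" and "e \<in> E k"
      then obtain p where p: "e = eval p t" "length p = k" "set p \<subseteq> ?Z" unfolding E_def by blast
      then have "c \<otimes> t [^] k \<oplus> e = eval (c # p) t" by simp
      then show "c \<otimes> t [^] k \<oplus> e \<in> E (Suc k)" unfolding E_def using p c
        by (intro CollectI exI[of _ "c # p"]) auto
    qed
  qed
  have E0: "E 0 = {\<zero>}" unfolding E_def by auto
  have Esub: "subgroup (E k) (add_monoid K)" for k
  proof (induction k)
    case 0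
    show ?case unfolding E0 by (rule add.subgroupI) (auto simp: a_inv_def[symmetric])
  next
    case (Suc k)
    have Ec: "e \<in> carrier K" if "e \<in> E k" for e using subgroup.subset[OF Suc] that by auto
    have Ea: "e \<oplus> e' \<in> E k" if "e \<in> E k" "e' \<in> E k" for e e' using subgroup.m_closed[OF Suc] that by simp
    have Ei: "\<ominus> e \<in> E k" if "e \<in> E k" for e using subgroup.m_inv_closed[OF Suc] that by (simp add: a_inv_def)
    have tk: "t [^] k \<in> carrier K" using t by simp
    show ?case
    proof (rule add.subgroupI)
      show "E (Suc k) \<subseteq> carrier K" unfolding ESuc using Ec Zc tk by auto
      show "E (Suc k) \<noteq> {}" unfolding ESuc using Z0 subgroup.one_closed[OF Suc] by auto
      fix x assume "x \<in> E (Suc k)"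
      then obtain c e where x: "x = c \<otimes> t [^] k \<oplus> e" "c \<in> ?Z" "e \<in> E k" unfolding ESuc by blast
      have cc: "c \<in> carrier K" "e \<in> carrier K" using x Zc Ec by auto
      have "\<ominus> x = (\<ominus> c) \<otimes> t [^] k \<oplus> (\<ominus> e)" unfolding x(1) using cc tk by algebra
      then have "\<ominus> x \<in> E (Suc k)" unfolding ESuc using generate_ring.a_inv[OF x(2)] Ei[OF x(3)] by blast
      then show "\<ominus> x \<in> E (Suc k)" .
      fix y assume "y \<in> E (Suc k)"
      then obtain c' e' where y: "y = c' \<otimes> t [^] k \<oplus> e'" "c' \<in> ?Z" "e' \<in> E k" unfolding ESuc by blast
      have cc': "c' \<in> carrier K" "e' \<in> carrier K" using y Zc Ec by auto
      have "x \<oplus> y = (c \<oplus> c') \<otimes> t [^] k \<oplus> (e \<oplus> e')" unfolding x(1) y(1) using cc cc' tk by algebra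
      then show "x \<oplus> y \<in> E (Suc k)"
        unfolding ESuc using generate_ring.eng_add[OF x(2) y(2)] Ea[OF x(3) y(3)] by blast
    qed
  qed
  have Emono: "E k \<subseteq> E (Suc k)" for k
  proof
    fix e assume e: "e \<in> E k"
    then have "e \<in> carrier K" using subgroup.subset[OF Esub] by fastforce
    then have "e = \<zero> \<otimes> t [^] k \<oplus> e" using t by simp
    then show "e \<in> E (Suc k)" unfolding ESuc using e Z0 by blast
  qed
  then have Emono': "E k \<subseteq> E l" if "k \<le> l" for k l using lift_Suc_mono_le[of E] that by blast
  have pow: "t [^] k \<in> E (Suc k)" for k
  proof -
    have "t [^] k = \<one> \<otimes> t [^] k \<oplus> \<zero>" using t by simp
    moreover have "\<zero> \<in> E k" using subgroup.one_closed[OF Esub] by simp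
    ultimately show ?thesis unfolding ESuc using generate_ring.one[of K "{}"] by blast
  qed
  have powT: "t [^] (k::nat) \<otimes> u \<in> T" for k
  proof (induction k)
    case 0 then show ?case using u by (simp add: Units_closed)
  next
    case (Suc k)
    have "t \<otimes> (t [^] k \<otimes> u) \<in> T" using T(2) Suc by blast
    then show ?case using t u by (simp add: Units_closed m_assoc[symmetric] m_comm)
  qed
  define H where "H = generate (add_monoid K) (range (\<lambda>k::nat. t [^] k))"
  have H: "subgroup H (add_monoid K)" unfolding H_def by (rule add.generate_is_subgroup) (use t in auto)
  have "fg H"
  proof -
    have "fg ((\<otimes>) (inv u) ` T)" using fg_scale[OF _ T(1)] u by blast
    then obtain U where U: "finite U" "U \<subseteq> carrier K" "(\<otimes>) (inv u) ` T \<subseteq> generate (add_monoid K) U"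
      unfolding fg_def by blast
    have "t [^] (k::nat) \<in> generate (add_monoid K) U" for k
    proof -
      have "inv u \<otimes> (t [^] k \<otimes> u) = t [^] k \<otimes> (inv u \<otimes> u)"
        using t u(2) by (intro m_lcomm) (auto simp: Units_closed)
      then have "inv u \<otimes> (t [^] k \<otimes> u) = t [^] k" using t u(2) by simp
      moreover have "inv u \<otimes> (t [^] k \<otimes> u) \<in> generate (add_monoid K) U"
        by (rule subsetD[OF U(3) imageI[OF powT]])
      ultimately show ?thesis by simp
    qed
    then have "H \<subseteq> generate (add_monoid K) U" unfolding H_def
      by (intro add.generate_subgroup_incl add.generate_is_subgroup U(2)) auto
    then show ?thesis unfolding fg_def using U by blast
  qed
  then obtain Y where Y: "finite Y" "Y \<subseteq> H" "H = generate (add_monoid K) Y"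
    using generate_finitely_generated H by blast
  have "x \<in> (\<Union>k. E k)" if "x \<in> H" for x
    using that unfolding H_def
  proof (induction x rule: generate.induct)
    case one
    then show ?case using E0 by auto
  next
    case (incl h) then show ?case using pow by blast
  next
    case (inv h)
    then obtain k where "h \<in> E k" using pow by blast
    then show ?case using subgroup.m_inv_closed[OF Esub] by blast
  next
    case (eng h1 h2)
    then obtain k l where kl: "h1 \<in> E k" "h2 \<in> E l" by blast
    then have "h1 \<in> E (max k l)" "h2 \<in> E (max k l)" using Emono'[of k "max k l"] Emono'[of l "max k l"] by auto
    then show ?case using subgroup.m_closed[OF Esub] by blast
  qed
  then have "\<forall>y\<in>Y. \<exists>k. y \<in> E k" using Y(2) by blast
  then obtain f where f: "\<And>y. y \<in> Y \<Longrightarrow> y \<in> E (f y)" by metis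
  define k where "k = Max (insert 0 (f ` Y))"
  have "Y \<subseteq> E k"
  proof
    fix y assume y: "y \<in> Y"
    then have "f y \<le> k" unfolding k_def using Y(1) by simp
    then show "y \<in> E k" using f[OF y] Emono' by blast
  qed
  then have "H \<subseteq> E k" unfolding Y(3) by (rule add.generate_subgroup_incl[OF _ Esub])
  moreover have "t [^] k \<in> H" unfolding H_def by (rule generate.incl) simp
  \<comment> \<open>The negative is taken so that prepending the coefficient 1 to the resulting list
    yields a monic polynomial that vanishes at t.\<close>
  ultimately have "inv\<^bsub>add_monoid K\<^esub> (t [^] k) \<in> E k" using subgroup.m_inv_closed[OF Esub] by blast
  then have "\<ominus> (t [^] k) \<in> E k" by (simp add: a_inv_def)
  then obtain p where p: "\<ominus> (t [^] k) = eval p t" "length p = k" "set p \<subseteq> ?Z" unfolding E_def by blast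
  have "eval (\<one> # p) t = \<one> \<otimes> t [^] k \<oplus> eval p t" using p(2) by simp
  also have "\<dots> = \<zero>" unfolding p(1)[symmetric] using t by (simp add: r_neg)
  finally have ev: "eval (\<one> # p) t = \<zero>" .
  have "set (\<one> # p) \<subseteq> ?Z" using p(3) generate_ring.one[of K "{}"] by simp
  then show ?thesis unfolding maximal_order_def using t ev by (intro CollectI conjI exI[of _ "\<one> # p"]) auto
qed

text \<open>By regularity the fraction x/1 equals some r/s, which means v s x = v r with v \<notin>
  m; the denominator is v s. The factor v belongs to equality of fractions in a ring with zero
  divisors, and v s stays outside m because m is prime.\<close>

lemma regular_denominator:
  assumes m: "maximalideal m \<R>" and reg: "localization K R m R = localization K R m (maximal_order K)"
    and x: "x \<in> maximal_order K"
  shows "\<exists>s\<in>R - m. s \<otimes> x \<in> R"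
proof -
  interpret m: maximalideal m \<R> by fact
  interpret R: cring \<R> by (rule order_cring)
  interpret p: primeideal m \<R> using R.maximalideal_prime[OF m] .
  have xc: "x \<in> carrier K" using x by (simp add: maximal_order_def)
  have one: "\<one> \<in> R - m" using m.one_imp_carrier m.I_notcarr order_one by auto
  have "loc_fraction K R m x \<one> \<in> localization K R m R"
    unfolding reg using x one by (auto simp: localization_def)
  then obtain r s where rs: "r \<in> R" "s \<in> R - m" "loc_fraction K R m x \<one> = loc_fraction K R m r s"
    unfolding localization_def by auto
  have "(x, \<one>) \<in> loc_fraction K R m x \<one>" unfolding loc_fraction_def using xc one by auto
  then have "(x, \<one>) \<in> loc_fraction K R m r s" using rs(3) by simp
  then obtain v where v: "v \<in> R - m" "v \<otimes> (\<one> \<otimes> r) = v \<otimes> (s \<otimes> x)" unfolding loc_fraction_def by auto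
  have "(v \<otimes> s) \<otimes> x = v \<otimes> r"
    using v rs order_carrier xc by (simp add: m_assoc)
  moreover have "v \<otimes> s \<in> R - m" using v(1) rs(2) order_mult p.I_prime[of v s] by auto
  moreover have "v \<otimes> r \<in> R" using order_mult v(1) rs(1) by blast
  ultimately show ?thesis by (intro bexI[of _ "v \<otimes> s"]) simp_all
qed

end

section \<open>Ideals of the order and quotient modules\<close>

context order_in_algebra
begin

lemma order_ideal_submodule:
  assumes "ideal m \<R>"
  shows "submodule_of m" "m \<subseteq> R"
proof -
  interpret m: ideal m \<R> by fact
  show mR: "m \<subseteq> R" using m.a_subset by simp
  show "submodule_of m"
    by (rule submodule_ofI) (use mR order_carrier additive_subgroup.zero_closed[OF m.is_additive_subgroup]
      additive_subgroup.a_closed[OF m.is_additive_subgroup] m.I_l_closed in auto)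
qed

lemma order_ring_minus: "r \<in> R \<Longrightarrow> \<ominus>\<^bsub>\<R>\<^esub> r = \<ominus> r"
proof -
  assume r: "r \<in> R"
  interpret R: cring \<R> by (rule order_cring)
  have "\<ominus> r \<oplus>\<^bsub>\<R>\<^esub> r = \<zero>\<^bsub>\<R>\<^esub>" using r order_carrier by (simp add: l_neg)
  then show ?thesis using R.minus_equality[of "\<ominus> r" r] r order_minus by simp
qed

lemma submodule_order_ideal:
  assumes "submodule_of m" "m \<subseteq> R"
  shows "ideal m \<R>"
proof -
  interpret R: cring \<R> by (rule order_cring)
  note D = submodule_ofD[OF assms(1)]
  show ?thesis
  proof (rule idealI)
    show "ring \<R>" by (rule cring.axioms(1)[OF order_cring])
    show "subgroup m (add_monoid \<R>)"
    proof (rule R.add.subgroupI)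
      show "m \<subseteq> carrier \<R>" "m \<noteq> {}" using assms(2) D(3) by auto
      fix a assume a: "a \<in> m"
      have "\<ominus>\<^bsub>\<R>\<^esub> a = \<ominus> a" using a assms(2) order_ring_minus by blast
      then show "\<ominus>\<^bsub>\<R>\<^esub> a \<in> m" using D(5)[OF a] by simp
    qed (use D(4) in simp)
    fix a x assume "a \<in> m" "x \<in> carrier \<R>"
    then have "x \<otimes> a \<in> m" "a \<otimes> x = x \<otimes> a"
      using D(7,8) order_carrier m_comm[of a x] by simp_all
    then show "x \<otimes>\<^bsub>\<R>\<^esub> a \<in> m" "a \<otimes>\<^bsub>\<R>\<^esub> x \<in> m" by simp_all
  qed
qed

lemma r_coset_order: "m +>\<^bsub>\<R>\<^esub> r = m +> r"
  by (simp add: a_r_coset_def r_coset_def)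

lemma carrier_order_quot: "carrier (\<R> Quot m) = (+>) m ` R"
  unfolding FactRing_def A_RCOSETS_def' by (auto simp: r_coset_order)

lemma mem_coset_iff_diff:
  assumes "submodule_of L" "x \<in> carrier K" "y \<in> carrier K"
  shows "x \<in> L +> y \<longleftrightarrow> x \<ominus> y \<in> L"
proof
  assume "x \<in> L +> y"
  then obtain l where l: "l \<in> L" "x = l \<oplus> y" unfolding a_r_coset_def' by blast
  have "l \<oplus> y \<ominus> y = l" using submodule_ofD(8)[OF assms(1) l(1)] assms(3) by algebra
  then show "x \<ominus> y \<in> L" using l by simp
next
  assume l: "x \<ominus> y \<in> L"
  have "x = (x \<ominus> y) \<oplus> y" using assms by algebra
  then show "x \<in> L +> y" using l unfolding a_r_coset_def' by blast
qed

lemma coset_eq_iff_diff: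
  assumes "submodule_of L" "x \<in> carrier K" "y \<in> carrier K"
  shows "L +> x = L +> y \<longleftrightarrow> x \<ominus> y \<in> L"
proof -
  have L: "abelian_subgroup L K"
    by (rule abelian_subgroupI3[OF additive_subgroup.intro[OF submodule_ofD(1)[OF assms(1)]] abelian_group_axioms])
  have "L +> x = L +> y \<longleftrightarrow> x \<in> L +> y"
    using abelian_subgroup.a_rcos_self[OF L assms(2)] abelian_subgroup.a_repr_independence'[OF L _ assms(3), of x]
    by auto
  then show ?thesis using mem_coset_iff_diff[OF assms] by simp
qed

lemma carrier_quot_submod: "carrier (quot_module (submod K T) S) = (+>) S ` T"
  unfolding quot_module_def A_RCOSETS_def RCOSETS_def by (auto simp: submod_def a_r_coset_def r_coset_def)

lemma zero_quot_submod: "\<zero>\<^bsub>quot_module (submod K T) S\<^esub> = S"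
  by (simp add: quot_module_def)

lemma add_quot_submod:
  assumes "submodule_of S" "x \<in> carrier K" "y \<in> carrier K"
  shows "(S +> x) \<oplus>\<^bsub>quot_module (submod K T) S\<^esub> (S +> y) = S +> (x \<oplus> y)"
proof -
  have S: "abelian_subgroup S K"
    by (rule abelian_subgroupI3[OF additive_subgroup.intro[OF submodule_ofD(1)[OF assms(1)]] abelian_group_axioms])
  have "(S +> x) \<oplus>\<^bsub>quot_module (submod K T) S\<^esub> (S +> y) = (S +> x) <+> (S +> y)"
    by (simp add: quot_module_def submod_def set_add_def set_mult_def)
  then show ?thesis using abelian_subgroup.a_rcos_sum[OF S assms(2,3)] by simp
qed

lemma smult_quot_submod:
  assumes "submodule_of S" "x \<in> carrier K" "r \<in> R"
  shows "r \<odot>\<^bsub>quot_module (submod K T) S\<^esub> (S +> x) = S +> (r \<otimes> x)"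
proof -
  note D = submodule_ofD[OF assms(1)]
  have rc: "r \<in> carrier K" using assms order_carrier by blast
  have "S +> (r \<otimes> z) = S +> (r \<otimes> x)" if z: "z \<in> S +> x" for z
  proof -
    obtain l where l: "l \<in> S" "z = l \<oplus> x" using z unfolding a_r_coset_def' by blast
    have lc: "l \<in> carrier K" using l D by blast
    have "r \<otimes> z \<ominus> r \<otimes> x = r \<otimes> l" unfolding l(2) using lc rc assms by algebra
    then have "r \<otimes> z \<ominus> r \<otimes> x \<in> S" using D(7)[OF assms(3) l(1)] by simp
    then show ?thesis using coset_eq_iff_diff[OF assms(1)] rc lc assms(2) l(2) by simp
  qed
  moreover have "S +> x \<noteq> {}" using D(3) unfolding a_r_coset_def' by blast
  ultimately have "(\<Union>z\<in>S +> x. S +> (r \<otimes> z)) = S +> (r \<otimes> x)" by auto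
  then show ?thesis by (simp add: quot_module_def submod_def a_r_coset_def r_coset_def)
qed

lemma quot_submod_module:
  assumes S: "submodule_of S" and T: "submodule_of T"
  shows "module \<R> (quot_module (submod K T) S)"
proof -
  let ?Q = "quot_module (submod K T) S"
  note D = submodule_ofD[OF T]
  note [simp] = carrier_quot_submod zero_quot_submod
  have rep: "\<exists>x\<in>T. C = S +> x" if "C \<in> carrier ?Q" for C using that by auto
  have S0: "S = S +> \<zero>" using submodule_ofD(2)[OF S] by simp
  have add: "(S +> x) \<oplus>\<^bsub>?Q\<^esub> (S +> y) = S +> (x \<oplus> y)" if "x \<in> T" "y \<in> T" for x y
    using add_quot_submod[OF S] D(8) that by blast
  have smult: "r \<odot>\<^bsub>?Q\<^esub> (S +> x) = S +> (r \<otimes> x)" if "x \<in> T" "r \<in> R" for x r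
    using smult_quot_submod[OF S] D(8) that by blast
  show ?thesis
  proof (rule moduleI)
    show "cring \<R>" by (rule order_cring)
    show "abelian_group ?Q"
    proof (rule abelian_groupI)
      fix A B assume AB: "A \<in> carrier ?Q" "B \<in> carrier ?Q"
      obtain x y where xy: "x \<in> T" "y \<in> T" "A = S +> x" "B = S +> y" using rep[OF AB(1)] rep[OF AB(2)] by blast
      show "A \<oplus>\<^bsub>?Q\<^esub> B \<in> carrier ?Q" using xy add D(4) by auto
      show "A \<oplus>\<^bsub>?Q\<^esub> B = B \<oplus>\<^bsub>?Q\<^esub> A" using xy add D(8) a_comm by simp
      fix C assume "C \<in> carrier ?Q"
      then obtain z where z: "z \<in> T" "C = S +> z" using rep by blast
      show "(A \<oplus>\<^bsub>?Q\<^esub> B) \<oplus>\<^bsub>?Q\<^esub> C = A \<oplus>\<^bsub>?Q\<^esub> (B \<oplus>\<^bsub>?Q\<^esub> C)"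
        using xy z add D(4,8) by (simp add: a_assoc)
    next
      show "\<zero>\<^bsub>?Q\<^esub> \<in> carrier ?Q" using S0 D(3) by (metis carrier_quot_submod image_eqI zero_quot_submod)
      fix A assume "A \<in> carrier ?Q"
      then obtain x where x: "x \<in> T" "A = S +> x" using rep by blast
      show "\<zero>\<^bsub>?Q\<^esub> \<oplus>\<^bsub>?Q\<^esub> A = A" using add[OF D(3) x(1)] x D(8) S0 by simp
      have "(S +> \<ominus> x) \<oplus>\<^bsub>?Q\<^esub> A = \<zero>\<^bsub>?Q\<^esub>" using add[OF D(5)[OF x(1)] x(1)] x D(8) S0 by (simp add: l_neg)
      then show "\<exists>B\<in>carrier ?Q. B \<oplus>\<^bsub>?Q\<^esub> A = \<zero>\<^bsub>?Q\<^esub>" using D(5)[OF x(1)] by auto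
    qed
  next
    fix r A assume r: "r \<in> carrier \<R>" and "A \<in> carrier ?Q"
    then obtain x where x: "x \<in> T" "A = S +> x" using rep by blast
    have r': "r \<in> R" "r \<in> carrier K" using r order_carrier by auto
    have xc: "x \<in> carrier K" using x D(8) by blast
    show "r \<odot>\<^bsub>?Q\<^esub> A \<in> carrier ?Q" using smult[OF x(1) r'(1)] x D(7)[OF r'(1) x(1)] by auto
    {
      fix s assume s: "s \<in> carrier \<R>"
      have s': "s \<in> R" "s \<in> carrier K" using s order_carrier by auto
      have rs: "r \<oplus> s \<in> R" "r \<otimes> s \<in> R" using r' s' order_add order_mult by auto
      show "(r \<oplus>\<^bsub>\<R>\<^esub> s) \<odot>\<^bsub>?Q\<^esub> A = r \<odot>\<^bsub>?Q\<^esub> A \<oplus>\<^bsub>?Q\<^esub> s \<odot>\<^bsub>?Q\<^esub> A"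
        using x smult[OF x(1)] rs r' s' xc add[OF D(7)[OF r'(1) x(1)] D(7)[OF s'(1) x(1)]] by (simp add: l_distr)
      show "(r \<otimes>\<^bsub>\<R>\<^esub> s) \<odot>\<^bsub>?Q\<^esub> A = r \<odot>\<^bsub>?Q\<^esub> (s \<odot>\<^bsub>?Q\<^esub> A)"
        using x smult[OF x(1)] smult[OF D(7)[OF s'(1) x(1)]] rs r' s' xc by (simp add: m_assoc)
    }
    fix B assume "B \<in> carrier ?Q"
    then obtain y where y: "y \<in> T" "B = S +> y" using rep by blast
    have yc: "y \<in> carrier K" using y D(8) by blast
    show "r \<odot>\<^bsub>?Q\<^esub> (A \<oplus>\<^bsub>?Q\<^esub> B) = r \<odot>\<^bsub>?Q\<^esub> A \<oplus>\<^bsub>?Q\<^esub> r \<odot>\<^bsub>?Q\<^esub> B"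
      using x y smult[OF x(1) r'(1)] smult[OF y(1) r'(1)] smult[OF D(4)[OF x(1) y(1)] r'(1)]
        add[OF x(1) y(1)] add[OF D(7)[OF r'(1) x(1)] D(7)[OF r'(1) y(1)]] r' xc yc by (simp add: r_distr)
  next
    fix A assume "A \<in> carrier ?Q"
    then obtain x where x: "x \<in> T" "A = S +> x" using rep by blast
    show "\<one>\<^bsub>\<R>\<^esub> \<odot>\<^bsub>?Q\<^esub> A = A" using smult[OF x(1) order_one] x D(8) by simp
  qed
qed

text \<open>T/S is finitely generated and killed by n.\<close>

lemma finite_quot:
  assumes S: "submodule_of S" and T: "submodule_of T" "fg T"
    and n: "n > 0" "\<And>x. x \<in> T \<Longrightarrow> add_pow K (n::nat) \<one> \<otimes> x \<in> S"
  shows "finite ((+>) S ` T)"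
proof -
  obtain Y where Y: "finite Y" "Y \<subseteq> T" "T = generate (add_monoid K) Y"
    using generate_finitely_generated[OF T(2) submodule_ofD(1)[OF T(1)]] by blast
  have Yc: "Y \<subseteq> carrier K" using Y(2) submodule_ofD(2)[OF T(1)] by blast
  have "finite ((\<lambda>x. S #>\<^bsub>add_monoid K\<^esub> x) ` generate (add_monoid K) Y)"
  proof (rule add.finite_cosets_of_torsion_quotient[OF Y(1) _ submodule_ofD(1)[OF S] n(1)])
    show "Y \<subseteq> carrier K" by (rule Yc)
    fix x assume x: "x \<in> Y"
    then have "x \<in> carrier K" "add_pow K n \<one> \<otimes> x \<in> S" using Yc Y(2) n(2) by auto
    then show "add_pow K n x \<in> S" using add_pow_eq_mult[of x n] by simp
  qed
  then show ?thesis unfolding Y(3)[symmetric] by (simp add: a_r_coset_def)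
qed

section \<open>Colon modules\<close>

lemma colon_iff: "t \<in> colon K J I \<longleftrightarrow> t \<in> carrier K \<and> (\<forall>x\<in>I. t \<otimes> x \<in> J)"
  by (auto simp: colon_def l_coset_def)

lemma colon_submodule:
  assumes "submodule_of I" "submodule_of J"
  shows "submodule_of (colon K J I)"
proof -
  note I = submodule_ofD[OF assms(1)] and J = submodule_ofD[OF assms(2)]
  show ?thesis
    by (rule submodule_ofI)
      (use I(8) J(3,4,7) order_carrier in \<open>auto simp: colon_iff l_distr m_assoc\<close>)
qed

text \<open>Multiplication by the unit \<open>u\<close> embeds (J:I) into J.\<close>

lemma colon_fg:
  assumes u: "u \<in> I" "u \<in> Units K" and J: "fg J"
  shows "fg (colon K J I)"
proof (rule fg_mono[OF fg_scale[OF _ J]])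
  show "inv u \<in> carrier K" using u by simp
  show "colon K J I \<subseteq> (\<otimes>) (inv u) ` J"
  proof
    fix t assume "t \<in> colon K J I"
    then have t: "t \<in> carrier K" "t \<otimes> u \<in> J" using u by (auto simp: colon_iff)
    have "t = t \<otimes> (inv u \<otimes> u)" using t u by simp
    also have "\<dots> = inv u \<otimes> (t \<otimes> u)" using t(1) u(2) by (intro m_lcomm) auto
    finally show "t \<in> (\<otimes>) (inv u) ` J" using t by blast
  qed
qed

lemma order_subset_colon_self:
  assumes "submodule_of I"
  shows "R \<subseteq> colon K I I"
  using submodule_ofD[OF assms] order_carrier by (auto simp: colon_iff)

lemma colon_self_maximal_order:
  assumes "lattice_in I"
  shows "colon K I I \<subseteq> maximal_order K"
proof
  fix t assume t: "t \<in> colon K I I"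
  obtain u where "u \<in> I" "u \<in> Units K" using assms by (auto simp: lattice_in_def)
  then show "t \<in> maximal_order K"
    using integral_of_stable[of t I u] t assms by (auto simp: lattice_in_def colon_iff)
qed

lemma mult_notin_maximalideal:
  assumes "maximalideal m \<R>" "s \<in> R - m" "t \<in> R - m"
  shows "s \<otimes> t \<in> R - m"
proof -
  interpret R: cring \<R> by (rule order_cring)
  interpret p: primeideal m \<R> using R.maximalideal_prime[OF assms(1)] .
  show ?thesis using p.I_prime[of s t] assms(2,3) order_mult by auto
qed

text \<open>
  Start from \<open>1/n\<close> and treat the generators of \<open>m\<close> one at a time.  As \<open>R/nR\<close> is finite, two powers of
  a generator \<open>\<mu>\<close> agree modulo \<open>nR\<close>, so some power of \<open>\<mu>\<close> maps \<open>y\<close> into \<open>R\<close> up to a factor outside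
  \<open>m\<close>; replace \<open>y\<close> by its multiple with the last power of \<open>\<mu>\<close> that does not.
\<close>
lemma exists_exact_denominator:
  assumes m: "maximalideal m \<R>" and n: "n > 0" "add_pow K (n::nat) \<one> \<in> m"
  obtains y where "y \<in> carrier K" "\<And>z. z \<in> m \<Longrightarrow> z \<otimes> y \<in> R" "\<And>t. t \<in> R - m \<Longrightarrow> t \<otimes> y \<notin> R"
proof -
  interpret m: maximalideal m \<R> by fact
  note mR = order_ideal_submodule[OF m.is_ideal]
  note mD = submodule_ofD[OF mR(1)]
  let ?N = "add_pow K n \<one>"
  have N: "?N \<in> Units K" "?N \<in> carrier K" "?N \<in> R" using int_unit[OF n(1)] int_in_order by auto
  have one: "\<one> \<in> R - m" using m.one_imp_carrier m.I_notcarr order_one by auto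
  define NR where "NR = (\<otimes>) ?N ` R"
  have NR: "submodule_of NR"
    unfolding NR_def by (rule submodule_of_scale[OF submodule_of_order N(2)])
  have fin: "finite ((+>) NR ` R)"
    by (rule finite_quot[OF NR submodule_of_order fg_order n(1)]) (simp add: NR_def)
  \<comment> \<open>The condition \<open>?N \<otimes> y \<in> R\<close> is carried through the
    induction because two powers of a generator agree only modulo N R; applied to y, the difference
    N r then gives r (N y) \<in> R.\<close>
  have step: "\<exists>y\<in>carrier K. ?N \<otimes> y \<in> R \<and> (\<forall>t\<in>R - m. t \<otimes> y \<notin> R) \<and> (\<forall>z\<in>A. z \<otimes> y \<in> R)"
    if "finite A" "A \<subseteq> m" for A
    using that
  proof (induction A rule: finite_induct)
    case empty
    have "t \<otimes> inv ?N \<notin> R" if t: "t \<in> R - m" for t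
    proof
      assume "t \<otimes> inv ?N \<in> R"
      then have "(t \<otimes> inv ?N) \<otimes> ?N \<in> m" using mD(7) n(2) by blast
      moreover have "(t \<otimes> inv ?N) \<otimes> ?N = t" using t N order_carrier by (simp add: m_assoc)
      ultimately show False using t by simp
    qed
    then show ?case using N order_one by (intro bexI[of _ "inv ?N"]) auto
  next
    case (insert \<mu> A)
    then obtain y where y: "y \<in> carrier K" "?N \<otimes> y \<in> R" "\<forall>t\<in>R - m. t \<otimes> y \<notin> R" "\<forall>z\<in>A. z \<otimes> y \<in> R" by auto
    have \<mu>: "\<mu> \<in> m" "\<mu> \<in> R" "\<mu> \<in> carrier K" using insert mR mD by auto
    have pR: "\<mu> [^] (k::nat) \<in> R" for k
      by (induction k) (use \<mu> order_one order_mult in auto)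
    have pm: "\<mu> [^] (Suc k) \<in> m" for k using mD(7)[OF pR \<mu>(1)] by simp
    define P where "P k \<longleftrightarrow> (\<exists>t\<in>R - m. t \<otimes> (\<mu> [^] k \<otimes> y) \<in> R)" for k :: nat
    have "\<not> inj (\<lambda>k::nat. NR +> \<mu> [^] k)"
    proof
      assume "inj (\<lambda>k::nat. NR +> \<mu> [^] k)"
      moreover have "finite (range (\<lambda>k::nat. NR +> \<mu> [^] k))"
        by (rule finite_subset[OF _ fin]) (use pR in auto)
      ultimately show False using finite_imageD infinite_UNIV_nat by blast
    qed
    then obtain i j :: nat where ij: "i < j" "NR +> \<mu> [^] i = NR +> \<mu> [^] j"
      unfolding inj_def by (metis linorder_neqE_nat)
    have pc: "\<mu> [^] (k::nat) \<in> carrier K" for k using \<mu> by simp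
    have "\<mu> [^] i \<ominus> \<mu> [^] j \<in> NR" using coset_eq_iff_diff[OF NR pc pc] ij by blast
    then obtain r where r: "r \<in> R" "\<mu> [^] i \<ominus> \<mu> [^] j = ?N \<otimes> r" unfolding NR_def by blast
    obtain d where d: "j = i + Suc d" using ij(1) less_iff_Suc_add by auto
    \<comment> \<open>As \<mu> lies in m, this factor does not; and \<mu>^i times it is the
      difference \<mu>^i - \<mu>^j that is known to lie in N R.\<close>
    let ?s = "\<one> \<ominus> \<mu> [^] (Suc d)"
    have sm: "?s \<in> R - m"
    proof -
      have "?s \<in> R" using order_diff order_one pR by blast
      moreover have "?s \<notin> m"
      proof
        assume "?s \<in> m"
        then have "?s \<oplus> \<mu> [^] (Suc d) \<in> m" using mD(4) pm by blast
        moreover have "?s \<oplus> \<mu> [^] (Suc d) = \<one>" using pc[of "Suc d"] by algebra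
        ultimately show False using one by simp
      qed
      ultimately show ?thesis by blast
    qed
    have "?s \<otimes> (\<mu> [^] i \<otimes> y) = (\<mu> [^] i \<ominus> \<mu> [^] j) \<otimes> y"
    proof -
      have "\<mu> [^] j = \<mu> [^] i \<otimes> \<mu> [^] (Suc d)" unfolding d using \<mu> by (simp only: nat_pow_mult)
      then show ?thesis using y(1) pc[of i] pc[of "Suc d"] by algebra
    qed
    also have "\<dots> = r \<otimes> (?N \<otimes> y)" unfolding r(2) using N y(1) r(1) order_carrier by (simp add: m_ac)
    finally have "?s \<otimes> (\<mu> [^] i \<otimes> y) \<in> R" using order_mult[OF r(1) y(2)] by simp
    then have Pi: "P i" unfolding P_def using sm by blast
    define k where "k = (LEAST k. P k)"
    have Pk: "P k" unfolding k_def using Pi by (rule LeastI)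
    have "\<not> P 0" unfolding P_def using y(1,3) by simp
    then obtain l where l: "k = Suc l" using Pk by (metis nat.exhaust)
    have nPl: "\<not> P l" using not_less_Least[of l P] l unfolding k_def by simp
    obtain t where t: "t \<in> R - m" "t \<otimes> (\<mu> [^] k \<otimes> y) \<in> R" using Pk unfolding P_def by blast
    have tc: "t \<in> carrier K" using t order_carrier by blast
    define y' where "y' = t \<otimes> (\<mu> [^] l \<otimes> y)"
    have y'c: "y' \<in> carrier K" unfolding y'_def using tc pc y(1) by simp
    have shift: "z \<otimes> y' \<in> R" if z: "z \<in> carrier K" "z \<otimes> y \<in> R" for z
    proof -
      have "z \<otimes> y' = (t \<otimes> \<mu> [^] l) \<otimes> (z \<otimes> y)" unfolding y'_def using z(1) tc pc y(1) by (simp add: m_ac)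
      then show ?thesis using order_mult[OF order_mult[OF _ pR] z(2)] t by simp
    qed
    have "\<mu> \<otimes> y' = t \<otimes> (\<mu> [^] k \<otimes> y)" unfolding y'_def l using \<mu> tc pc y(1) by (simp add: m_ac)
    then have "\<mu> \<otimes> y' \<in> R" using t(2) by simp
    moreover have "s \<otimes> y' \<notin> R" if s: "s \<in> R - m" for s
    proof
      assume "s \<otimes> y' \<in> R"
      moreover have "s \<otimes> y' = (s \<otimes> t) \<otimes> (\<mu> [^] l \<otimes> y)"
        unfolding y'_def using s order_carrier tc pc y(1) by (simp add: m_assoc)
      ultimately show False using nPl mult_notin_maximalideal[OF m s t(1)] unfolding P_def by auto
    qed
    moreover have "z \<otimes> y' \<in> R" if "z \<in> A" for z
      using shift y(4) that insert.prems mD(8) by auto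
    moreover have "?N \<otimes> y' \<in> R" using shift N y(2) by blast
    ultimately show ?case using y'c by (intro bexI[of _ y']) auto
  qed
  obtain Y where Y: "finite Y" "Y \<subseteq> m" "m = generate (add_monoid K) Y"
    using generate_finitely_generated[OF fg_mono[OF fg_order mR(2)] mD(1)] by blast
  obtain y where y: "y \<in> carrier K" "\<forall>t\<in>R - m. t \<otimes> y \<notin> R" "\<forall>z\<in>Y. z \<otimes> y \<in> R" using step[OF Y(1,2)] by blast
  have "z \<otimes> y \<in> R" if z: "z \<in> m" for z
  proof -
    have "y \<otimes> z \<in> generate (add_monoid K) ((\<otimes>) y ` Y)"
      by (rule generate_scale[OF y(1)]) (use z Y mD(2) in auto)
    moreover have "generate (add_monoid K) ((\<otimes>) y ` Y) \<subseteq> R"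
    proof (rule add.generate_subgroup_incl[OF _ submodule_ofD(1)[OF submodule_of_order]])
      show "(\<otimes>) y ` Y \<subseteq> R" using y(1,3) Y(2) mD(8) by (auto simp: m_comm)
    qed
    ultimately show ?thesis using z mD(8) y(1) m_comm by auto
  qed
  then show thesis using that y by blast
qed

text \<open>Such an x generates \<open>L\<close> locally at m: for every l \<in> L the product (w x)
  l = (w l) x lies in R x, while w x is outside m.\<close>

lemma locally_principal:
  assumes m: "maximalideal m \<R>" and n: "n > 0" "add_pow K (n::nat) \<one> \<in> m"
    and reg: "localization K R m R = localization K R m (maximal_order K)"
    and L: "lattice_in L"
  obtains x w where "x \<in> L" "w \<in> colon K R L" "w \<otimes> x \<in> R - m"
proof -
  have "\<exists>x\<in>L. \<exists>w\<in>colon K R L. w \<otimes> x \<in> R - m"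
  proof (rule ccontr)
    assume "\<not> (\<exists>x\<in>L. \<exists>w\<in>colon K R L. w \<otimes> x \<in> R - m)"
    then have all: "w \<otimes> x \<in> m" if "x \<in> L" "w \<in> colon K R L" for x w
      using that by (auto simp: colon_iff)
    obtain y where y: "y \<in> carrier K" "\<And>z. z \<in> m \<Longrightarrow> z \<otimes> y \<in> R" "\<And>t. t \<in> R - m \<Longrightarrow> t \<otimes> y \<notin> R"
      using exists_exact_denominator[OF m n] by blast
    have Ls: "submodule_of L" "fg L" using L by (auto simp: lattice_in_def)
    obtain u where u: "u \<in> L" "u \<in> Units K" using L by (auto simp: lattice_in_def)
    have Lc: "x \<in> carrier K" if "x \<in> L" for x using submodule_ofD(8)[OF Ls(1) that] .
    \<comment> \<open>For x \<in> L, y w x is (w x) y, and w x lies in m, which y carries into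
      R.\<close>
    have "y \<otimes> w \<in> colon K R L" if w: "w \<in> colon K R L" for w
    proof -
      have wc: "w \<in> carrier K" using w by (simp add: colon_iff)
      have "y \<otimes> w \<otimes> x \<in> R" if x: "x \<in> L" for x
      proof -
        have "y \<otimes> w \<otimes> x = (w \<otimes> x) \<otimes> y" using y(1) wc Lc[OF x] by (simp add: m_ac)
        then show ?thesis using y(2)[OF all[OF x w]] by simp
      qed
      then show ?thesis using y(1) wc by (simp add: colon_iff)
    qed
    \<comment> \<open>To conclude integrality from stability of (R:L) under y, a unit of
      \<open>K\<close> inside (R:L) is required; a positive integer that carries \<open>L\<close>
      into R is one.\<close>
    moreover obtain k :: nat where k: "k > 0" "\<And>x. x \<in> L \<Longrightarrow> add_pow K k \<one> \<otimes> x \<in> R"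
      using fg_denominator[OF submodule_of_order order_one _ Ls(2)] by auto
    moreover have "add_pow K k \<one> \<in> colon K R L" using k by (auto simp: colon_iff)
    ultimately have "y \<in> maximal_order K"
      using integral_of_stable[OF y(1) colon_fg[OF u fg_order]] int_unit by blast
    then obtain s where "s \<in> R - m" "s \<otimes> y \<in> R" using regular_denominator[OF m reg] by blast
    then show False using y(3) by blast
  qed
  then show thesis using that by blast
qed

text \<open>Multiplications by a and b compose in both orders to multiplication by a b, which
  becomes a unit of the completion.\<close>

lemma completed_isomorphic:
  assumes m: "maximalideal m \<R>" and I: "submodule_of I" and J: "submodule_of J"
    and a: "a \<in> colon K J I" and b: "b \<in> colon K I J" and ab: "a \<otimes> b \<in> R - m"
  shows "module_isomorphic (completion \<R> m)
    (base_change \<R> (completion \<R> m) (to_completion \<R> m) (submod K I))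
    (base_change \<R> (completion \<R> m) (to_completion \<R> m) (submod K J))"
proof -
  have swap: "c \<otimes> (r \<otimes> x) = r \<otimes> (c \<otimes> x)" if "c \<in> carrier K" "r \<in> R" "x \<in> carrier K" for c r x
    using m_lcomm[OF that(1) order_carrier[OF that(2)] that(3)] .
  have prod: "b \<otimes> (a \<otimes> x) = a \<otimes> b \<otimes> x" "a \<otimes> (b \<otimes> x) = a \<otimes> b \<otimes> x" if "x \<in> carrier K" for x
    using that a b by (auto simp: colon_iff m_ac)
  interpret m: maximalideal m \<R> by fact
  interpret completing \<R> m by (rule completing.intro[OF order_cring m.is_ideal])
  note ID = submodule_ofD[OF I] and JD = submodule_ofD[OF J]
  have ac: "a \<in> carrier K" "b \<in> carrier K" using a b by (auto simp: colon_iff)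
  obtain v where v: "v \<in> carrier (completion \<R> m)"
      "v \<otimes>\<^bsub>completion \<R> m\<^esub> to_completion \<R> m (a \<otimes> b) = \<one>\<^bsub>completion \<R> m\<^esub>"
    using to_completion_unit[OF m, of "a \<otimes> b"] ab by auto
  show ?thesis
  proof (rule base_change_isomorphic[where f = "(\<otimes>) a" and g = "(\<otimes>) b" and s = "a \<otimes> b" and v = v])
    show "closed_module (submod K I)" "closed_module (submod K J)"
      using ID JD by (auto simp: closed_module_def submod_def)
    show "linear_map (submod K I) (submod K J) ((\<otimes>) a)"
      using a ID(8) swap[OF ac(1)] by (auto simp: linear_map_def submod_def colon_iff r_distr)
    show "linear_map (submod K J) (submod K I) ((\<otimes>) b)"
      using b JD(8) swap[OF ac(2)] by (auto simp: linear_map_def submod_def colon_iff r_distr)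
    show "a \<otimes> b \<in> carrier \<R>" using ab by simp
    show "v \<in> carrier (completion \<R> m)" "v \<otimes>\<^bsub>completion \<R> m\<^esub> to_completion \<R> m (a \<otimes> b) = \<one>\<^bsub>completion \<R> m\<^esub>"
      using v by auto
    show "b \<otimes> (a \<otimes> x) = (a \<otimes> b) \<odot>\<^bsub>submod K I\<^esub> x" if "x \<in> carrier (submod K I)" for x
      using that prod(1)[of x] ID(8) by (simp add: submod_def)
    show "a \<otimes> (b \<otimes> x) = (a \<otimes> b) \<odot>\<^bsub>submod K J\<^esub> x" if "x \<in> carrier (submod K J)" for x
      using that prod(2)[of x] JD(8) by (simp add: submod_def)
  qed
qed

lemma scale_lattice:
  assumes "lattice_in L" "c \<in> Units K"
  shows "lattice_in (c <# L)"
proof -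
  have c: "c \<in> carrier K" using assms(2) by (rule Units_closed)
  have e: "c <# L = (\<otimes>) c ` L" by (auto simp: l_coset_def)
  obtain u where u: "u \<in> L" "u \<in> Units K" using assms(1) by (auto simp: lattice_in_def)
  have "c \<otimes> u \<in> (c <# L) \<inter> Units K" using u assms(2) unfolding e by blast
  then show ?thesis
    using submodule_of_scale[OF _ c, of L] fg_scale[OF c, of L] assms(1) unfolding lattice_in_def e by auto
qed

lemma colon_scale_left:
  assumes c: "c \<in> Units K" and t: "t \<in> carrier K" and I: "I \<subseteq> carrier K"
  shows "t \<in> colon K J (c <# I) \<longleftrightarrow> t \<otimes> c \<in> colon K J I"
  using assms by (auto simp: colon_iff l_coset_def m_assoc subset_iff Units_closed)

lemma colon_self_scale:
  assumes c: "c \<in> Units K" and I: "I \<subseteq> carrier K"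
  shows "colon K (c <# I) (c <# I) = colon K I I"
proof -
  have inj: "c \<otimes> x = c \<otimes> y \<longleftrightarrow> x = y" if "x \<in> carrier K" "y \<in> carrier K" for x y
    using c that by (simp add: Units_l_cancel)
  have "t \<otimes> (c \<otimes> x) \<in> c <# I \<longleftrightarrow> t \<otimes> x \<in> I" if "t \<in> carrier K" "x \<in> I" for t x
  proof -
    have xc: "x \<in> carrier K" using that(2) I by blast
    have e: "t \<otimes> (c \<otimes> x) = c \<otimes> (t \<otimes> x)" by (rule m_lcomm) (use that xc Units_closed[OF c] in auto)
    show ?thesis unfolding e l_coset_def using inj that(1,2) xc I by auto
  qed
  then show ?thesis by (auto simp: colon_iff l_coset_def)
qed

end

section \<open>Simple inclusions of lattices\<close>

text \<open>In the application \<open>I\<close> is the image of the source lattice under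
  multiplication by the isogeny. Simplicity of J/I is expressed through intermediate modules, the
  form in which minimality of the isogeny delivers it.\<close>

locale simple_inclusion = order_in_algebra +
  fixes I J :: "'a set"
  assumes lattice_I: "lattice_in I" and lattice_J: "lattice_in J"
    and incl: "I \<subseteq> J" and neq: "I \<noteq> J"
    and simple: "\<And>L. submodule_of L \<Longrightarrow> I \<subseteq> L \<Longrightarrow> L \<subseteq> J \<Longrightarrow> L = I \<or> L = J"
begin

lemma sub_I: "submodule_of I" and sub_J: "submodule_of J"
  using lattice_I lattice_J by (auto simp: lattice_in_def)

lemmas ID = submodule_ofD[OF sub_I] and JD = submodule_ofD[OF sub_J]

text \<open>I + L lies between I and J and differs from I. This is the point at which
  \<open>simple\<close> is applied.\<close>

lemma sum_with_I:
  assumes "submodule_of L" "L \<subseteq> J" "\<not> L \<subseteq> I" "x \<in> J"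
  shows "\<exists>i\<in>I. \<exists>l\<in>L. x = i \<oplus> l"
proof -
  note LD = submodule_ofD[OF assms(1)]
  let ?M = "{i \<oplus> l | i l. i \<in> I \<and> l \<in> L}"
  have mem: "i \<oplus> l \<in> ?M" if "i \<in> I" "l \<in> L" for i l using that by blast
  have "submodule_of ?M" by (rule submodule_of_sum[OF sub_I assms(1)])
  moreover have "I \<subseteq> ?M"
  proof
    fix i assume "i \<in> I"
    then show "i \<in> ?M" using mem[OF _ LD(3), of i] ID(8) by simp
  qed
  moreover have "?M \<subseteq> J" using incl assms(2) JD(4) by blast
  moreover have "?M \<noteq> I"
  proof -
    obtain l where l: "l \<in> L" "l \<notin> I" using assms(3) by blast
    then have "l \<in> ?M" using mem[OF ID(3), of l] LD(8) by simp
    then show ?thesis using l by blast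
  qed
  ultimately have "?M = J" using simple by blast
  then show ?thesis using assms(4) by blast
qed

lemma adjoin_generator:
  assumes y: "y \<in> J" "y \<notin> I" and x: "x \<in> J"
  shows "\<exists>i\<in>I. \<exists>r\<in>R. x = i \<oplus> r \<otimes> y"
proof -
  have yc: "y \<in> carrier K" using y JD(8) by blast
  let ?L = "(\<otimes>) y ` R"
  have L: "submodule_of ?L" by (rule submodule_of_scale[OF submodule_of_order yc])
  have comm: "y \<otimes> r = r \<otimes> y" if "r \<in> R" for r using m_comm[OF yc order_carrier[OF that]] .
  have "y = y \<otimes> \<one>" using yc by simp
  then have "y \<in> ?L" using order_one by blast
  then have nI: "\<not> ?L \<subseteq> I" using y(2) by blast
  have "?L \<subseteq> J" using JD(7)[OF _ y(1)] comm by auto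
  then show ?thesis using sum_with_I[OF L _ nI x] comm by (metis imageE)
qed

definition ann :: "'a set" where "ann = {r \<in> R. \<forall>x\<in>J. r \<otimes> x \<in> I}"

lemma annI: "r \<in> R \<Longrightarrow> (\<And>x. x \<in> J \<Longrightarrow> r \<otimes> x \<in> I) \<Longrightarrow> r \<in> ann"
  and annD: "r \<in> ann \<Longrightarrow> r \<in> R" "r \<in> ann \<Longrightarrow> x \<in> J \<Longrightarrow> r \<otimes> x \<in> I"
  by (auto simp: ann_def)

lemma ann_submodule: "submodule_of ann"
  by (rule submodule_ofI)
    (use ID(3,4,7) JD(8) order_carrier order_zero order_add order_mult in
      \<open>auto simp: ann_def l_distr m_assoc\<close>)

text \<open>J/I is generated by the class of any y outside I, so whatever kills this class kills all
  of J/I.\<close>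

lemma ann_iff:
  assumes y: "y \<in> J" "y \<notin> I"
  shows "r \<in> ann \<longleftrightarrow> r \<in> R \<and> r \<otimes> y \<in> I"
proof
  assume "r \<in> ann" then show "r \<in> R \<and> r \<otimes> y \<in> I" using y annD by blast
next
  assume r: "r \<in> R \<and> r \<otimes> y \<in> I"
  show "r \<in> ann"
  proof (rule annI)
    show "r \<in> R" using r by blast
    fix x assume "x \<in> J"
    then obtain i s where x: "i \<in> I" "s \<in> R" "x = i \<oplus> s \<otimes> y" using adjoin_generator[OF y] by blast
    have c: "r \<in> carrier K" "s \<in> carrier K" "y \<in> carrier K" "i \<in> carrier K"
      using r x y order_carrier JD(8) ID(8) by auto
    have "r \<otimes> x = r \<otimes> i \<oplus> s \<otimes> (r \<otimes> y)" unfolding x(3) using c by algebra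
    then show "r \<otimes> x \<in> I" using ID(4)[OF ID(7)[of r i] ID(7)[of s "r \<otimes> y"]] r x by simp
  qed
qed

lemma exists_generator: "\<exists>y. y \<in> J \<and> y \<notin> I"
  using incl neq by blast

text \<open>For p outside the annihilator, p y is outside \<open>I\<close> and hence generates J
  modulo \<open>I\<close>, so that y = i + r p y. Then 1 - r p kills the class of y, and an ideal
  that contains \<open>ann\<close> and p contains 1.\<close>

lemma ann_maximal: "maximalideal ann \<R>"
proof (rule maximalidealI)
  obtain y where y: "y \<in> J" "y \<notin> I" using exists_generator by blast
  have yc: "y \<in> carrier K" using y JD(8) by blast
  have annR: "ann \<subseteq> R" using annD by blast
  show "ideal ann \<R>" by (rule submodule_order_ideal[OF ann_submodule annR])
  have "\<one> \<notin> ann" using ann_iff[OF y] y yc by simp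
  then show "carrier \<R> \<noteq> ann" using order_one by auto
  fix P assume P: "ideal P \<R>" "ann \<subseteq> P" "P \<subseteq> carrier \<R>"
  note PD = submodule_ofD[OF order_ideal_submodule(1)[OF P(1)]] and PR = order_ideal_submodule(2)[OF P(1)]
  show "P = ann \<or> P = carrier \<R>"
  proof (cases "P \<subseteq> ann")
    case True then show ?thesis using P by blast
  next
    case False
    then obtain p where p: "p \<in> P" "p \<notin> ann" by blast
    have pR: "p \<in> R" using p PR by blast
    have "p \<otimes> y \<in> J" "p \<otimes> y \<notin> I" using ann_iff[OF y] p pR JD(7)[OF pR y(1)] by auto
    then obtain i r where ir: "i \<in> I" "r \<in> R" "y = i \<oplus> r \<otimes> (p \<otimes> y)" using adjoin_generator y(1) by blast
    have c: "p \<in> carrier K" "r \<in> carrier K" "i \<in> carrier K" using pR ir order_carrier ID(8) by auto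
    have "(\<one> \<ominus> r \<otimes> p) \<otimes> y = y \<ominus> r \<otimes> (p \<otimes> y)" using c yc by algebra
    also have "\<dots> = (i \<oplus> r \<otimes> (p \<otimes> y)) \<ominus> r \<otimes> (p \<otimes> y)" using ir(3) by simp
    also have "\<dots> = i" using c yc by algebra
    finally have "(\<one> \<ominus> r \<otimes> p) \<otimes> y \<in> I" using ir(1) by simp
    then have "\<one> \<ominus> r \<otimes> p \<in> ann"
      using ann_iff[OF y] order_diff[OF order_one order_mult[OF ir(2) pR]] by blast
    then have "(\<one> \<ominus> r \<otimes> p) \<oplus> r \<otimes> p \<in> P" using P(2) PD(4) PD(7)[OF ir(2) p(1)] by blast
    moreover have "(\<one> \<ominus> r \<otimes> p) \<oplus> r \<otimes> p = \<one>" using c by algebra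
    ultimately have one: "\<one> \<in> P" by simp
    have "x \<in> P" if "x \<in> R" for x using PD(7)[OF that one] order_carrier[OF that] by simp
    then have "P = R" using PR by blast
    then show ?thesis by simp
  qed
qed

lemma quotient_isomorphic_residue:
  "module_isomorphic \<R> (quot_module (submod K J) I) (quot_module (submod K R) ann)"
proof -
  let ?Q = "quot_module (submod K J) I" and ?P = "quot_module (submod K R) ann"
  obtain y where y: "y \<in> J" "y \<notin> I" using exists_generator by blast
  have yc: "y \<in> carrier K" using y JD(8) by blast
  \<comment> \<open>The preimage of a coset under r \<mapsto> r y is a coset of the annihilator.
    Going in this direction defines the isomorphism without a choice of representatives.\<close>
  define f where "f C = {r \<in> R. r \<otimes> y \<in> C}" for C
  have f: "f (I +> r \<otimes> y) = ann +> r" if r: "r \<in> R" for r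
  proof -
    have rc: "r \<in> carrier K" using r order_carrier by blast
    have "s \<otimes> y \<in> I +> r \<otimes> y \<longleftrightarrow> s \<in> ann +> r" if s: "s \<in> R" for s
    proof -
      have sc: "s \<in> carrier K" using s order_carrier by blast
      have "s \<otimes> y \<in> I +> r \<otimes> y \<longleftrightarrow> s \<otimes> y \<ominus> r \<otimes> y \<in> I"
        by (rule mem_coset_iff_diff[OF sub_I]) (use sc rc yc in auto)
      also have "s \<otimes> y \<ominus> r \<otimes> y = (s \<ominus> r) \<otimes> y" using sc rc yc by algebra
      also have "(s \<ominus> r) \<otimes> y \<in> I \<longleftrightarrow> s \<ominus> r \<in> ann" using ann_iff[OF y] order_diff[OF s r] by blast
      also have "s \<ominus> r \<in> ann \<longleftrightarrow> s \<in> ann +> r" using mem_coset_iff_diff[OF ann_submodule sc rc] by blast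
      finally show ?thesis .
    qed
    moreover have "ann +> r \<subseteq> R" using annD(1) order_add r unfolding a_r_coset_def' by blast
    ultimately show ?thesis unfolding f_def by blast
  qed
  have rep: "\<exists>r\<in>R. C = I +> r \<otimes> y" if C: "C \<in> carrier ?Q" for C
  proof -
    obtain x where x: "x \<in> J" "C = I +> x" using C carrier_quot_submod by auto
    obtain i r where ir: "i \<in> I" "r \<in> R" "x = i \<oplus> r \<otimes> y" using adjoin_generator[OF y x(1)] by blast
    have c: "i \<in> carrier K" "r \<otimes> y \<in> carrier K" using ir yc order_carrier ID(8) by auto
    have "x \<ominus> r \<otimes> y = i" unfolding ir(3) using c by algebra
    then have "I +> x = I +> r \<otimes> y" using coset_eq_iff_diff[OF sub_I JD(8)[OF x(1)] c(2)] ir(1) by simp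
    then show ?thesis using x ir by blast
  qed
  have ry: "I +> r \<otimes> y \<in> carrier ?Q" if "r \<in> R" for r
    using JD(7)[OF that y(1)] carrier_quot_submod by auto
  have ryc: "r \<otimes> y \<in> carrier K" if "r \<in> R" for r using that yc order_carrier by simp
  have "bij_betw f (carrier ?Q) (carrier ?P)"
    unfolding bij_betw_def
  proof
    show "inj_on f (carrier ?Q)"
    proof (rule inj_onI)
      fix C D assume CD: "C \<in> carrier ?Q" "D \<in> carrier ?Q" "f C = f D"
      obtain r s where rs: "r \<in> R" "s \<in> R" "C = I +> r \<otimes> y" "D = I +> s \<otimes> y" using rep CD(1,2) by metis
      then have "ann +> r = ann +> s" using f CD(3) by simp
      then have "r \<ominus> s \<in> ann" using coset_eq_iff_diff[OF ann_submodule] rs order_carrier by simp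
      then have "(r \<ominus> s) \<otimes> y \<in> I" using annD(2) y(1) by blast
      moreover have "(r \<ominus> s) \<otimes> y = r \<otimes> y \<ominus> s \<otimes> y"
        using order_carrier[OF rs(1)] order_carrier[OF rs(2)] yc by algebra
      ultimately show "C = D" using coset_eq_iff_diff[OF sub_I ryc[OF rs(1)] ryc[OF rs(2)]] rs by simp
    qed
    show "f ` carrier ?Q = carrier ?P"
    proof
      show "f ` carrier ?Q \<subseteq> carrier ?P" using rep f carrier_quot_submod[of R ann] by force
      show "carrier ?P \<subseteq> f ` carrier ?Q" unfolding carrier_quot_submod[of R ann] using f ry by (metis image_eqI image_subsetI)
    qed
  qed
  moreover have "f (C \<oplus>\<^bsub>?Q\<^esub> D) = f C \<oplus>\<^bsub>?P\<^esub> f D" if CD: "C \<in> carrier ?Q" "D \<in> carrier ?Q" for C D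
  proof -
    obtain r s where rs: "r \<in> R" "s \<in> R" "C = I +> r \<otimes> y" "D = I +> s \<otimes> y" using rep CD by metis
    have "C \<oplus>\<^bsub>?Q\<^esub> D = I +> (r \<oplus> s) \<otimes> y"
      using add_quot_submod[OF sub_I ryc[OF rs(1)] ryc[OF rs(2)]] rs yc order_carrier by (simp add: l_distr)
    then show ?thesis
      using f[OF order_add[OF rs(1,2)]] f[OF rs(1)] f[OF rs(2)] add_quot_submod[OF ann_submodule] rs order_carrier by simp
  qed
  moreover have "f (r \<odot>\<^bsub>?Q\<^esub> C) = r \<odot>\<^bsub>?P\<^esub> f C" if r: "r \<in> carrier \<R>" and C: "C \<in> carrier ?Q" for r C
  proof -
    obtain s where s: "s \<in> R" "C = I +> s \<otimes> y" using rep C by metis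
    have r': "r \<in> R" using r by simp
    have "r \<odot>\<^bsub>?Q\<^esub> C = I +> (r \<otimes> s) \<otimes> y"
      using smult_quot_submod[OF sub_I ryc[OF s(1)] r'] s r' yc order_carrier by (simp add: m_assoc)
    then show ?thesis
      using f[OF order_mult[OF r' s(1)]] f[OF s(1)] smult_quot_submod[OF ann_submodule _ r'] s order_carrier by simp
  qed
  ultimately show ?thesis unfolding module_isomorphic_def by blast
qed

text \<open>Isomorphic modules have the same annihilator: an element of \<open>ann\<close> kills the
  class of 1 in R/m and so lies in m, and both ideals are maximal.\<close>

lemma residue_field_unique:
  assumes m: "maximalideal m \<R>"
    and iso: "module_isomorphic \<R> (quot_module (submod K J) I) (quot_module (submod K R) m)"
  shows "m = ann"
proof -
  interpret m: maximalideal m \<R> by fact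
  let ?Q = "quot_module (submod K J) I" and ?P = "quot_module (submod K R) m"
  note mR = order_ideal_submodule[OF m.is_ideal]
  obtain f where f: "bij_betw f (carrier ?Q) (carrier ?P)"
    "\<And>x y. x \<in> carrier ?Q \<Longrightarrow> y \<in> carrier ?Q \<Longrightarrow> f (x \<oplus>\<^bsub>?Q\<^esub> y) = f x \<oplus>\<^bsub>?P\<^esub> f y"
    "\<And>r x. r \<in> carrier \<R> \<Longrightarrow> x \<in> carrier ?Q \<Longrightarrow> f (r \<odot>\<^bsub>?Q\<^esub> x) = r \<odot>\<^bsub>?P\<^esub> f x"
    using iso unfolding module_isomorphic_def by blast
  have I0: "I = I +> \<zero>" using ID(2) by simp
  have m0: "m = m +> \<zero>" using submodule_ofD(2)[OF mR(1)] by simp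
  have IQ: "I \<in> carrier ?Q" unfolding carrier_quot_submod using I0 JD(3) by (rule image_eqI)
  have zero_smult: "\<zero> \<odot>\<^bsub>?Q\<^esub> I = I"
    using smult_quot_submod[OF sub_I zero_closed order_zero] I0 by simp
  \<comment> \<open>\<open>module_isomorphic\<close> demands additivity and linearity; that f
    preserves zero is derived by writing the zero class as a multiple by the scalar 0.\<close>
  have fI: "f I = m"
  proof -
    have "f I \<in> carrier ?P" using f(1) IQ by (auto simp: bij_betw_def)
    then obtain r where r: "r \<in> R" "f I = m +> r" unfolding carrier_quot_submod by blast
    have "f I = \<zero> \<odot>\<^bsub>?P\<^esub> f I" using f(3)[of \<zero> I] IQ order_zero zero_smult by simp
    also have "\<dots> = m" unfolding r(2)
      using smult_quot_submod[OF mR(1) order_carrier[OF r(1)] order_zero] order_carrier[OF r(1)] m0 by simp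
    finally show ?thesis .
  qed
  have "ann \<subseteq> m"
  proof
    fix r assume r: "r \<in> ann"
    have rR: "r \<in> R" using r annD by blast
    have "m +> \<one> \<in> carrier ?P" unfolding carrier_quot_submod using order_one by blast
    then obtain C where C: "C \<in> carrier ?Q" "f C = m +> \<one>" using f(1) unfolding bij_betw_def by (metis imageE)
    obtain x where x: "x \<in> J" "C = I +> x" using C(1) unfolding carrier_quot_submod by blast
    have "r \<odot>\<^bsub>?Q\<^esub> C = I +> r \<otimes> x" using smult_quot_submod[OF sub_I JD(8)[OF x(1)] rR] x(2) by simp
    also have "\<dots> = I"
    proof -
      have rx: "r \<otimes> x \<in> I" by (rule annD(2)[OF r x(1)])
      then have "r \<otimes> x \<ominus> \<zero> \<in> I" using ID(6)[OF _ ID(3)] by blast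
      then show ?thesis using coset_eq_iff_diff[OF sub_I ID(8)[OF rx] zero_closed] I0 by simp
    qed
    finally have "f I = r \<odot>\<^bsub>?P\<^esub> (m +> \<one>)" using f(3)[of r C] C rR by simp
    then have "m +> \<zero> = m +> r"
      using fI m0 smult_quot_submod[OF mR(1) one_closed rR] order_carrier[OF rR] by simp
    then have "r \<ominus> \<zero> \<in> m"
      using coset_eq_iff_diff[OF mR(1) order_carrier[OF rR] zero_closed] by simp
    moreover have "r \<ominus> \<zero> = r" using order_carrier[OF rR] by algebra
    ultimately show "r \<in> m" by simp
  qed
  moreover have "m \<noteq> carrier \<R>" using m.I_notcarr by blast
  ultimately show ?thesis
    using maximalideal.I_maximal[OF ann_maximal m.is_ideal] mR(2) by auto
qed

section \<open>Comparison of the endomorphism rings\<close>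

abbreviation "End_I \<equiv> colon K I I"
abbreviation "End_J \<equiv> colon K J J"

lemma End_comparable: "End_I \<subseteq> End_J \<or> End_J \<subseteq> End_I"
proof (cases "\<forall>t\<in>End_J. \<forall>x\<in>I. t \<otimes> x \<in> I")
  case True
  then show ?thesis by (auto simp: colon_iff)
next
  case False
  then obtain t x0 where t: "t \<in> End_J" "x0 \<in> I" "t \<otimes> x0 \<notin> I" by blast
  have tc: "t \<in> carrier K" and tJ: "\<And>x. x \<in> J \<Longrightarrow> t \<otimes> x \<in> J" using t(1) by (auto simp: colon_iff)
  let ?L = "(\<otimes>) t ` I"
  have L: "submodule_of ?L" by (rule submodule_of_scale[OF sub_I tc])
  have LJ: "?L \<subseteq> J" using tJ incl by blast
  have nLI: "\<not> ?L \<subseteq> I" using t by blast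
  have "End_I \<subseteq> End_J"
  proof
    fix s assume "s \<in> End_I"
    then have sc: "s \<in> carrier K" and sI: "\<And>x. x \<in> I \<Longrightarrow> s \<otimes> x \<in> I" by (auto simp: colon_iff)
    have "s \<otimes> x \<in> J" if x: "x \<in> J" for x
    proof -
      obtain i j where ij: "i \<in> I" "j \<in> I" "x = i \<oplus> t \<otimes> j" using sum_with_I[OF L LJ nLI x] by blast
      have "s \<otimes> x = s \<otimes> i \<oplus> t \<otimes> (s \<otimes> j)"
        unfolding ij(3) using sc tc ID(8)[OF ij(1)] ID(8)[OF ij(2)] by algebra
      then show ?thesis using JD(4)[of "s \<otimes> i" "t \<otimes> (s \<otimes> j)"] tJ[of "s \<otimes> j"] sI[OF ij(1)] sI[OF ij(2)] incl by auto
    qed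
    then show "s \<in> End_J" using sc by (auto simp: colon_iff)
  qed
  then show ?thesis by blast
qed

text \<open>For t \<in> End_J, the element t carries I \<subseteq> J into J and then r carries J
  into I. For t \<in> End_I, r carries J into I and then t keeps the result in I \<subseteq> J. Both
  are recorded because either ring may be the larger one.\<close>

lemma ann_mult_End:
  assumes "r \<in> ann"
  shows "t \<in> End_J \<Longrightarrow> r \<otimes> t \<in> End_I" and "t \<in> End_I \<Longrightarrow> r \<otimes> t \<in> End_J"
proof -
  have rc: "r \<in> carrier K" and rJ: "\<And>x. x \<in> J \<Longrightarrow> r \<otimes> x \<in> I" using assms annD order_carrier by auto
  show "r \<otimes> t \<in> End_I" if t: "t \<in> End_J"
  proof -
    have tc: "t \<in> carrier K" and tJ: "\<And>x. x \<in> J \<Longrightarrow> t \<otimes> x \<in> J" using t by (auto simp: colon_iff)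
    have "r \<otimes> t \<otimes> x \<in> I" if "x \<in> I" for x
      using rJ[OF tJ[of x]] that incl rc tc ID(8)[OF that] by (auto simp: m_assoc)
    then show ?thesis using rc tc by (auto simp: colon_iff)
  qed
  show "r \<otimes> t \<in> End_J" if t: "t \<in> End_I"
  proof -
    have tc: "t \<in> carrier K" and tI: "\<And>x. x \<in> I \<Longrightarrow> t \<otimes> x \<in> I" using t by (auto simp: colon_iff)
    have "r \<otimes> t \<otimes> x \<in> J" if x: "x \<in> J" for x
    proof -
      have "r \<otimes> t \<otimes> x = t \<otimes> (r \<otimes> x)" using rc tc JD(8)[OF x] by (simp add: m_ac)
      then show ?thesis using tI[OF rJ[OF x]] incl by auto
    qed
    then show ?thesis using rc tc by (auto simp: colon_iff)
  qed
qed

text \<open>\<open>I\<close> contains a unit of \<open>K\<close>, so one integer carries the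
  finitely generated \<open>J\<close> into \<open>I\<close>. This integer is what makes the
  quotients R/ann and T/S finite.\<close>

lemma int_in_ann: obtains n :: nat where "n > 0" "add_pow K n \<one> \<in> ann"
proof -
  obtain b where b: "b \<in> I" "b \<in> Units K" using lattice_I by (auto simp: lattice_in_def)
  have "fg J" using lattice_J by (simp add: lattice_in_def)
  then obtain n :: nat where n: "n > 0" "\<And>x. x \<in> J \<Longrightarrow> add_pow K n \<one> \<otimes> x \<in> I"
    using fg_denominator[OF sub_I b] by blast
  then show thesis using that[OF n(1)] annI[OF int_in_order] by blast
qed

lemma End_sub: "submodule_of End_I" "submodule_of End_J" "fg End_I" "fg End_J"
proof -
  obtain b where b: "b \<in> I" "b \<in> Units K" using lattice_I by (auto simp: lattice_in_def)
  obtain c where c: "c \<in> J" "c \<in> Units K" using lattice_J by (auto simp: lattice_in_def)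
  have "fg I" "fg J" using lattice_I lattice_J by (simp_all add: lattice_in_def)
  then show "fg End_I" "fg End_J" using colon_fg b c by auto
  show "submodule_of End_I" "submodule_of End_J" using colon_submodule sub_I sub_J by auto
qed

text \<open>R/ann and T/S are killed by the integer of \<open>int_in_ann\<close>, hence finite. As
  |T/S| is a power of |R/ann| \<ge> 2, the last two claims say that its exponent is 0 exactly for S
  = T, and this is what becomes the divisibility criterion.\<close>

lemma End_quotient:
  assumes ST: "S = End_I \<and> T = End_J \<or> S = End_J \<and> T = End_I" and sub: "S \<subseteq> T"
  defines "TS \<equiv> quot_module (submod K T) S"
  shows "finite (carrier (\<R> Quot ann))" "finite (carrier TS)"
    "2 \<le> card (carrier (\<R> Quot ann))"
    "\<exists>n. module_length \<R> TS = enat n \<and> card (carrier TS) = card (carrier (\<R> Quot ann)) ^ n"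
    "S = T \<Longrightarrow> card (carrier TS) = 1" "S \<noteq> T \<Longrightarrow> card (carrier TS) \<noteq> 1"
proof -
  have S: "submodule_of S" and T: "submodule_of T" "fg T" using ST End_sub by auto
  have rT: "r \<otimes> t \<in> S" if "r \<in> ann" "t \<in> T" for r t using ST ann_mult_End[OF that(1)] that(2) by auto
  obtain n :: nat where n: "n > 0" "add_pow K n \<one> \<in> ann" using int_in_ann by blast
  have nR: "add_pow K n \<one> \<otimes> x \<in> ann" if "x \<in> R" for x
    using submodule_ofD(7)[OF ann_submodule that n(2)] order_carrier[OF that] by (simp add: m_comm)
  show fR: "finite (carrier (\<R> Quot ann))"
    unfolding carrier_order_quot
    by (rule finite_quot[OF ann_submodule submodule_of_order fg_order n(1) nR])
  show fT: "finite (carrier TS)"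
    unfolding carrier_quot_submod TS_def
    by (rule finite_quot[OF S T n(1)]) (rule rT[OF n(2)])
  have S0: "S = S +> \<zero>" using submodule_ofD(2)[OF S] by simp
  have mod: "module \<R> TS" unfolding TS_def by (rule quot_submod_module[OF S T(1)])
  have ann0: "r \<odot>\<^bsub>TS\<^esub> C = \<zero>\<^bsub>TS\<^esub>" if r: "r \<in> ann" and C: "C \<in> carrier TS" for r C
  proof -
    obtain t where t: "t \<in> T" "C = S +> t" using C unfolding carrier_quot_submod TS_def by blast
    have tc: "t \<in> carrier K" using submodule_ofD(8)[OF T(1) t(1)] .
    have rt: "r \<otimes> t \<in> S" by (rule rT[OF r t(1)])
    then have "r \<otimes> t \<ominus> \<zero> \<in> S" using submodule_ofD(6)[OF S _ submodule_ofD(3)[OF S]] by blast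
    then have "S +> r \<otimes> t = S"
      using coset_eq_iff_diff[OF S submodule_ofD(8)[OF S rt] zero_closed] S0 by simp
    then show ?thesis
      using smult_quot_submod[OF S tc annD(1)[OF r]] t(2) unfolding TS_def zero_quot_submod by simp
  qed
  show "2 \<le> card (carrier (\<R> Quot ann))"
    "\<exists>n. module_length \<R> TS = enat n \<and> card (carrier TS) = card (carrier (\<R> Quot ann)) ^ n"
    using length_of_finite_vector_space[OF mod fT ann_maximal fR ann0] by blast+
  have eq: "S +> t = S \<longleftrightarrow> t \<in> S" if t: "t \<in> T" for t
  proof -
    have tc: "t \<in> carrier K" using submodule_ofD(8)[OF T(1) t] .
    have "t \<ominus> \<zero> = t" using tc by algebra
    then show ?thesis using coset_eq_iff_diff[OF S tc zero_closed] S0 by simp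
  qed
  have STS: "S \<in> carrier TS"
    unfolding carrier_quot_submod TS_def using S0 submodule_ofD(3)[OF T(1)] by (rule image_eqI)
  show "card (carrier TS) = 1" if "S = T"
  proof -
    have "carrier TS = {S}" using STS eq that unfolding carrier_quot_submod TS_def by auto
    then show ?thesis by simp
  qed
  show "card (carrier TS) \<noteq> 1" if neq: "S \<noteq> T"
  proof
    assume "card (carrier TS) = 1"
    then have "carrier TS = {S}" using STS by (metis card_1_singletonE singletonD)
    moreover obtain t where t: "t \<in> T" "t \<notin> S" using sub neq by blast
    moreover have "S +> t \<in> carrier TS" using t unfolding carrier_quot_submod TS_def by blast
    ultimately show False using eq by blast
  qed
qed

text \<open>An element t of one ring is integral, so s t \<in> R for some s outside
  \<open>ann\<close>, and \<open>ann\<close> multiplies t into the other ring S. Writing 1 = y s + z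
  with z \<in> ann gives t = y (s t) + z t \<in> S.\<close>

lemma regular_imp_End_eq:
  assumes reg: "localization K R ann R = localization K R ann (maximal_order K)"
  shows "End_I = End_J"
proof -
  have one: "\<one> \<in> R - ann" using ann_maximal order_one maximalideal.I_notcarr[OF ann_maximal]
      ideal.one_imp_carrier[OF maximalideal.axioms(1)[OF ann_maximal]] by auto
  have aux: "t \<in> S" if S: "submodule_of S" "R \<subseteq> S" and t: "t \<in> maximal_order K"
    and rt: "\<And>r. r \<in> ann \<Longrightarrow> r \<otimes> t \<in> S" for t S
  proof -
    have tc: "t \<in> carrier K" using t by (simp add: maximal_order_def)
    obtain s where s: "s \<in> R - ann" "s \<otimes> t \<in> R" using regular_denominator[OF ann_maximal reg t] by blast
    have sc: "s \<in> carrier K" using s order_carrier by blast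
    obtain y z where yz: "y \<in> R" "z \<in> ann" "y \<otimes> s \<oplus> z = \<one>"
      using maximalideal.exists_inverse_mod[OF ann_maximal order_cring, of s] s by auto
    have c: "y \<in> carrier K" "z \<in> carrier K" using yz order_carrier annD(1) by auto
    have "t = (y \<otimes> s \<oplus> z) \<otimes> t" using yz(3) tc by simp
    also have "\<dots> = y \<otimes> (s \<otimes> t) \<oplus> z \<otimes> t" using c sc tc by algebra
    also have "\<dots> \<in> S" using submodule_ofD(4,7)[OF S(1)] S(2) s(2) yz(1) rt[OF yz(2)] by blast
    finally show ?thesis .
  qed
  have "End_I \<subseteq> End_J"
    using aux[OF End_sub(2) order_subset_colon_self[OF sub_J]] colon_self_maximal_order[OF lattice_I] ann_mult_End(2) by blast
  moreover have "End_J \<subseteq> End_I"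
    using aux[OF End_sub(1) order_subset_colon_self[OF sub_I]] colon_self_maximal_order[OF lattice_J] ann_mult_End(1) by blast
  ultimately show ?thesis by blast
qed

text \<open>At n = ann, x and x' are local generators of \<open>I\<close> and \<open>J\<close>. The
  element w x' sends I into R x' \<subseteq> J, and w' x sends J into R x \<subseteq> I; their
  product is (w x)(w' x'), outside n because n is prime.\<close>

lemma regular_imp_locally_isomorphic:
  assumes reg: "localization K R ann R = localization K R ann (maximal_order K)" and n: "maximalideal n \<R>"
  shows "\<exists>a\<in>colon K J I. \<exists>b\<in>colon K I J. a \<otimes> b \<in> R - n"
proof (cases "n = ann")
  case False
  have "\<not> ann \<subseteq> n"
    using maximalideal.I_maximal[OF ann_maximal maximalideal.axioms(1)[OF n]] False
      maximalideal.I_notcarr[OF n] order_ideal_submodule(2)[OF maximalideal.axioms(1)[OF n]] by auto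
  then obtain r where r: "r \<in> ann" "r \<notin> n" by blast
  have "\<one> \<in> colon K J I" using incl ID(8) by (auto simp: colon_iff)
  moreover have "r \<in> colon K I J" using annD[OF r(1)] annD(1)[OF r(1)] order_carrier r by (auto simp: colon_iff dest: annD(2))
  moreover have "\<one> \<otimes> r \<in> R - n" using r annD(1)[OF r(1)] order_carrier by simp
  ultimately show ?thesis by blast
next
  case True
  obtain k :: nat where k: "k > 0" "add_pow K k \<one> \<in> ann" using int_in_ann by blast
  obtain x w where xw: "x \<in> I" "w \<in> colon K R I" "w \<otimes> x \<in> R - ann"
    using locally_principal[OF ann_maximal k reg lattice_I] by blast
  obtain x' w' where xw': "x' \<in> J" "w' \<in> colon K R J" "w' \<otimes> x' \<in> R - ann"
    using locally_principal[OF ann_maximal k reg lattice_J] by blast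
  have c: "x \<in> carrier K" "w \<in> carrier K" "x' \<in> carrier K" "w' \<in> carrier K"
    using xw xw' ID(8) JD(8) by (auto simp: colon_iff)
  have "w \<otimes> x' \<in> colon K J I"
  proof -
    have "w \<otimes> x' \<otimes> z \<in> J" if z: "z \<in> I" for z
    proof -
      have "w \<otimes> x' \<otimes> z = (w \<otimes> z) \<otimes> x'" using c ID(8)[OF z] by (simp add: m_ac)
      then show ?thesis using JD(7)[OF _ xw'(1)] xw(2) z by (auto simp: colon_iff)
    qed
    then show ?thesis using c by (auto simp: colon_iff)
  qed
  moreover have "w' \<otimes> x \<in> colon K I J"
  proof -
    have "w' \<otimes> x \<otimes> z \<in> I" if z: "z \<in> J" for z
    proof -
      have "w' \<otimes> x \<otimes> z = (w' \<otimes> z) \<otimes> x" using c JD(8)[OF z] by (simp add: m_ac)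
      then show ?thesis using ID(7)[OF _ xw(1)] xw'(2) z by (auto simp: colon_iff)
    qed
    then show ?thesis using c by (auto simp: colon_iff)
  qed
  moreover have "(w \<otimes> x') \<otimes> (w' \<otimes> x) \<in> R - n"
  proof -
    have "(w \<otimes> x') \<otimes> (w' \<otimes> x) = (w \<otimes> x) \<otimes> (w' \<otimes> x')" using c by (simp add: m_ac)
    then show ?thesis using mult_notin_maximalideal[OF ann_maximal xw(3) xw'(3)] True by simp
  qed
  ultimately show ?thesis by blast
qed

end

text \<open>The group spanned by the listed powers is stable under x: x x^i is x^(i+1), where for i
  = d the integral equation of x is multiplied by x, and x y^(i+1) = q y^i. With exponents up to d
  included, x^(i+1) is in the list for each i < d. By symmetry the group is stable under y as
  well.\<close>

lemma (in cring) generate_ring_finitely_generated: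
  assumes x: "x \<in> carrier R" and y: "y \<in> carrier R" and xy: "x \<otimes> y = add_pow R (q::nat) \<one>"
    and xd: "x [^] d \<in> generate (add_monoid R) ((\<lambda>i. x [^] i) ` {..<d::nat})"
    and yd: "y [^] d \<in> generate (add_monoid R) ((\<lambda>i. y [^] i) ` {..<d})"
  shows "generate_ring R {x, y} \<subseteq>
    generate (add_monoid R) ((\<lambda>i. x [^] i) ` {..d} \<union> (\<lambda>i. y [^] i) ` {..d})"
    (is "_ \<subseteq> generate _ ?U")
proof -
  let ?W = "generate (add_monoid R) ?U"
  have U: "?U \<subseteq> carrier R" using x y by auto
  have W: "subgroup ?W (add_monoid R)" using add.generate_is_subgroup U by simp
  have Wc: "?W \<subseteq> carrier R" using subgroup.subset[OF W] by simp
  have pow_Suc: "z [^] Suc i \<in> ?W"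
    if z: "z \<in> carrier R" and zd: "z [^] d \<in> generate (add_monoid R) ((\<lambda>i. z [^] i) ` {..<d})"
      and zU: "(\<lambda>i. z [^] i) ` {..d} \<subseteq> ?U" and i: "i \<le> d" for z i
  proof (cases "i < d")
    case True
    then have "z [^] Suc i \<in> ?U" using zU by (meson Suc_leI atMost_iff image_subset_iff)
    then show ?thesis by (rule generate.incl)
  next
    case False
    have "z \<otimes> z [^] d \<in> ?W"
    proof (rule generate_add_mult_closed[OF _ z W _ zd])
      show "(\<lambda>i. z [^] i) ` {..<d} \<subseteq> carrier R" using z by auto
      fix u assume "u \<in> (\<lambda>i. z [^] i) ` {..<d}"
      then obtain j where j: "j < d" "u = z [^] j" by auto
      then have "z \<otimes> u = z [^] Suc j" using z by (simp add: m_comm)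
      moreover have "z [^] Suc j \<in> ?U" using zU j(1) by (meson Suc_leI atMost_iff image_subset_iff)
      ultimately show "z \<otimes> u \<in> ?W" by (simp only: generate.incl)
    qed
    then show ?thesis using False i z by (simp add: m_comm)
  qed
  have nat_mult: "add_pow R q \<one> \<otimes> u \<in> ?W" if u: "u \<in> ?U" for u
  proof -
    have uc: "u \<in> carrier R" using u U by blast
    have "add_pow R (k::nat) u \<in> ?W" for k
    proof (induction k)
      case 0 then show ?case using subgroup.one_closed[OF W] by simp
    next
      case (Suc k)
      then show ?case using subgroup.m_closed[OF W Suc generate.incl[OF u]] by simp
    qed
    then show ?thesis using add_pow_ldistr[of \<one> u q] uc by simp
  qed
  \<comment> \<open>Stated for a pair c, e so that it can be used with x and y in either
    order.\<close>
  have mult: "c \<otimes> u \<in> ?W"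
    if ce: "c \<in> carrier R" "e \<in> carrier R" "c \<otimes> e = add_pow R q \<one>"
      and cd: "c [^] d \<in> generate (add_monoid R) ((\<lambda>i. c [^] i) ` {..<d})"
      and cU: "(\<lambda>i. c [^] i) ` {..d} \<subseteq> ?U" and eU: "(\<lambda>i. e [^] i) ` {..d} \<subseteq> ?U"
      and Ueq: "?U = (\<lambda>i. c [^] i) ` {..d} \<union> (\<lambda>i. e [^] i) ` {..d}"
      and u: "u \<in> ?W" for c e u
  proof (rule generate_add_mult_closed[OF U ce(1) W _ u])
    fix v assume "v \<in> ?U"
    then consider i where "i \<le> d" "v = c [^] i" | i where "i \<le> d" "v = e [^] i" using Ueq by auto
    then show "c \<otimes> v \<in> ?W"
    proof cases
      case 1
      have "c \<otimes> v = c [^] Suc i" using 1 ce by (simp add: m_comm)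
      then show ?thesis using pow_Suc[OF ce(1) cd cU 1(1)] by simp
    next
      case 2
      show ?thesis
      proof (cases i)
        case 0
        have "c \<otimes> v = c [^] Suc 0" using 0 2 ce by simp
        then show ?thesis using pow_Suc[OF ce(1) cd cU, of 0] by simp
      next
        case (Suc j)
        have "v = e \<otimes> e [^] j" using Suc 2 ce by (simp add: m_comm)
        then have "c \<otimes> v = (c \<otimes> e) \<otimes> e [^] j" using m_assoc[of c e "e [^] j"] ce(1,2) by simp
        moreover have "e [^] j \<in> ?U" by (rule subsetD[OF eU], rule imageI) (use Suc 2 in simp)
        ultimately show ?thesis using nat_mult ce(3) by simp
      qed
    qed
  qed
  have xW: "x \<otimes> u \<in> ?W" if "u \<in> ?W" for u
    by (rule mult[OF x y xy xd _ _ _ that]) auto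
  have yW: "y \<otimes> u \<in> ?W" if "u \<in> ?W" for u
    by (rule mult[OF y x _ yd _ _ _ that]) (use xy x y m_comm in auto)
  have one: "\<one> \<in> ?W"
  proof (rule generate.incl)
    have "x [^] (0::nat) \<in> (\<lambda>i. x [^] i) ` {..d}" by (rule imageI) simp
    then show "\<one> \<in> ?U" by simp
  qed
  \<comment> \<open>The elements that map the group into itself form a ring containing x and y;
    since 1 lies in the group, so does every element of that ring.\<close>
  have "r \<in> carrier R \<and> (\<forall>u\<in>?W. r \<otimes> u \<in> ?W)" if "r \<in> generate_ring R {x, y}" for r
    using that
  proof (induction r rule: generate_ring.induct)
    case one then show ?case using Wc by auto
  next
    case (incl h) then show ?case using x y xW yW by auto
  next
    case (a_inv h)
    have "(\<ominus> h) \<otimes> u \<in> ?W" if u: "u \<in> ?W" for u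
    proof -
      have "(\<ominus> h) \<otimes> u = \<ominus> (h \<otimes> u)" using a_inv u Wc by (simp add: l_minus subset_iff)
      moreover have "\<ominus> (h \<otimes> u) \<in> ?W" using subgroup.m_inv_closed[OF W, of "h \<otimes> u"] a_inv u by (simp add: a_inv_def)
      ultimately show ?thesis by simp
    qed
    then show ?case using a_inv by simp
  next
    case (eng_add h1 h2)
    have "(h1 \<oplus> h2) \<otimes> u \<in> ?W" if u: "u \<in> ?W" for u
    proof -
      have "(h1 \<oplus> h2) \<otimes> u = h1 \<otimes> u \<oplus> h2 \<otimes> u" using eng_add u Wc by (simp add: l_distr subset_iff)
      moreover have "h1 \<otimes> u \<oplus> h2 \<otimes> u \<in> ?W" using subgroup.m_closed[OF W, of "h1 \<otimes> u" "h2 \<otimes> u"] eng_add u by simp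
      ultimately show ?thesis by simp
    qed
    then show ?case using eng_add by simp
  next
    case (eng_mult h1 h2)
    have "(h1 \<otimes> h2) \<otimes> u \<in> ?W" if u: "u \<in> ?W" for u
    proof -
      have "u \<in> carrier R" using u Wc by blast
      then have "(h1 \<otimes> h2) \<otimes> u = h1 \<otimes> (h2 \<otimes> u)" using eng_mult by (simp add: m_assoc)
      then show ?thesis using eng_mult u by simp
    qed
    then show ?case using eng_mult by simp
  qed
  then show ?thesis using one by fastforce
qed

section \<open>The algebra of a Weil polynomial\<close>

text \<open>Complex values of rational polynomials give access to the roots of \<open>h\<close>, in
  terms of which both the Weil condition and the absence of repeated roots are stated.\<close>

definition rat_poly_at :: "rat poly \<Rightarrow> complex \<Rightarrow> complex" where
  "rat_poly_at f z = poly (map_poly of_rat f) z"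

lemma rat_poly_at_0 [simp]: "rat_poly_at 0 z = 0"
  by (simp add: rat_poly_at_def)

lemma rat_poly_at_pCons [simp]: "rat_poly_at (pCons a f) z = of_rat a + z * rat_poly_at f z"
  by (simp add: rat_poly_at_def map_poly_pCons)

lemma rat_poly_at_add [simp]: "rat_poly_at (f + g) z = rat_poly_at f z + rat_poly_at g z"
  by (induction f g rule: poly_induct2) (auto simp: of_rat_add algebra_simps)

lemma rat_poly_at_smult [simp]: "rat_poly_at (smult c f) z = of_rat c * rat_poly_at f z"
  by (induction f) (auto simp: of_rat_mult algebra_simps)

lemma rat_poly_at_mult [simp]: "rat_poly_at (f * g) z = rat_poly_at f z * rat_poly_at g z"
  by (induction f) (auto simp: algebra_simps)

lemma rat_poly_at_pcompose: "rat_poly_at (pcompose f g) z = rat_poly_at f (rat_poly_at g z)"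
  by (induction f) (auto simp: pcompose_pCons)

lemma map_poly_int_rat: "map_poly of_rat (map_poly of_int h :: rat poly) = (map_poly of_int h :: complex poly)"
  by (simp add: map_poly_map_poly comp_def)

lemma rat_poly_at_of_int: "rat_poly_at (map_poly of_int h) z = poly (map_poly of_int h) z"
  by (simp add: rat_poly_at_def map_poly_int_rat)

lemma rat_poly_at_of_int_cnj: "rat_poly_at (map_poly of_int h) (cnj z) = cnj (rat_poly_at (map_poly of_int h) z)"
  by (induction h) (auto simp: map_poly_pCons)

text \<open>\<open>h\<close> has as many distinct roots as its degree, so the remainder of
  \<open>f\<close>, which vanishes at all of them and has smaller degree, is zero.\<close>

lemma dvd_of_roots:
  assumes sf: "rsquarefree (map_poly of_int h :: complex poly)"
    and roots: "\<And>z. poly (map_poly of_int h) z = 0 \<Longrightarrow> rat_poly_at f z = 0"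
  shows "map_poly of_int h dvd f"
proof -
  let ?h = "map_poly of_int h :: rat poly" and ?hc = "map_poly of_int h :: complex poly"
  let ?Z = "{z. poly ?hc z = 0}"
  have hc0: "?hc \<noteq> 0" using sf by (simp add: rsquarefree_def)
  have dc: "Polynomial.degree ?hc = Polynomial.degree h" and dr: "Polynomial.degree ?h = Polynomial.degree h"
    by (rule degree_map_poly; simp)+
  have card: "card ?Z = Polynomial.degree h"
  proof -
    have "Polynomial.degree (smult (Polynomial.lead_coeff ?hc) (\<Prod>z\<in>?Z. [:-z, 1:])) = Polynomial.degree ?hc"
      using complex_poly_decompose_rsquarefree[OF sf] by simp
    moreover have "Polynomial.degree (\<Prod>z\<in>?Z. [:-z, 1:]) = card ?Z"
      by (subst degree_prod_eq_sum_degree) auto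
    moreover have "Polynomial.lead_coeff ?hc \<noteq> 0" using hc0 leading_coeff_0_iff by blast
    ultimately show ?thesis unfolding degree_smult_eq dc by argo
  qed
  define r where "r = f mod ?h"
  have h0: "?h \<noteq> 0" using hc0 map_poly_int_rat[of h] by auto
  have rz: "rat_poly_at r z = 0" if z: "z \<in> ?Z" for z
  proof -
    have "f = (f div ?h) * ?h + r" unfolding r_def by (rule div_mult_mod_eq[symmetric])
    then have "rat_poly_at f z = rat_poly_at (f div ?h) z * rat_poly_at ?h z + rat_poly_at r z"
      by (metis rat_poly_at_add rat_poly_at_mult)
    then show ?thesis using roots z rat_poly_at_of_int[of h z] by simp
  qed
  have "r = 0"
  proof (rule ccontr)
    assume r0: "r \<noteq> 0"
    let ?r = "map_poly of_rat r :: complex poly"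
    have rc0: "?r \<noteq> 0" using r0 by (simp add: map_poly_eq_0_iff)
    have "Polynomial.degree r < Polynomial.degree h" using degree_mod_less[OF h0, of f] r0 dr by (simp add: r_def)
    moreover have "Polynomial.degree ?r = Polynomial.degree r" by (rule degree_map_poly) simp
    moreover have "card ?Z \<le> card {z. poly ?r z = 0}"
      by (rule card_mono[OF poly_roots_finite[OF rc0]]) (use rz in \<open>auto simp: rat_poly_at_def\<close>)
    moreover have "card {z. poly ?r z = 0} \<le> Polynomial.degree ?r" by (rule card_poly_roots_bound[OF rc0])
    ultimately show False using card by linarith
  qed
  then show ?thesis by (simp add: r_def mod_eq_0_iff_dvd)
qed

section \<open>The quotient algebra and classes of polynomials\<close>

lemma rat_poly_ring_simps [simp]:
  "carrier rat_poly_ring = UNIV" "f \<otimes>\<^bsub>rat_poly_ring\<^esub> g = f * g" "f \<oplus>\<^bsub>rat_poly_ring\<^esub> g = f + g"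
  "\<one>\<^bsub>rat_poly_ring\<^esub> = 1" "\<zero>\<^bsub>rat_poly_ring\<^esub> = 0"
  by (simp_all add: rat_poly_ring_def ring_of_type_algebra_def)

lemma cring_rat_poly_ring: "cring rat_poly_ring"
  unfolding rat_poly_ring_def by (rule cring_from_type_algebra)

lemma ideal_weil_ideal: "ideal (weil_ideal h) rat_poly_ring"
  unfolding weil_ideal_def by (rule cring.cgenideal_ideal[OF cring_rat_poly_ring]) simp

lemma mem_weil_ideal: "f \<in> weil_ideal h \<longleftrightarrow> map_poly of_int h dvd f"
  unfolding weil_ideal_def cgenideal_def by (auto simp: dvd_def mult.commute)

lemma cring_weil_algebra: "cring (weil_algebra h)"
  unfolding weil_algebra_def by (rule ideal.quotient_is_cring[OF ideal_weil_ideal cring_rat_poly_ring])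

lemma weil_class_hom: "weil_class h \<in> ring_hom rat_poly_ring (weil_algebra h)"
  using ideal.rcos_ring_hom[OF ideal_weil_ideal, of h] unfolding weil_algebra_def weil_class_def[abs_def] .

lemma weil_class_closed [simp]: "weil_class h f \<in> carrier (weil_algebra h)"
  using ring_hom_closed[OF weil_class_hom] by simp

lemma weil_class_mult: "weil_class h (f * g) = weil_class h f \<otimes>\<^bsub>weil_algebra h\<^esub> weil_class h g"
  using ring_hom_mult[OF weil_class_hom, of f g] by simp

lemma weil_class_add: "weil_class h (f + g) = weil_class h f \<oplus>\<^bsub>weil_algebra h\<^esub> weil_class h g"
  using ring_hom_add[OF weil_class_hom, of f g] by simp

lemma weil_class_one: "weil_class h 1 = \<one>\<^bsub>weil_algebra h\<^esub>"
  using ring_hom_one[OF weil_class_hom] by simp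

lemma weil_class_zero: "weil_class h 0 = \<zero>\<^bsub>weil_algebra h\<^esub>"
  using ring_hom_zero[OF weil_class_hom] cring_rat_poly_ring cring_weil_algebra
  by (simp add: cring.axioms(1))

lemma weil_class_minus: "weil_class h (- f) = \<ominus>\<^bsub>weil_algebra h\<^esub> weil_class h f"
proof -
  interpret K: cring "weil_algebra h" by (rule cring_weil_algebra)
  have "weil_class h (- f) \<oplus>\<^bsub>weil_algebra h\<^esub> weil_class h f = \<zero>\<^bsub>weil_algebra h\<^esub>"
    unfolding weil_class_add[symmetric] by (simp add: weil_class_zero)
  then show ?thesis using K.minus_equality by simp
qed

lemma weil_class_eq_zero: "map_poly of_int h dvd f \<Longrightarrow> weil_class h f = \<zero>\<^bsub>weil_algebra h\<^esub>"
proof -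
  assume "map_poly of_int h dvd f"
  then have "weil_ideal h +>\<^bsub>rat_poly_ring\<^esub> f = weil_ideal h"
    using abelian_subgroup.a_rcos_const[OF abelian_subgroupI3] mem_weil_ideal ideal_weil_ideal[of h]
      ideal.axioms(1) cring_rat_poly_ring cring.axioms(1) ring.is_abelian_group by metis
  then show ?thesis by (simp add: weil_class_def weil_algebra_def FactRing_def)
qed

lemma carrier_weil_algebra: "carrier (weil_algebra h) = range (weil_class h)"
  unfolding weil_algebra_def weil_class_def[abs_def] FactRing_def A_RCOSETS_def' by auto

lemma weil_class_power: "weil_class h (f ^ n) = weil_class h f [^]\<^bsub>weil_algebra h\<^esub> (n::nat)"
proof (induction n)
  case (Suc n)
  have "f ^ Suc n = f ^ n * f" by simp
  then show ?case using Suc weil_class_mult[of h "f ^ n" f] by (simp only: nat_pow_Suc)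
qed (simp add: weil_class_one)

lemma weil_class_of_nat: "weil_class h [:of_nat n:] = add_pow (weil_algebra h) n \<one>\<^bsub>weil_algebra h\<^esub>"
proof -
  interpret K: cring "weil_algebra h" by (rule cring_weil_algebra)
  show ?thesis
  proof (induction n)
    case 0 show ?case by (simp add: weil_class_zero)
  next
    case (Suc n)
    have "[:of_nat (Suc n):] = [:of_nat n:] + (1 :: rat poly)" by (simp add: one_pCons)
    then show ?case using Suc weil_class_add[of h "[:of_nat n:]" 1] by (simp add: weil_class_one)
  qed
qed

lemma weil_class_int_mem:
  assumes "subgroup B (add_monoid (weil_algebra h))" "\<one>\<^bsub>weil_algebra h\<^esub> \<in> B"
  shows "weil_class h [:of_int c:] \<in> B"
proof -
  interpret K: cring "weil_algebra h" by (rule cring_weil_algebra)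
  have nat: "weil_class h [:of_nat n:] \<in> B" for n
    unfolding weil_class_of_nat
    by (induction n) (use subgroup.one_closed[OF assms(1)] subgroup.m_closed[OF assms(1) _ assms(2)] in simp_all)
  show ?thesis
  proof (cases "c \<ge> 0")
    case True
    then show ?thesis using nat[of "nat c"] by simp
  next
    case False
    have e: "[:of_int c:] = - [:of_nat (nat (- c)):: rat:]" using False by simp
    show ?thesis unfolding e weil_class_minus using subgroup.m_inv_closed[OF assms(1) nat[of "nat (- c)"]]
      by (simp add: a_inv_def)
  qed
qed

text \<open>Horner's scheme. The zero polynomial is listed apart since its degree is 0, which is not
  below k = 0, a case that the induction reaches.\<close>

lemma weil_class_pcompose_mem:
  assumes "g = 0 \<or> Polynomial.degree g < k"
  shows "weil_class h (pcompose (map_poly of_int g) w) \<in>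
    generate (add_monoid (weil_algebra h)) ((\<lambda>i. weil_class h w [^]\<^bsub>weil_algebra h\<^esub> i) ` {..<k::nat})"
  using assms
proof (induction g arbitrary: k)
  case 0
  show ?case using generate.one[of "add_monoid (weil_algebra h)"] by (simp add: weil_class_zero)
next
  case (pCons c g)
  interpret K: cring "weil_algebra h" by (rule cring_weil_algebra)
  let ?x = "weil_class h w"
  let ?B = "\<lambda>k. generate (add_monoid (weil_algebra h)) ((\<lambda>i. ?x [^]\<^bsub>weil_algebra h\<^esub> i) ` {..<k::nat})"
  obtain l where k: "k = Suc l" using pCons by (cases k) (auto simp: pCons_eq_0_iff)
  have gl: "g = 0 \<or> Polynomial.degree g < l" using pCons.prems pCons.hyps k by (auto split: if_splits)
  have B: "subgroup (?B k) (add_monoid (weil_algebra h))" for k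
    by (rule K.add.generate_is_subgroup) auto
  have "\<one>\<^bsub>weil_algebra h\<^esub> \<in> ?B k"
  proof (rule generate.incl)
    have "?x [^]\<^bsub>weil_algebra h\<^esub> (0::nat) \<in> (\<lambda>i. ?x [^]\<^bsub>weil_algebra h\<^esub> i) ` {..<k}"
      by (rule imageI) (simp add: k)
    then show "\<one>\<^bsub>weil_algebra h\<^esub> \<in> (\<lambda>i. ?x [^]\<^bsub>weil_algebra h\<^esub> i) ` {..<k}" by simp
  qed
  then have c: "weil_class h [:of_int c:] \<in> ?B k" by (rule weil_class_int_mem[OF B])
  have m: "?x \<otimes>\<^bsub>weil_algebra h\<^esub> weil_class h (pcompose (map_poly of_int g) w) \<in> ?B k"
  proof (rule K.generate_add_mult_closed[OF _ _ B _ pCons.IH[OF gl]])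
    fix u assume "u \<in> (\<lambda>i. ?x [^]\<^bsub>weil_algebra h\<^esub> i) ` {..<l}"
    then obtain i where i: "i < l" "u = ?x [^]\<^bsub>weil_algebra h\<^esub> i" by auto
    then have "?x \<otimes>\<^bsub>weil_algebra h\<^esub> u = ?x [^]\<^bsub>weil_algebra h\<^esub> Suc i" by (simp add: K.m_comm)
    moreover have "?x [^]\<^bsub>weil_algebra h\<^esub> Suc i \<in> (\<lambda>i. ?x [^]\<^bsub>weil_algebra h\<^esub> i) ` {..<k}"
      by (rule imageI) (simp add: k i)
    ultimately show "?x \<otimes>\<^bsub>weil_algebra h\<^esub> u \<in> ?B k" by (simp only: generate.incl)
  qed auto
  have e: "pcompose (map_poly of_int (pCons c g)) w = [:of_int c:] + w * pcompose (map_poly of_int g) w"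
    by (simp add: map_poly_pCons pcompose_pCons)
  show ?case unfolding e weil_class_add weil_class_mult
    using subgroup.m_closed[OF B c m] by simp
qed

text \<open>The divisibility says that the class of \<open>w\<close> is a root of \<open>h\<close>
  in the algebra; as \<open>h\<close> is monic, it expresses the top power by lower ones. It is used
  for x and for q/x.\<close>

lemma weil_class_integral:
  assumes monic: "Polynomial.lead_coeff h = 1" and dvd: "map_poly of_int h dvd pcompose (map_poly of_int h) w"
  shows "weil_class h w [^]\<^bsub>weil_algebra h\<^esub> Polynomial.degree h \<in>
    generate (add_monoid (weil_algebra h)) ((\<lambda>i. weil_class h w [^]\<^bsub>weil_algebra h\<^esub> i) ` {..<Polynomial.degree h})"
    (is "_ \<in> ?B")
proof -
  interpret K: cring "weil_algebra h" by (rule cring_weil_algebra)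
  let ?g = "h - Polynomial.monom 1 (Polynomial.degree h)"
  have B: "subgroup ?B (add_monoid (weil_algebra h))"
    by (rule K.add.generate_is_subgroup) auto
  have g: "?g = 0 \<or> Polynomial.degree ?g < Polynomial.degree h"
  proof (cases "Polynomial.degree h = 0")
    case True
    then obtain c where "h = [:c:]" by (metis degree_0_id)
    then show ?thesis using monic True by (simp add: monom_0)
  next
    case False
    have "Polynomial.degree ?g < Polynomial.degree h \<or> ?g = 0"
    proof -
      have "Polynomial.degree ?g \<le> Polynomial.degree h" by (rule degree_diff_le) (auto simp: degree_monom_eq)
      moreover have "Polynomial.coeff ?g (Polynomial.degree h) = 0" using monic by simp
      ultimately show ?thesis by (metis leading_coeff_0_iff nat_less_le)
    qed
    then show ?thesis by blast
  qed
  have e: "pcompose (map_poly of_int h) w = w ^ Polynomial.degree h + pcompose (map_poly of_int ?g) w"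
  proof -
    have "map_poly of_int h = (Polynomial.monom 1 (Polynomial.degree h) :: rat poly) + map_poly of_int ?g"
      by (rule poly_eqI) (simp add: coeff_map_poly)
    moreover have "pcompose (Polynomial.monom 1 n) w = w ^ n" for n
      by (induction n) (auto simp: monom_0 monom_Suc pcompose_pCons)
    ultimately show ?thesis by (simp add: pcompose_add)
  qed
  have "\<zero>\<^bsub>weil_algebra h\<^esub> = weil_class h w [^]\<^bsub>weil_algebra h\<^esub> Polynomial.degree h \<oplus>\<^bsub>weil_algebra h\<^esub> weil_class h (pcompose (map_poly of_int ?g) w)"
    using weil_class_eq_zero[OF dvd] unfolding e weil_class_add weil_class_power by simp
  then have "weil_class h w [^]\<^bsub>weil_algebra h\<^esub> Polynomial.degree h = \<ominus>\<^bsub>weil_algebra h\<^esub> weil_class h (pcompose (map_poly of_int ?g) w)"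
    using K.minus_equality by simp
  also have "\<dots> \<in> ?B"
    using subgroup.m_inv_closed[OF B weil_class_pcompose_mem[OF g]] by (simp add: a_inv_def)
  finally show ?thesis .
qed

section \<open>Frobenius, Verschiebung and the order they generate\<close>

locale weil_polynomial =
  fixes q :: nat and h :: "int poly"
  assumes q_pos: "q > 0" and weil: "weil_poly q h" and no_repeated: "no_repeated_complex_roots h"
begin

lemma monic: "Polynomial.lead_coeff h = 1" and root_abs: "poly (map_poly of_int h) z = 0 \<Longrightarrow> cmod z = sqrt (real q)"
  using weil by (auto simp: weil_poly_def)

lemma coeff_0_nonzero: "Polynomial.coeff h 0 \<noteq> 0"
proof
  assume "Polynomial.coeff h 0 = 0"
  then have "poly (map_poly of_int h) (0::complex) = 0" by (simp add: poly_0_coeff_0 coeff_map_poly)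
  then show False using root_abs[of 0] q_pos by simp
qed

text \<open>With h = c + x g and c \<noteq> 0, the polynomial v = -g/c satisfies x v = 1 - h/c,
  which is 1 in the algebra and at every root of \<open>h\<close>.\<close>

lemma frob_inverse:
  obtains v where "weil_class h ([:0, 1:] * v) = \<one>\<^bsub>weil_algebra h\<^esub>"
    "\<And>z. poly (map_poly of_int h) z = 0 \<Longrightarrow> z * rat_poly_at v z = 1"
proof -
  let ?h = "map_poly of_int h :: rat poly"
  obtain c g where hc: "h = pCons c g" by (cases h)
  have c0: "c \<noteq> 0" using coeff_0_nonzero hc by simp
  define v where "v = smult (- 1 / of_int c) (map_poly of_int g :: rat poly)"
  have e: "[:0, 1:] * v = 1 + smult (- 1 / of_int c) ?h"
    using c0 by (simp add: v_def hc map_poly_pCons one_pCons)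
  have "weil_class h (smult (- 1 / of_int c) ?h) = \<zero>\<^bsub>weil_algebra h\<^esub>"
    by (rule weil_class_eq_zero) (rule dvd_smult, simp)
  then have "weil_class h ([:0, 1:] * v) = \<one>\<^bsub>weil_algebra h\<^esub>"
    unfolding e weil_class_add weil_class_one
    using cring.cring_simprules(16)[OF cring_weil_algebra] weil_class_closed[of h 1, unfolded weil_class_one]
    by (simp add: cring.axioms(1) ring.ring_simprules(15) cring_weil_algebra)
  moreover have "z * rat_poly_at v z = 1" if z: "poly (map_poly of_int h) z = 0" for z
  proof -
    have "rat_poly_at ([:0, 1:] * v) z = rat_poly_at 1 z"
      unfolding e rat_poly_at_add rat_poly_at_smult rat_poly_at_of_int z by simp
    then show ?thesis by (simp add: one_pCons)
  qed
  ultimately show thesis using that by blast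
qed

abbreviation "K \<equiv> weil_algebra h"

lemma frob_order_eq: "frob_order q h = K\<lparr>carrier := carrier (frob_order q h)\<rparr>"
  by (simp add: frob_order_def)

lemma carrier_frob_order: "carrier (frob_order q h) = generate_ring K {frob h, verschiebung q h}"
  by (simp add: frob_order_def)

text \<open>A polynomial \<open>w\<close> for q/x takes the value q/z at a root z, and |z|^2 = q
  makes this the conjugate of z. As \<open>h\<close> has real coefficients, the conjugate is again a
  root, so h(w) vanishes at all roots of \<open>h\<close> and is divisible by
  \<open>h\<close>.\<close>

lemma verschiebung_class:
  obtains w where "verschiebung q h = weil_class h w" "frob h \<otimes>\<^bsub>K\<^esub> verschiebung q h = add_pow K q \<one>\<^bsub>K\<^esub>"
    "map_poly of_int h dvd pcompose (map_poly of_int h) w"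
proof -
  interpret K: cring K by (rule cring_weil_algebra)
  obtain v where v: "weil_class h ([:0, 1:] * v) = \<one>\<^bsub>K\<^esub>"
    "\<And>z. poly (map_poly of_int h) z = 0 \<Longrightarrow> z * rat_poly_at v z = 1"
    using frob_inverse by blast
  have fv: "frob h \<otimes>\<^bsub>K\<^esub> weil_class h v = \<one>\<^bsub>K\<^esub>"
    using v(1) unfolding weil_class_mult frob_def .
  have fc: "frob h \<in> carrier K" by (simp add: frob_def)
  have inv: "inv\<^bsub>K\<^esub> (frob h) = weil_class h v"
    using K.comm_inv_char[OF fc weil_class_closed fv] .
  define w where "w = [:of_nat q:] * v"
  have w: "verschiebung q h = weil_class h w"
    unfolding verschiebung_def inv w_def weil_class_mult ..
  have "frob h \<otimes>\<^bsub>K\<^esub> verschiebung q h = weil_class h [:of_nat q:] \<otimes>\<^bsub>K\<^esub> (frob h \<otimes>\<^bsub>K\<^esub> weil_class h v)"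
    unfolding w w_def weil_class_mult by (rule K.m_lcomm) (simp_all add: fc)
  also have "\<dots> = add_pow K q \<one>\<^bsub>K\<^esub>" unfolding fv by (simp add: weil_class_of_nat)
  finally have fw: "frob h \<otimes>\<^bsub>K\<^esub> verschiebung q h = add_pow K q \<one>\<^bsub>K\<^esub>" .
  have "map_poly of_int h dvd pcompose (map_poly of_int h) w"
  proof (rule dvd_of_roots)
    show "rsquarefree (map_poly of_int h :: complex poly)"
      using no_repeated by (simp add: no_repeated_complex_roots_def)
    fix z :: complex assume z: "poly (map_poly of_int h) z = 0"
    have "cmod z ^ 2 = real q" using root_abs[OF z] by simp
    then have "z * cnj z = of_nat q" using complex_norm_square[of z] by simp
    then have "rat_poly_at w z = (z * rat_poly_at v z) * cnj z" by (simp add: w_def algebra_simps)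
    then have wz: "rat_poly_at w z = cnj z" using v(2)[OF z] by simp
    show "rat_poly_at (pcompose (map_poly of_int h) w) z = 0"
      unfolding rat_poly_at_pcompose wz
      using rat_poly_at_of_int_cnj[of h z, unfolded rat_poly_at_of_int[of h z] z] by simp
  qed
  then show thesis using that w fw by blast
qed

lemma frob_order_subring: "subring (carrier (frob_order q h)) K"
proof -
  interpret K: cring K by (rule cring_weil_algebra)
  obtain w where "verschiebung q h = weil_class h w" using verschiebung_class by blast
  then show ?thesis unfolding carrier_frob_order
    by (intro K.generate_ring_is_subring) (auto simp: frob_def)
qed

lemma order_in_algebra_frob_order: "order_in_algebra K (carrier (frob_order q h))"
proof -
  interpret K: cring K by (rule cring_weil_algebra)
  let ?R = "carrier (frob_order q h)"
  note RD = subringE[OF frob_order_subring]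
  obtain w where w: "verschiebung q h = weil_class h w" "frob h \<otimes>\<^bsub>K\<^esub> verschiebung q h = add_pow K q \<one>\<^bsub>K\<^esub>"
    "map_poly of_int h dvd pcompose (map_poly of_int h) w" using verschiebung_class by blast
  have fc: "frob h \<in> carrier K" "verschiebung q h \<in> carrier K" by (simp_all add: frob_def w(1))
  have fR: "frob h \<in> ?R" unfolding carrier_frob_order by (simp add: generate_ring.incl)
  have intR: "weil_class h [:of_int c:] \<in> ?R" for c
  proof (rule weil_class_int_mem)
    show "subgroup ?R (add_monoid K)"
      using subring.axioms(1)[OF frob_order_subring] .
  qed (rule RD(3))
  have pow: "add_pow K n x = weil_class h [:of_nat n:] \<otimes>\<^bsub>K\<^esub> x" if "x \<in> carrier K" for n :: nat and x
    using K.add_pow_ldistr[of "\<one>\<^bsub>K\<^esub>" x n] that by (simp add: weil_class_of_nat)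
  \<comment> \<open>With k a denominator of the coefficient c and n one for f, the identity n k (c +
    x f) = n (k c) + k (x (n f)) has all its terms on the right in R.\<close>
  have den: "\<exists>n>0. add_pow K (n::nat) (weil_class h f) \<in> ?R" for f
  proof (induction f)
    case 0
    show ?case using RD(2) by (intro exI[of _ 1]) (simp add: weil_class_zero)
  next
    case (pCons c f)
    then obtain n :: nat where n: "n > 0" "add_pow K n (weil_class h f) \<in> ?R" by blast
    obtain a b where ab: "c = of_int a / of_int b" "b > 0"
      by (metis quotient_of_div quotient_of_denom_pos surj_pair)
    define k where "k = nat b"
    have k: "k > 0" "of_nat k * c = of_int a" using ab by (auto simp: k_def)
    have e: "[:of_nat (n * k):] * pCons c f = [:of_int (int n * a):] + [:of_int (int k):] * ([:0, 1:] * ([:of_nat n:] * f))"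
      using k(2) by (simp add: algebra_simps)
    have "add_pow K (n * k) (weil_class h (pCons c f)) = weil_class h ([:of_nat (n * k):] * pCons c f)"
      by (simp only: pow weil_class_mult weil_class_closed)
    also have "\<dots> = weil_class h [:of_int (int n * a):] \<oplus>\<^bsub>K\<^esub> weil_class h [:of_int (int k):] \<otimes>\<^bsub>K\<^esub> (frob h \<otimes>\<^bsub>K\<^esub> add_pow K n (weil_class h f))"
      unfolding e weil_class_add weil_class_mult frob_def pow[OF weil_class_closed] ..
    also have "\<dots> \<in> ?R" by (intro RD(6) RD(7) intR fR n(2))
    finally show ?case using n k by (intro exI[of _ "n * k"]) simp
  qed
  show ?thesis
  proof (intro order_in_algebra.intro order_in_algebra_axioms.intro)
    show "cring K" by (rule cring_weil_algebra)
    show "subring ?R K" by (rule frob_order_subring)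
    have "frob h [^]\<^bsub>K\<^esub> Polynomial.degree h \<in>
        generate (add_monoid K) ((\<lambda>i. frob h [^]\<^bsub>K\<^esub> i) ` {..<Polynomial.degree h})"
      unfolding frob_def by (rule weil_class_integral[OF monic]) simp
    moreover have "verschiebung q h [^]\<^bsub>K\<^esub> Polynomial.degree h \<in>
        generate (add_monoid K) ((\<lambda>i. verschiebung q h [^]\<^bsub>K\<^esub> i) ` {..<Polynomial.degree h})"
      unfolding w(1) by (rule weil_class_integral[OF monic w(3)])
    ultimately have sub: "?R \<subseteq> generate (add_monoid K) ((\<lambda>i. frob h [^]\<^bsub>K\<^esub> i) ` {..Polynomial.degree h} \<union>
        (\<lambda>i. verschiebung q h [^]\<^bsub>K\<^esub> i) ` {..Polynomial.degree h})"
      unfolding carrier_frob_order by (rule K.generate_ring_finitely_generated[OF fc w(2)])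
    show "\<exists>U. finite U \<and> U \<subseteq> carrier K \<and> ?R \<subseteq> generate (add_monoid K) U"
      by (rule exI[where P = "\<lambda>U. finite U \<and> U \<subseteq> carrier K \<and> ?R \<subseteq> generate (add_monoid K) U", OF conjI[OF _ conjI[OF _ sub]]])
        (use fc in auto)
    fix n :: nat assume n: "n > 0"
    have "weil_class h [:of_nat n:] \<otimes>\<^bsub>K\<^esub> weil_class h [:1 / of_nat n:] = \<one>\<^bsub>K\<^esub>"
      unfolding weil_class_mult[symmetric] weil_class_one[symmetric] using n by (simp add: one_pCons)
    then show "add_pow K n \<one>\<^bsub>K\<^esub> \<in> Units K"
      unfolding weil_class_of_nat[symmetric] Units_def
      using K.m_comm[of "weil_class h [:of_nat n:]" "weil_class h [:1 / of_nat n:]"]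
      by (intro CollectI conjI bexI[of _ "weil_class h [:1 / of_nat n:]"]) simp_all
  next
    fix x assume "x \<in> carrier K"
    then show "\<exists>n>0. add_pow K (n::nat) x \<in> ?R" using den carrier_weil_algebra by auto
  qed
qed

sublocale frob: order_in_algebra "weil_algebra h" "carrier (frob_order q h)"
  by (rule order_in_algebra_frob_order)

lemma fractional_ideal_iff: "fractional_ideal q h L \<longleftrightarrow> frob.lattice_in L"
  unfolding fractional_ideal_def frob.lattice_in_def using frob.Span_iff by blast

end

section \<open>Deligne's functor\<close>

locale deligne = weil_polynomial q h for q h +
  fixes V :: "('o, 'm) isog_cat"
    and F\<^sub>O :: "'o \<Rightarrow> rat poly set set" and F\<^sub>M :: "'o \<Rightarrow> 'o \<Rightarrow> 'm \<Rightarrow> rat poly set"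
  assumes deligne_functor: "deligne_functor q h V F\<^sub>O F\<^sub>M"
begin

lemma category_V: "category V"
  using deligne_functor by (simp add: deligne_functor_def)

lemma equivalence: "equivalence_functor V (fractional_ideal_cat q h) F\<^sub>O F\<^sub>M"
  using deligne_functor by (simp add: deligne_functor_def)

lemma F_lattice: "A \<in> Obj V \<Longrightarrow> frob.lattice_in (F\<^sub>O A)"
  using equivalence by (auto simp: equivalence_functor_def fractional_ideal_cat_def fractional_ideal_iff)

lemma F_id: "A \<in> Obj V \<Longrightarrow> F\<^sub>M A A (Id V A) = \<one>\<^bsub>K\<^esub>"
  using equivalence by (auto simp: equivalence_functor_def fractional_ideal_cat_def)

lemma F_comp:
  assumes "A \<in> Obj V" "B \<in> Obj V" "C \<in> Obj V" "f \<in> Hom V A B" "g \<in> Hom V B C"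
  shows "F\<^sub>M A C (Comp V g f) = F\<^sub>M B C g \<otimes>\<^bsub>K\<^esub> F\<^sub>M A B f"
proof -
  have "\<forall>A\<in>Obj V. \<forall>B\<in>Obj V. \<forall>E\<in>Obj V. \<forall>f\<in>Hom V A B. \<forall>g\<in>Hom V B E.
      F\<^sub>M A E (Comp V g f) = Comp (fractional_ideal_cat q h) (F\<^sub>M B E g) (F\<^sub>M A B f)"
    using equivalence unfolding equivalence_functor_def by (elim conjE)
  then have "F\<^sub>M A C (Comp V g f) = Comp (fractional_ideal_cat q h) (F\<^sub>M B C g) (F\<^sub>M A B f)"
    using assms by blast
  then show ?thesis by (simp add: fractional_ideal_cat_def)
qed

lemma F_bij:
  assumes "A \<in> Obj V" "B \<in> Obj V"
  shows "bij_betw (F\<^sub>M A B) (Hom V A B) (colon K (F\<^sub>O B) (F\<^sub>O A))"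
proof -
  have "\<forall>A\<in>Obj V. \<forall>B\<in>Obj V. bij_betw (F\<^sub>M A B) (Hom V A B) (Hom (fractional_ideal_cat q h) (F\<^sub>O A) (F\<^sub>O B))"
    using equivalence unfolding equivalence_functor_def by (elim conjE)
  then show ?thesis using assms by (simp add: fractional_ideal_cat_def)
qed

lemma F_closed: "A \<in> Obj V \<Longrightarrow> B \<in> Obj V \<Longrightarrow> f \<in> Hom V A B \<Longrightarrow> F\<^sub>M A B f \<in> colon K (F\<^sub>O B) (F\<^sub>O A)"
  using F_bij by (auto simp: bij_betw_def)

lemma F_inj:
  assumes "A \<in> Obj V" "B \<in> Obj V" "f \<in> Hom V A B" "g \<in> Hom V A B" "F\<^sub>M A B f = F\<^sub>M A B g"
  shows "f = g"
  using F_bij[OF assms(1,2)] assms(3-5) by (auto simp: bij_betw_def inj_on_def)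

lemma F_surj:
  assumes "A \<in> Obj V" "B \<in> Obj V" "a \<in> colon K (F\<^sub>O B) (F\<^sub>O A)"
  obtains f where "f \<in> Hom V A B" "F\<^sub>M A B f = a"
proof -
  have "a \<in> F\<^sub>M A B ` Hom V A B" using F_bij[OF assms(1,2)] assms(3) by (simp add: bij_betw_def)
  then show thesis using that by blast
qed

lemma End_eq: "A \<in> Obj V \<Longrightarrow> End_in V F\<^sub>M A = colon K (F\<^sub>O A) (F\<^sub>O A)"
  using F_bij[of A A] by (simp add: End_in_def bij_betw_def)

lemma comp_closed:
  assumes "A \<in> Obj V" "B \<in> Obj V" "C \<in> Obj V" "f \<in> Hom V A B" "g \<in> Hom V B C"
  shows "Comp V g f \<in> Hom V A C"
  using category_V assms unfolding category_def by blast

lemma id_closed: "A \<in> Obj V \<Longrightarrow> Id V A \<in> Hom V A A"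
  using category_V unfolding category_def by blast

text \<open>A fully faithful functor reflects isomorphisms: the preimage of b is the inverse. One
  equation in \<open>K\<close> yields both composites because \<open>K\<close> is
  commutative.\<close>

lemma isomorphismI:
  assumes AB: "A \<in> Obj V" "B \<in> Obj V" and f: "f \<in> Hom V A B"
    and b: "b \<in> colon K (F\<^sub>O A) (F\<^sub>O B)" "F\<^sub>M A B f \<otimes>\<^bsub>K\<^esub> b = \<one>\<^bsub>K\<^esub>"
  shows "isomorphism V A B f"
proof -
  obtain g where g: "g \<in> Hom V B A" "F\<^sub>M B A g = b" using F_surj[OF AB(2,1) b(1)] by blast
  have "F\<^sub>M A B f \<in> carrier K" "b \<in> carrier K"
    using F_closed[OF AB f] b(1) by (auto simp: frob.colon_iff)
  then have b': "b \<otimes>\<^bsub>K\<^esub> F\<^sub>M A B f = \<one>\<^bsub>K\<^esub>" using b(2) frob.m_comm by simp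
  have "F\<^sub>M A A (Comp V g f) = F\<^sub>M A A (Id V A)"
    using F_comp[OF AB AB(1) f g(1)] F_id[OF AB(1)] g(2) b' by simp
  then have 1: "Comp V g f = Id V A"
    using F_inj[OF AB(1,1) comp_closed[OF AB AB(1) f g(1)] id_closed[OF AB(1)]] by blast
  have "F\<^sub>M B B (Comp V f g) = F\<^sub>M B B (Id V B)"
    using F_comp[OF AB(2,1,2) g(1) f] F_id[OF AB(2)] g(2) b(2) by simp
  then have "Comp V f g = Id V B"
    using F_inj[OF AB(2,2) comp_closed[OF AB(2,1,2) g(1) f] id_closed[OF AB(2)]] by blast
  then show ?thesis using 1 f g(1) unfolding isomorphism_def by blast
qed

lemma isomorphismD:
  assumes AB: "A \<in> Obj V" "B \<in> Obj V" and iso: "isomorphism V A B f"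
  obtains b where "b \<in> colon K (F\<^sub>O A) (F\<^sub>O B)" "F\<^sub>M A B f \<otimes>\<^bsub>K\<^esub> b = \<one>\<^bsub>K\<^esub>"
proof -
  obtain g where g: "f \<in> Hom V A B" "g \<in> Hom V B A" "Comp V f g = Id V B"
    using iso unfolding isomorphism_def by blast
  have "F\<^sub>M A B f \<otimes>\<^bsub>K\<^esub> F\<^sub>M B A g = \<one>\<^bsub>K\<^esub>"
    using F_comp[OF AB(2,1,2) g(2,1)] g(3) F_id[OF AB(2)] by simp
  then show thesis using that F_closed[OF AB(2,1) g(2)] by blast
qed

lemma essentially_surjective:
  assumes "frob.lattice_in L"
  obtains C f g where "C \<in> Obj V" "f \<in> colon K L (F\<^sub>O C)" "g \<in> colon K (F\<^sub>O C) L"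
    "f \<otimes>\<^bsub>K\<^esub> g = \<one>\<^bsub>K\<^esub>"
proof -
  have "\<forall>Y\<in>Obj (fractional_ideal_cat q h). \<exists>A\<in>Obj V. \<exists>f. isomorphism (fractional_ideal_cat q h) (F\<^sub>O A) Y f"
    using equivalence unfolding equivalence_functor_def by (elim conjE)
  moreover have "L \<in> Obj (fractional_ideal_cat q h)"
    using assms by (simp add: fractional_ideal_cat_def fractional_ideal_iff)
  ultimately obtain C f where C: "C \<in> Obj V" "isomorphism (fractional_ideal_cat q h) (F\<^sub>O C) L f" by blast
  then obtain g where "f \<in> colon K L (F\<^sub>O C)" "g \<in> colon K (F\<^sub>O C) L" "f \<otimes>\<^bsub>K\<^esub> g = \<one>\<^bsub>K\<^esub>"
    unfolding isomorphism_def by (auto simp: fractional_ideal_cat_def)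
  then show thesis using that C(1) by blast
qed

end

section \<open>Minimal isogenies as simple inclusions\<close>

context deligne
begin

text \<open>A module L between a F(A) and F(B) is a lattice, so up to an isomorphism f with inverse
  g it is F(C) for some C, and the isogeny factors through C as f after g a. If the first factor is
  an isomorphism, then L = F(B); if the second is, then L = a F(A). The two ends differ, since an
  isogeny of degree > 1 is not an isomorphism.\<close>

lemma minimal_simple_inclusion:
  assumes AB: "A \<in> Obj V" "B \<in> Obj V" and min: "minimal_isogeny V A B \<phi>"
  shows "F\<^sub>M A B \<phi> \<in> Units K"
    and "simple_inclusion K (carrier (frob_order q h)) (F\<^sub>M A B \<phi> <#\<^bsub>K\<^esub> F\<^sub>O A) (F\<^sub>O B)"
proof -
  define a where "a = F\<^sub>M A B \<phi>"
  have isog: "Isog V A B = {\<phi> \<in> Hom V A B. F\<^sub>M A B \<phi> \<in> Units K}"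
    using deligne_functor AB by (simp add: deligne_functor_def)
  have \<phi>: "\<phi> \<in> Hom V A B" "a \<in> Units K" "\<phi> \<in> Isog V A B"
    using min isog by (auto simp: minimal_isogeny_def a_def)
  then show "F\<^sub>M A B \<phi> \<in> Units K" by (simp add: a_def)
  have ac: "a \<in> carrier K" using \<phi>(2) by (rule frob.Units_closed)
  have "isog_deg V A B \<phi> = 1 \<longleftrightarrow> isomorphism V A B \<phi>"
    using deligne_functor AB \<phi>(3) by (simp add: deligne_functor_def)
  then have niso: "\<not> isomorphism V A B \<phi>" using min by (simp add: minimal_isogeny_def)
  have acol: "a \<in> colon K (F\<^sub>O B) (F\<^sub>O A)" unfolding a_def by (rule F_closed[OF AB \<phi>(1)])
  have I: "frob.submodule_of (F\<^sub>O A)" and J: "frob.submodule_of (F\<^sub>O B)"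
    using F_lattice AB by (auto simp: frob.lattice_in_def)
  have sub: "a <#\<^bsub>K\<^esub> F\<^sub>O A \<subseteq> F\<^sub>O B" using acol by (simp add: colon_def)
  show "simple_inclusion K (carrier (frob_order q h)) (F\<^sub>M A B \<phi> <#\<^bsub>K\<^esub> F\<^sub>O A) (F\<^sub>O B)"
    unfolding a_def[symmetric]
  proof (intro simple_inclusion.intro simple_inclusion_axioms.intro order_in_algebra_frob_order)
    show "frob.lattice_in (a <#\<^bsub>K\<^esub> F\<^sub>O A)" by (rule frob.scale_lattice[OF F_lattice[OF AB(1)] \<phi>(2)])
    show "frob.lattice_in (F\<^sub>O B)" by (rule F_lattice[OF AB(2)])
    show "a <#\<^bsub>K\<^esub> F\<^sub>O A \<subseteq> F\<^sub>O B" by (rule sub)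
    show "a <#\<^bsub>K\<^esub> F\<^sub>O A \<noteq> F\<^sub>O B"
    proof
      assume eq: "a <#\<^bsub>K\<^esub> F\<^sub>O A = F\<^sub>O B"
      have "inv\<^bsub>K\<^esub> a \<otimes>\<^bsub>K\<^esub> x \<in> F\<^sub>O A" if x: "x \<in> F\<^sub>O B" for x
      proof -
        obtain y where y: "y \<in> F\<^sub>O A" "x = a \<otimes>\<^bsub>K\<^esub> y" using x unfolding eq[symmetric] l_coset_def by blast
        have "inv\<^bsub>K\<^esub> a \<otimes>\<^bsub>K\<^esub> (a \<otimes>\<^bsub>K\<^esub> y) = (inv\<^bsub>K\<^esub> a \<otimes>\<^bsub>K\<^esub> a) \<otimes>\<^bsub>K\<^esub> y"
          using frob.m_assoc[of "inv\<^bsub>K\<^esub> a" a y] ac \<phi>(2) frob.submodule_ofD(8)[OF I y(1)] by simp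
        then show ?thesis using y \<phi>(2) frob.submodule_ofD(8)[OF I y(1)] by simp
      qed
      then have "inv\<^bsub>K\<^esub> a \<in> colon K (F\<^sub>O A) (F\<^sub>O B)" using \<phi>(2) by (simp add: frob.colon_iff)
      moreover have "a \<otimes>\<^bsub>K\<^esub> inv\<^bsub>K\<^esub> a = \<one>\<^bsub>K\<^esub>" using \<phi>(2) by simp
      ultimately have "isomorphism V A B \<phi>" using isomorphismI[OF AB \<phi>(1)] unfolding a_def by blast
      then show False using niso by blast
    qed
    fix L assume L: "frob.submodule_of L" "a <#\<^bsub>K\<^esub> F\<^sub>O A \<subseteq> L" "L \<subseteq> F\<^sub>O B"
    \<comment> \<open>Finite generation of L is inherited from F(B) above it, a unit of
      \<open>K\<close> from a F(A) below it.\<close>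
    have "frob.fg L" using frob.fg_mono[OF _ L(3)] F_lattice[OF AB(2)] by (simp add: frob.lattice_in_def)
    moreover have "L \<inter> Units K \<noteq> {}"
      using frob.scale_lattice[OF F_lattice[OF AB(1)] \<phi>(2)] L(2) unfolding frob.lattice_in_def by blast
    ultimately have "frob.lattice_in L" using L(1) by (simp add: frob.lattice_in_def)
    then obtain C f g where C: "C \<in> Obj V" "f \<in> colon K L (F\<^sub>O C)" "g \<in> colon K (F\<^sub>O C) L" "f \<otimes>\<^bsub>K\<^esub> g = \<one>\<^bsub>K\<^esub>"
      using essentially_surjective by blast
    have fg: "f \<in> carrier K" "g \<in> carrier K" "\<And>x. x \<in> F\<^sub>O C \<Longrightarrow> f \<otimes>\<^bsub>K\<^esub> x \<in> L" "\<And>x. x \<in> L \<Longrightarrow> g \<otimes>\<^bsub>K\<^esub> x \<in> F\<^sub>O C"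
      using C(2,3) by (auto simp: frob.colon_iff)
    have fgx: "f \<otimes>\<^bsub>K\<^esub> (g \<otimes>\<^bsub>K\<^esub> x) = x" if "x \<in> carrier K" for x
      using frob.m_assoc[OF fg(1,2) that] C(4) that by simp
    have aI: "a \<otimes>\<^bsub>K\<^esub> x \<in> L" if "x \<in> F\<^sub>O A" for x using that L(2) by (auto simp: l_coset_def)
    have "g \<otimes>\<^bsub>K\<^esub> a \<in> colon K (F\<^sub>O C) (F\<^sub>O A)"
    proof -
      have "g \<otimes>\<^bsub>K\<^esub> a \<otimes>\<^bsub>K\<^esub> x \<in> F\<^sub>O C" if x: "x \<in> F\<^sub>O A" for x
        using fg(4)[OF aI[OF x]] frob.m_assoc[OF fg(2) ac frob.submodule_ofD(8)[OF I x]] by simp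
      then show ?thesis using fg ac by (simp add: frob.colon_iff)
    qed
    then obtain \<psi>\<^sub>2 where \<psi>\<^sub>2: "\<psi>\<^sub>2 \<in> Hom V A C" "F\<^sub>M A C \<psi>\<^sub>2 = g \<otimes>\<^bsub>K\<^esub> a" using F_surj[OF AB(1) C(1)] by blast
    have "f \<in> colon K (F\<^sub>O B) (F\<^sub>O C)" using fg L(3) by (auto simp: frob.colon_iff)
    then obtain \<psi>\<^sub>1 where \<psi>\<^sub>1: "\<psi>\<^sub>1 \<in> Hom V C B" "F\<^sub>M C B \<psi>\<^sub>1 = f" using F_surj[OF C(1) AB(2)] by blast
    have "F\<^sub>M A B (Comp V \<psi>\<^sub>1 \<psi>\<^sub>2) = F\<^sub>M A B \<phi>"
      using F_comp[OF AB(1) C(1) AB(2) \<psi>\<^sub>2(1) \<psi>\<^sub>1(1)] \<psi>\<^sub>1(2) \<psi>\<^sub>2(2) fgx[OF ac] a_def by simp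
    then have "\<phi> = Comp V \<psi>\<^sub>1 \<psi>\<^sub>2"
      using F_inj[OF AB \<phi>(1) comp_closed[OF AB(1) C(1) AB(2) \<psi>\<^sub>2(1) \<psi>\<^sub>1(1)]] by simp
    then consider "isomorphism V C B \<psi>\<^sub>1" | "isomorphism V A C \<psi>\<^sub>2"
      using min C(1) \<psi>\<^sub>1(1) \<psi>\<^sub>2(1) unfolding minimal_isogeny_def by blast
    then show "L = a <#\<^bsub>K\<^esub> F\<^sub>O A \<or> L = F\<^sub>O B"
    proof cases
      case 1
      then obtain b where b: "b \<in> colon K (F\<^sub>O C) (F\<^sub>O B)" "f \<otimes>\<^bsub>K\<^esub> b = \<one>\<^bsub>K\<^esub>"
        using isomorphismD[OF C(1) AB(2)] \<psi>\<^sub>1(2) by metis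
      have "x \<in> L" if x: "x \<in> F\<^sub>O B" for x
      proof -
        have bx: "b \<otimes>\<^bsub>K\<^esub> x \<in> F\<^sub>O C" and bc: "b \<in> carrier K" using b(1) x by (auto simp: frob.colon_iff)
        have xc: "x \<in> carrier K" using frob.submodule_ofD(8)[OF J x] .
        have "f \<otimes>\<^bsub>K\<^esub> (b \<otimes>\<^bsub>K\<^esub> x) = x" using frob.m_assoc[OF fg(1) bc xc] b(2) xc by simp
        then show ?thesis using fg(3)[OF bx] by simp
      qed
      then show ?thesis using L(3) by blast
    next
      case 2
      then obtain b where b: "b \<in> colon K (F\<^sub>O A) (F\<^sub>O C)" "g \<otimes>\<^bsub>K\<^esub> a \<otimes>\<^bsub>K\<^esub> b = \<one>\<^bsub>K\<^esub>"
        using isomorphismD[OF AB(1) C(1)] \<psi>\<^sub>2(2) by metis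
      have "x \<in> a <#\<^bsub>K\<^esub> F\<^sub>O A" if x: "x \<in> L" for x
      proof -
        have bc: "b \<in> carrier K" using b(1) by (simp add: frob.colon_iff)
        have xc: "x \<in> carrier K" using frob.submodule_ofD(8)[OF L(1) x] .
        have y: "b \<otimes>\<^bsub>K\<^esub> (g \<otimes>\<^bsub>K\<^esub> x) \<in> F\<^sub>O A" using b(1) fg(4)[OF x] by (auto simp: frob.colon_iff)
        have "a \<otimes>\<^bsub>K\<^esub> (b \<otimes>\<^bsub>K\<^esub> (g \<otimes>\<^bsub>K\<^esub> x)) = (g \<otimes>\<^bsub>K\<^esub> a \<otimes>\<^bsub>K\<^esub> b) \<otimes>\<^bsub>K\<^esub> x"
          using ac bc fg(2) xc by (simp add: frob.m_ac)
        then have "a \<otimes>\<^bsub>K\<^esub> (b \<otimes>\<^bsub>K\<^esub> (g \<otimes>\<^bsub>K\<^esub> x)) = x" using b(2) xc by simp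
        then show ?thesis using y unfolding l_coset_def by force
      qed
      then show ?thesis using L(2) by blast
    qed
  qed
qed

end

theorem theorem3p6:
  fixes q :: nat and h :: "int poly"
    and V :: "('o, 'm) isog_cat"
    and F\<^sub>O :: "'o \<Rightarrow> rat poly set set" and F\<^sub>M :: "'o \<Rightarrow> 'o \<Rightarrow> 'm \<Rightarrow> rat poly set"
    and A B :: 'o and \<phi> :: 'm
    and I J :: "rat poly set set" and a :: "rat poly set"
  assumes "primepow q"
    and "weil_poly q h" and "ordinary_poly q h" and "no_repeated_complex_roots h"
    and "deligne_functor q h V F\<^sub>O F\<^sub>M"
    and "A \<in> Obj V" and "B \<in> Obj V"
    and "minimal_isogeny V A B \<phi>"
    and "I = F\<^sub>O A" and "J = F\<^sub>O B" and "a = F\<^sub>M A B \<phi>"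
  shows "(\<exists>!m. cokernel_maximal_ideal q h I J a m) \<and>
    (horizontal V F\<^sub>M A B \<or> vertical V F\<^sub>M A B) \<and>
    (End_in V F\<^sub>M A \<subseteq> End_in V F\<^sub>M B \<or> End_in V F\<^sub>M B \<subseteq> End_in V F\<^sub>M A) \<and>
    (\<forall>m. cokernel_maximal_ideal q h I J a m \<longrightarrow>
      (regular_ideal q h m \<longrightarrow> weakly_equivalent q h I J \<and> horizontal V F\<^sub>M A B) \<and>
      (vertical V F\<^sub>M A B \<longrightarrow> singular_ideal q h m) \<and>
      (\<forall>S T. (S = End_in V F\<^sub>M A \<and> T = End_in V F\<^sub>M B \<or> S = End_in V F\<^sub>M B \<and> T = End_in V F\<^sub>M A)
          \<and> S \<subseteq> T \<longrightarrow>
        (let R = frob_order q h;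
             TS = quot_module (submod (weil_algebra h) T) S
         in finite (carrier (R Quot m)) \<and> finite (carrier TS) \<and>
            module_length R TS \<noteq> \<infinity> \<and>
            Coset.order TS = Coset.order (R Quot m) ^ the_enat (module_length R TS) \<and>
            (vertical V F\<^sub>M A B \<longleftrightarrow> Coset.order (R Quot m) dvd Coset.order TS))))"
proof -
  interpret deligne q h V F\<^sub>O F\<^sub>M
    by (intro deligne.intro weil_polynomial.intro deligne_axioms.intro)
      (use assms(1,2,4,5) primepow_gt_0_nat in auto)
  let ?K = "weil_algebra h" and ?R = "carrier (frob_order q h)"
  let ?I = "a <#\<^bsub>?K\<^esub> I"
  have a: "a \<in> Units ?K" using minimal_simple_inclusion(1)[OF assms(6-8)] assms(11) by simp
  interpret simple_inclusion ?K ?R ?I J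
    using minimal_simple_inclusion(2)[OF assms(6-8)] assms(9-11) by simp
  have I: "frob.submodule_of I" and Ic: "I \<subseteq> carrier ?K"
    using F_lattice[OF assms(6)] frob.submodule_ofD(2) assms(9) by (auto simp: frob.lattice_in_def)
  have End_A: "End_in V F\<^sub>M A = End_I" and End_B: "End_in V F\<^sub>M B = End_J"
    using End_eq assms(6,7,9,10) frob.colon_self_scale[OF a Ic] by auto
  have order: "frob_order q h = ?K\<lparr>carrier := ?R\<rparr>" by (rule frob_order_eq)
  \<comment> \<open>This settles existence and uniqueness of m at once and turns every claim about m
    into one about \<open>ann\<close>.\<close>
  have coker: "cokernel_maximal_ideal q h I J a m \<longleftrightarrow> m = ann" for m
  proof
    assume "cokernel_maximal_ideal q h I J a m"
    then show "m = ann"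
      using residue_field_unique unfolding cokernel_maximal_ideal_def Let_def order[symmetric] by blast
  next
    assume "m = ann"
    then show "cokernel_maximal_ideal q h I J a m"
      using ann_maximal quotient_isomorphic_residue
      unfolding cokernel_maximal_ideal_def Let_def order[symmetric] by blast
  qed
  have vert: "vertical V F\<^sub>M A B \<longleftrightarrow> End_I \<noteq> End_J"
    using End_comparable unfolding vertical_def ascending_def descending_def End_A End_B by blast
  have hor: "horizontal V F\<^sub>M A B \<longleftrightarrow> End_I = End_J"
    unfolding horizontal_def End_A End_B ..
  have reg_iff: "regular_ideal q h ann \<longleftrightarrow> localization ?K ?R ann ?R = localization ?K ?R ann (maximal_order ?K)"
    by (simp add: regular_ideal_def Let_def)
  have weak: "weakly_equivalent q h I J" if reg: "regular_ideal q h ann"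
    unfolding weakly_equivalent_def Let_def
  proof (intro allI impI)
    fix n assume n: "maximalideal n (frob_order q h)"
    then have n': "maximalideal n (?K\<lparr>carrier := ?R\<rparr>)" unfolding order[symmetric] .
    obtain \<alpha> \<beta> where \<alpha>\<beta>: "\<alpha> \<in> colon ?K J ?I" "\<beta> \<in> colon ?K ?I J" "\<alpha> \<otimes>\<^bsub>?K\<^esub> \<beta> \<in> ?R - n"
      using regular_imp_locally_isomorphic[OF reg[unfolded reg_iff] n'] by blast
    have c: "\<alpha> \<in> carrier ?K" "\<beta> \<in> carrier ?K" "a \<in> carrier ?K" "inv\<^bsub>?K\<^esub> a \<in> carrier ?K"
      using \<alpha>\<beta> a by (auto simp: frob.colon_iff frob.Units_closed)
    \<comment> \<open>\<alpha> and \<beta> relate J to a I, whereas weak equivalence is claimed for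
      I itself. Passing to \<alpha> a and a^(-1) \<beta> leaves the product unchanged.\<close>
    have 1: "\<alpha> \<otimes>\<^bsub>?K\<^esub> a \<in> colon ?K J I" using \<alpha>\<beta>(1) frob.colon_scale_left[OF a c(1) Ic] by blast
    have 2: "inv\<^bsub>?K\<^esub> a \<otimes>\<^bsub>?K\<^esub> \<beta> \<in> colon ?K I J"
    proof -
      have "inv\<^bsub>?K\<^esub> a \<otimes>\<^bsub>?K\<^esub> \<beta> \<otimes>\<^bsub>?K\<^esub> x \<in> I" if x: "x \<in> J" for x
      proof -
        have "\<beta> \<otimes>\<^bsub>?K\<^esub> x \<in> ?I" using \<alpha>\<beta>(2) x by (auto simp: frob.colon_iff)
        then obtain y where y: "y \<in> I" "\<beta> \<otimes>\<^bsub>?K\<^esub> x = a \<otimes>\<^bsub>?K\<^esub> y" unfolding l_coset_def by blast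
        have yc: "y \<in> carrier ?K" using y Ic by blast
        have "inv\<^bsub>?K\<^esub> a \<otimes>\<^bsub>?K\<^esub> \<beta> \<otimes>\<^bsub>?K\<^esub> x = inv\<^bsub>?K\<^esub> a \<otimes>\<^bsub>?K\<^esub> (a \<otimes>\<^bsub>?K\<^esub> y)"
          using frob.m_assoc[OF c(4,2) JD(8)[OF x]] y(2) by simp
        also have "\<dots> = y" using frob.m_assoc[OF c(4,3) yc, symmetric] a yc by simp
        finally show ?thesis using y(1) by simp
      qed
      then show ?thesis using c by (simp add: frob.colon_iff)
    qed
    have "(\<alpha> \<otimes>\<^bsub>?K\<^esub> a) \<otimes>\<^bsub>?K\<^esub> (inv\<^bsub>?K\<^esub> a \<otimes>\<^bsub>?K\<^esub> \<beta>) = \<alpha> \<otimes>\<^bsub>?K\<^esub> ((a \<otimes>\<^bsub>?K\<^esub> inv\<^bsub>?K\<^esub> a) \<otimes>\<^bsub>?K\<^esub> \<beta>)"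
      using c frob.m_assoc by simp
    then have 3: "(\<alpha> \<otimes>\<^bsub>?K\<^esub> a) \<otimes>\<^bsub>?K\<^esub> (inv\<^bsub>?K\<^esub> a \<otimes>\<^bsub>?K\<^esub> \<beta>) \<in> ?R - n" using \<alpha>\<beta>(3) a c by simp
    show "module_isomorphic (completion (frob_order q h) n)
        (base_change (frob_order q h) (completion (frob_order q h) n) (to_completion (frob_order q h) n) (submod ?K I))
        (base_change (frob_order q h) (completion (frob_order q h) n) (to_completion (frob_order q h) n) (submod ?K J))"
      using frob.completed_isomorphic[OF n' I sub_J 1 2 3] unfolding order[symmetric] .
  qed
  have quot: "let R = frob_order q h; TS = quot_module (submod ?K T) S
      in finite (carrier (R Quot ann)) \<and> finite (carrier TS) \<and> module_length R TS \<noteq> \<infinity> \<and>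
        Coset.order TS = Coset.order (R Quot ann) ^ the_enat (module_length R TS) \<and>
        (vertical V F\<^sub>M A B \<longleftrightarrow> Coset.order (R Quot ann) dvd Coset.order TS)"
    if ST: "S = End_I \<and> T = End_J \<or> S = End_J \<and> T = End_I" "S \<subseteq> T" for S T
  proof -
    note E = End_quotient[OF ST, unfolded order[symmetric]]
    obtain n where n: "module_length (frob_order q h) (quot_module (submod ?K T) S) = enat n"
      "card (carrier (quot_module (submod ?K T) S)) = card (carrier (frob_order q h Quot ann)) ^ n"
      using E(4) by blast
    have "vertical V F\<^sub>M A B \<longleftrightarrow> S \<noteq> T" using vert ST(1) by auto
    also have "\<dots> \<longleftrightarrow> n \<noteq> 0" using E(3,5,6) n(2) by (cases n) auto
    also have "\<dots> \<longleftrightarrow> card (carrier (frob_order q h Quot ann)) dvd card (carrier (quot_module (submod ?K T) S))"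
      unfolding n(2) using E(3) by (cases n) auto
    finally show ?thesis using E(1,2) n by (simp add: Let_def Coset.order_def)
  qed
  show ?thesis
    unfolding coker End_A End_B
  proof (intro conjI allI impI; (elim conjE)?)
    show "\<exists>!m. m = ann" by simp
    show "horizontal V F\<^sub>M A B \<or> vertical V F\<^sub>M A B" using vert hor by blast
    show "End_I \<subseteq> End_J \<or> End_J \<subseteq> End_I" by (rule End_comparable)
    fix m assume m: "m = ann"
    show "weakly_equivalent q h I J" if "regular_ideal q h m" using weak that m by blast
    show "horizontal V F\<^sub>M A B" if "regular_ideal q h m"
      using regular_imp_End_eq that reg_iff m hor by blast
    show "singular_ideal q h m" if "vertical V F\<^sub>M A B"
      using regular_imp_End_eq that reg_iff m vert by blast
    fix S T assume "S = End_I \<and> T = End_J \<or> S = End_J \<and> T = End_I" "S \<subseteq> T"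
    then show "let R = frob_order q h; TS = quot_module (submod ?K T) S
      in finite (carrier (R Quot m)) \<and> finite (carrier TS) \<and> module_length R TS \<noteq> \<infinity> \<and>
        Coset.order TS = Coset.order (R Quot m) ^ the_enat (module_length R TS) \<and>
        (vertical V F\<^sub>M A B \<longleftrightarrow> Coset.order (R Quot m) dvd Coset.order TS)"
      unfolding m by (rule quot)
  qed
qed

end
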